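(* Let $\Omega\subset\mathbb{R}^d$ be a bounded domain with $C^2$ boundary, let $L$ be a reversible strict Tonelli Lagrangian on $\mathbb{R}^d$ with Hamiltonian $H$, and let $F:\mathbb{R}^d\times\mathcal{P}(\overline{\Omega})\to\mathbb{R}$. Assume: (F1) for every $m\in\mathcal{P}(\overline{\Omega})$ the function $x\mapsto F(x,m)$ is of class $C^2_b(\mathbb{R}^d)$, and $\mathcal{F}:=\sup_{m\in\mathcal{P}(\overline{\Omega})}\sum_{|\alpha|\le 2}\|D^\alpha F(\cdot,m)\|_\infty<+\infty$; (F2) $\displaystyle\sup_{x\in\mathbb{R}^d,\ m_1\ne m_2\in\mathcal{P}(\overline{\Omega})}\frac{|F(x,m_1)-F(x,m_2)|}{d_1(m_1,m_2)}<+\infty$; (A2) $\operatorname{argmin}_{x\in\mathbb{R}^d}\big(L(x,0)+F(x,m)\big)\cap\overline{\Omega}\ne\emptyset$ for all $m\in\mathcal{P}(\overline{\Omega})$. Then: (i) There exists at least one solution $(c_{H_{\bar m}},\bar u,\bar m)\in\mathbb{R}\times C(\overline{\Omega})\times\mathcal{P}(\overline{\Omega})$ of the constrained ergodic MFG system $$H(x,Du)=F(x,m)+\lambda\ \text{ in }\overline{\Omega},\qquad \operatorname{div}\big(mV(x)\big)=0\ \text{ in }\overline{\Omega},\qquad \int_{\overline{\Omega}}m(dx)=1,$$ with $\lambda=c_{H_{\bar m}}$. (ii) Assume in addition (F3) there is a constant $C_F>0$ such that for all $m_1,m_2\in\mathcal{P}(\overline{\Omega})$, $$\int_{\overline{\Omega}}(F(x,m_1)-F(x,m_2))\,d(m_1-m_2)\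 \ge\ C_F\int_{\overline{\Omega}}(F(x,m_1)-F(x,m_2))^2\,dx.$$ If $(c_{H_{\bar m_1}},\bar u_1,\bar m_1)$ and $(c_{H_{\bar m_2}},\bar u_2,\bar m_2)$ are two solutions of the constrained ergodic MFG system, then $F(x,\bar m_1)=F(x,\bar m_2)$ for all $x\in\overline{\Omega}$, and $c_{H_{\bar m_1}}=c_{H_{\bar m_2}}$.
   Context: Strict Tonelli Lagrangian: a $C^2$ function $L:\mathbb{R}^d\times\mathbb{R}^d\to\mathbb{R}$ for which there are constants $C_1,C_2,C_3>0$ with, for all $(x,v)$: (a) $\frac{I}{C_1}\le D^2_{vv}L(x,v)\le C_1 I$; (b) $\|D^2_{vx}L(x,v)\|\le C_2(1+|v|)$; (c) $|L(x,0)|+|D_xL(x,0)|+|D_vL(x,0)|\le C_3$. It is reversible if $L(x,v)=L(x,-v)$. Its Hamiltonian is $H(x,p)=\sup_{v}\{\langle p,v\rangle-L(x,v)\}$. $C^2_b(\mathbb{R}^d)$: bounded functions with bounded uniformly continuous first and second derivatives. $\mathcal{P}(\overline{\Omega})$: Borel probability measures on $\overline{\Omega}$, with weak-$*$ topology; $d_1$: the Kantorovich–Rubinstein (Wasserstein-1) distance. $\nu(x)$: outward unit normal at $x\in\partial\Omega$. $\pi_1:\overline{\Omega}\times\mathbb{R}^d\to\overline{\Omega}$: projection onto the first factor; $\sharp$ denotes push-forward. For $m\in\mathcal{P}(\overline{\Omega})$: $L_m(x,v)=L(x,v)+F(x,m)$ and $H_m(x,p)=H(x,p)-F(x,m)$;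 under (F1) these are again a reversible strict Tonelli Lagrangian and its Hamiltonian. Constrained viscosity solution of $G(x,Du)=c$ on $\overline{\Omega}$: $u\in C(\overline{\Omega})$ such that for every $\varphi\in C^1(\mathbb{R}^d)$: $G(x_0,D\varphi(x_0))\le c$ at every local maximum point $x_0\in\Omega$ of $u-\varphi$, and $G(x_0,D\varphi(x_0))\ge c$ at every point $x_0\in\overline{\Omega}$ which is a local minimum point of $u-\varphi$ relative to $\overline{\Omega}$. For a Tonelli Hamiltonian $G$ there is a unique constant, denoted $c_G$, for which $G(x,Du)=c_G$ has a constrained viscosity solution on $\overline{\Omega}$; $c_{H_m}$ is this constant for $G=H_m$. Mather (minimizing) measure for a reversible Tonelli Lagrangian $\ell$ (with $\operatorname{argmin}_{\mathbb{R}^d}\ell(\cdot,0)\cap\overline{\Omega}\neq\emptyset$): $\mu\in\mathcal{P}(\overline{\Omega}\times\mathbb{R}^d)$ whose extension $\bar\mu(B)=\mu(B\cap(\overline{\Omega}\times\mathbb{R}^d))$ to $\mathbb{R}^d\times\mathbb{R}^d$ is invariant under the Euler–Lagrange flow of $\ell$ (the flow on $\mathbb{R}^d\times\mathbb{R}^d$ of $\frac{d}{dt}D_v\ell(x,\dot x)=D_x\ell(x,\dot x)$) and whose support is contained in $\{(x,0)\in\overline{\Omega}\times\mathbb{R}^d:\ \ell(x,0)=\inf_{y\in\mathbb{R}^d}\ell(y,0)\}$. Superdifferential of $u\in C(\overline\Omega)$ at $x\in\overline\Omega$: $D^+u(x)=\{p\in\mathbb{R}^d:\limsup_{y\to x,\,y\in\overline{\Omega}}\frac{u(y)-u(x)-\langle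 p,y-x\rangle}{|y-x|}\le0\}$. For $x\in\partial\Omega$ write $p^\tau=p-\langle p,\nu(x)\rangle\nu(x)$, and set $\lambda_p(x)=\max\{\lambda:\ p^\tau+\lambda\nu(x)\in D^+u(x)\}$ for $p\in D^+u(x)$, and $\lambda_+(x)=\max\{\lambda_p(x):p\in D^+u(x)\}$. Calibrated curves: for a Lagrangian $\ell$ and constant $c$, a $C^1$ curve $\gamma:[a,b]\to\overline{\Omega}$ is $(u,\ell,c)$-calibrated if $u(\gamma(t'))-u(\gamma(t))=\int_t^{t'}\ell(\gamma,\dot\gamma)\,ds+c(t'-t)$ for all $a\le t<t'\le b$. If $x\in\partial\Omega$ and $\gamma:[-\tau,\tau]\to\overline\Omega$ is $(u,\ell,c)$-calibrated with $\gamma(0)=x$, the tangential gradient of $u$ at $x$ is $D^\tau u(x)=D_v\ell(x,\dot\gamma(0))-\langle D_v\ell(x,\dot\gamma(0)),\nu(x)\rangle\nu(x)$. (If $x\in\operatorname{spt}(\bar m)$ below, the constant curve at $x$ is $(\bar u,L_{\bar m},c_{H_{\bar m}})$-calibrated.) Solution of the constrained ergodic MFG system: a triple $(\bar\lambda,\bar u,\bar m)\in\mathbb{R}\times C(\overline{\Omega})\times\mathcal{P}(\overline{\Omega})$ such that (1) $\bar u$ is a constrained viscosity solution on $\overline{\Omega}$ of $H(x,Du)=F(x,\bar m)+\bar\lambda$; (2) $D\bar u(x)$ exists for $\bar m$-a.e. $x\in\overline{\Omega}$ (at boundary points, differentiability is understood relative to $\overline\Omega$); (3) $\bar m=\pi_1\sharp\eta_{\bar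 m}$ for some minimizing (Mather) measure $\eta_{\bar m}$ for $L_{\bar m}$; (4) $\int_{\overline{\Omega}}\langle Df(x),V(x)\rangle\,d\bar m(x)=0$ for all $f\in C^\infty(\overline{\Omega})$ with $\operatorname{spt}(f)\subset\Omega$, where $V(x)=D_pH(x,D\bar u(x))$ if $x\in\Omega\cap\operatorname{spt}(\bar m)$ (where $D\bar u(x)$ exists), and $V(x)=D_pH(x,D^\tau\bar u(x)+\lambda_+(x)\nu(x))$ if $x\in\partial\Omega\cap\operatorname{spt}(\bar m)$, with $D^\tau\bar u$, $\lambda_+$ defined for $u=\bar u$. *)

theory Defs
  imports "HOL-Probability.Probability"
begin

section \<open>Differentiability classes\<close>

definition grad :: "('a::real_inner \<Rightarrow> real) \<Rightarrow> 'a \<Rightarrow> 'a" where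
  "grad f x = (THE D. GDERIV f x :> D)"

definition dir_deriv :: "'a::real_normed_vector \<Rightarrow> ('a \<Rightarrow> 'b::real_normed_vector) \<Rightarrow> 'a \<Rightarrow> 'b" where
  "dir_deriv h f x = frechet_derivative f (at x) h"

text \<open>On a finite-dimensional space, continuity of all iterated directional derivatives
  up to order \<open>k\<close> is continuity of the derivatives up to order \<open>k\<close> in operator norm.\<close>

primrec Ck :: "nat \<Rightarrow> ('a::euclidean_space \<Rightarrow> real) \<Rightarrow> bool" where
  "Ck 0 f \<longleftrightarrow> continuous_on UNIV f"
| "Ck (Suc k) f \<longleftrightarrow> (\<forall>x. f differentiable (at x)) \<and> (\<forall>h. Ck k (dir_deriv h f))"

definition smooth :: "('a::euclidean_space \<Rightarrow> real) \<Rightarrow> bool" where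
  "smooth f \<longleftrightarrow> (\<forall>k. Ck k f)"

definition C2b :: "('a::euclidean_space \<Rightarrow> real) \<Rightarrow> bool" where
  "C2b f \<longleftrightarrow> Ck 2 f \<and> bounded (range f) \<and>
     (\<forall>i\<in>Basis. bounded (range (dir_deriv i f)) \<and> uniformly_continuous_on UNIV (dir_deriv i f)) \<and>
     (\<forall>i\<in>Basis. \<forall>j\<in>Basis. bounded (range (dir_deriv j (dir_deriv i f))) \<and>
        uniformly_continuous_on UNIV (dir_deriv j (dir_deriv i f)))"

definition sup_norm :: "('a \<Rightarrow> real) \<Rightarrow> real" where
  "sup_norm f = (SUP x. \<bar>f x\<bar>)"

text \<open>The sum of the sup norms of all partial derivatives of order at most 2. The sum runs
  over ordered pairs \<open>(i, j)\<close>, so mixed partials count twice compared with the sum over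
  multi-indices; this does not affect whether a family of such sums is bounded.\<close>

definition C2_norm :: "('a::euclidean_space \<Rightarrow> real) \<Rightarrow> real" where
  "C2_norm f = sup_norm f + (\<Sum>i\<in>Basis. sup_norm (dir_deriv i f))
     + (\<Sum>i\<in>Basis. \<Sum>j\<in>Basis. sup_norm (dir_deriv j (dir_deriv i f)))"

section \<open>Domains with \<open>C\<^sup>2\<close> boundary\<close>

text \<open>Near \<open>x\<close>, the set \<open>\<Omega>\<close> is the part above the graph (in direction \<open>e\<close>) of a \<open>C\<^sup>2\<close> function
  on the hyperplane orthogonal to \<open>e\<close>; \<open>\<gamma>\<close> only matters on that hyperplane.\<close>

definition boundary_graph ::
    "'a::euclidean_space set \<Rightarrow> 'a \<Rightarrow> real \<Rightarrow> 'a \<Rightarrow> ('a \<Rightarrow> real) \<Rightarrow> bool" where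
  "boundary_graph \<Omega> x r e \<gamma> \<longleftrightarrow> r > 0 \<and> norm e = 1 \<and> Ck 2 \<gamma> \<and>
     \<Omega> \<inter> ball x r = {y \<in> ball x r. y \<bullet> e > \<gamma> (y - (y \<bullet> e) *\<^sub>R e)}"

definition C2_bounded_domain :: "'a::euclidean_space set \<Rightarrow> bool" where
  "C2_bounded_domain \<Omega> \<longleftrightarrow> open \<Omega> \<and> connected \<Omega> \<and> \<Omega> \<noteq> {} \<and> bounded \<Omega> \<and>
     (\<forall>x\<in>frontier \<Omega>. \<exists>r e \<gamma>. boundary_graph \<Omega> x r e \<gamma>)"

text \<open>Locally \<open>\<Omega>\<close> is the sublevel set \<open>{\<phi> < 0}\<close> of \<open>\<phi> y = \<gamma> (y - (y \<bullet> e) *\<^sub>R e) - y \<bullet> e\<close>, whose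
  gradient has \<open>e\<close>-component -1; hence the outward unit normal is the normalised gradient
  of \<open>\<phi>\<close>, whatever local graph representation is used.\<close>

definition outward_normal :: "'a::euclidean_space set \<Rightarrow> 'a \<Rightarrow> 'a" where
  "outward_normal \<Omega> x = (THE n. \<exists>r e \<gamma>. boundary_graph \<Omega> x r e \<gamma> \<and>
     n = sgn (grad (\<lambda>y. \<gamma> (y - (y \<bullet> e) *\<^sub>R e) - y \<bullet> e) x))"

definition tangential :: "'a::euclidean_space set \<Rightarrow> 'a \<Rightarrow> 'a \<Rightarrow> 'a" where
  "tangential \<Omega> x p = p - (p \<bullet> outward_normal \<Omega> x) *\<^sub>R outward_normal \<Omega> x"

section \<open>Probability measures\<close>

definition prob_measures :: "'a::topological_space set \<Rightarrow> 'a measure set" where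
  "prob_measures K = {m. sets m = sets (restrict_space borel K) \<and> prob_space m}"

definition spt :: "'a::topological_space measure \<Rightarrow> 'a set" where
  "spt m = {x \<in> space m. \<forall>U. open U \<and> x \<in> U \<longrightarrow> emeasure m (U \<inter> space m) > 0}"

definition couplings :: "'a measure \<Rightarrow> 'a measure \<Rightarrow> ('a \<times> 'a) measure set" where
  "couplings m1 m2 = {\<pi>. sets \<pi> = sets (m1 \<Otimes>\<^sub>M m2) \<and> distr \<pi> m1 fst = m1 \<and> distr \<pi> m2 snd = m2}"

definition wasserstein1 :: "'a::metric_space measure \<Rightarrow> 'a measure \<Rightarrow> real" where
  "wasserstein1 m1 m2 = (INF \<pi>\<in>couplings m1 m2. \<integral>z. dist (fst z) (snd z) \<partial>\<pi>)"

section \<open>Tonelli Lagrangians and Hamiltonians\<close>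

definition D_x :: "('a::real_inner \<Rightarrow> 'a \<Rightarrow> real) \<Rightarrow> 'a \<Rightarrow> 'a \<Rightarrow> 'a" where
  "D_x L x v = grad (\<lambda>y. L y v) x"

definition D_v :: "('a::real_inner \<Rightarrow> 'a \<Rightarrow> real) \<Rightarrow> 'a \<Rightarrow> 'a \<Rightarrow> 'a" where
  "D_v L x v = grad (L x) v"

definition D_vv :: "('a::real_inner \<Rightarrow> 'a \<Rightarrow> real) \<Rightarrow> 'a \<Rightarrow> 'a \<Rightarrow> 'a \<Rightarrow> 'a" where
  "D_vv L x v = frechet_derivative (D_v L x) (at v)"

definition D_vx :: "('a::real_inner \<Rightarrow> 'a \<Rightarrow> real) \<Rightarrow> 'a \<Rightarrow> 'a \<Rightarrow> 'a \<Rightarrow> 'a" where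
  "D_vx L x v = frechet_derivative (\<lambda>y. D_v L y v) (at x)"

definition strict_tonelli :: "('a::euclidean_space \<Rightarrow> 'a \<Rightarrow> real) \<Rightarrow> bool" where
  "strict_tonelli L \<longleftrightarrow> Ck 2 (\<lambda>(x, v). L x v) \<and>
     (\<exists>C1>0. \<exists>C2>0. \<exists>C3>0. \<forall>x v.
        (\<forall>h. (h \<bullet> h) / C1 \<le> D_vv L x v h \<bullet> h \<and> D_vv L x v h \<bullet> h \<le> C1 * (h \<bullet> h)) \<and>
        onorm (D_vx L x v) \<le> C2 * (1 + norm v) \<and>
        \<bar>L x 0\<bar> + norm (D_x L x 0) + norm (D_v L x 0) \<le> C3)"

definition reversible :: "('a::real_vector \<Rightarrow> 'a \<Rightarrow> real) \<Rightarrow> bool" where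
  "reversible L \<longleftrightarrow> (\<forall>x v. L x v = L x (- v))"

definition hamiltonian :: "('a::real_inner \<Rightarrow> 'a \<Rightarrow> real) \<Rightarrow> 'a \<Rightarrow> 'a \<Rightarrow> real" where
  "hamiltonian L x p = (SUP v. p \<bullet> v - L x v)"

definition L_mf :: "('a::real_inner \<Rightarrow> 'a \<Rightarrow> real) \<Rightarrow> ('a \<Rightarrow> 'a measure \<Rightarrow> real) \<Rightarrow> 'a measure \<Rightarrow>
    'a \<Rightarrow> 'a \<Rightarrow> real" where
  "L_mf L F m x v = L x v + F x m"

definition H_mf :: "('a::real_inner \<Rightarrow> 'a \<Rightarrow> real) \<Rightarrow> ('a \<Rightarrow> 'a measure \<Rightarrow> real) \<Rightarrow> 'a measure \<Rightarrow>
    'a \<Rightarrow> 'a \<Rightarrow> real" where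
  "H_mf L F m x p = hamiltonian L x p - F x m"

section \<open>Constrained viscosity solutions\<close>

definition constrained_viscosity_solution ::
    "'a::euclidean_space set \<Rightarrow> ('a \<Rightarrow> 'a \<Rightarrow> real) \<Rightarrow> real \<Rightarrow> ('a \<Rightarrow> real) \<Rightarrow> bool" where
  "constrained_viscosity_solution \<Omega> G c u \<longleftrightarrow> continuous_on (closure \<Omega>) u \<and>
     (\<forall>\<phi>. Ck 1 \<phi> \<longrightarrow>
        (\<forall>x\<in>\<Omega>. (\<forall>\<^sub>F y in at x within \<Omega>. u y - \<phi> y \<le> u x - \<phi> x) \<longrightarrow> G x (grad \<phi> x) \<le> c) \<and>
        (\<forall>x\<in>closure \<Omega>. (\<forall>\<^sub>F y in at x within closure \<Omega>. u y - \<phi> y \<ge> u x - \<phi> x) \<longrightarrow>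
           G x (grad \<phi> x) \<ge> c))"

definition critical_value :: "'a::euclidean_space set \<Rightarrow> ('a \<Rightarrow> 'a \<Rightarrow> real) \<Rightarrow> real" where
  "critical_value \<Omega> G = (THE c. \<exists>u. constrained_viscosity_solution \<Omega> G c u)"

section \<open>Mather measures\<close>

definition EL_curve :: "('a::euclidean_space \<Rightarrow> 'a \<Rightarrow> real) \<Rightarrow> (real \<Rightarrow> 'a) \<Rightarrow> (real \<Rightarrow> 'a) \<Rightarrow> bool" where
  "EL_curve L \<gamma> \<gamma>' \<longleftrightarrow> (\<forall>t. (\<gamma> has_vector_derivative \<gamma>' t) (at t) \<and>
     ((\<lambda>s. D_v L (\<gamma> s) (\<gamma>' s)) has_vector_derivative D_x L (\<gamma> t) (\<gamma>' t)) (at t))"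

text \<open>For strict Tonelli Lagrangians the flow is complete and unique, so the description
  below is well defined for all times.\<close>

definition EL_flow :: "('a::euclidean_space \<Rightarrow> 'a \<Rightarrow> real) \<Rightarrow> real \<Rightarrow> 'a \<times> 'a \<Rightarrow> 'a \<times> 'a" where
  "EL_flow L t z = (THE w. \<exists>\<gamma> \<gamma>'. EL_curve L \<gamma> \<gamma>' \<and> (\<gamma> 0, \<gamma>' 0) = z \<and> (\<gamma> t, \<gamma>' t) = w)"

definition extend_measure_borel :: "'a::topological_space measure \<Rightarrow> 'a measure" where
  "extend_measure_borel \<mu> = distr \<mu> borel (\<lambda>z. z)"

definition mather_measure ::
    "'a::euclidean_space set \<Rightarrow> ('a \<Rightarrow> 'a \<Rightarrow> real) \<Rightarrow> ('a \<times> 'a) measure \<Rightarrow> bool" where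
  "mather_measure \<Omega> L \<mu> \<longleftrightarrow> \<mu> \<in> prob_measures (closure \<Omega> \<times> UNIV) \<and>
     (\<forall>t. distr (extend_measure_borel \<mu>) borel (EL_flow L t) = extend_measure_borel \<mu>) \<and>
     spt \<mu> \<subseteq> {(x, 0) | x. x \<in> closure \<Omega> \<and> L x 0 = (INF y. L y 0)}"

section \<open>Superdifferentials and tangential gradients\<close>

definition superdiff :: "'a::euclidean_space set \<Rightarrow> ('a \<Rightarrow> real) \<Rightarrow> 'a \<Rightarrow> 'a set" where
  "superdiff \<Omega> u x = {p. Limsup (at x within closure \<Omega>)
     (\<lambda>y. ereal ((u y - u x - p \<bullet> (y - x)) / norm (y - x))) \<le> 0}"

definition lambda_p :: "'a::euclidean_space set \<Rightarrow> ('a \<Rightarrow> real) \<Rightarrow> 'a \<Rightarrow> 'a \<Rightarrow> real" where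
  "lambda_p \<Omega> u x p =
     (GREATEST l. tangential \<Omega> x p + l *\<^sub>R outward_normal \<Omega> x \<in> superdiff \<Omega> u x)"

definition lambda_plus :: "'a::euclidean_space set \<Rightarrow> ('a \<Rightarrow> real) \<Rightarrow> 'a \<Rightarrow> real" where
  "lambda_plus \<Omega> u x = (GREATEST l. l \<in> lambda_p \<Omega> u x ` superdiff \<Omega> u x)"

definition calibrated :: "'a::euclidean_space set \<Rightarrow> ('a \<Rightarrow> real) \<Rightarrow> ('a \<Rightarrow> 'a \<Rightarrow> real) \<Rightarrow> real \<Rightarrow>
    real \<Rightarrow> real \<Rightarrow> (real \<Rightarrow> 'a) \<Rightarrow> bool" where
  "calibrated \<Omega> u L c a b \<gamma> \<longleftrightarrow>
     (let \<gamma>' = (\<lambda>t. vector_derivative \<gamma> (at t within {a..b})) in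
       \<gamma> ` {a..b} \<subseteq> closure \<Omega> \<and> \<gamma> differentiable_on {a..b} \<and> continuous_on {a..b} \<gamma>' \<and>
       (\<forall>t t'. a \<le> t \<and> t < t' \<and> t' \<le> b \<longrightarrow>
          u (\<gamma> t') - u (\<gamma> t) = integral {t..t'} (\<lambda>s. L (\<gamma> s) (\<gamma>' s)) + c * (t' - t)))"

definition tangential_grad :: "'a::euclidean_space set \<Rightarrow> ('a \<Rightarrow> real) \<Rightarrow> ('a \<Rightarrow> 'a \<Rightarrow> real) \<Rightarrow>
    real \<Rightarrow> 'a \<Rightarrow> 'a" where
  "tangential_grad \<Omega> u L c x = (THE g. \<exists>\<tau>>0. \<exists>\<gamma>. calibrated \<Omega> u L c (-\<tau>) \<tau> \<gamma> \<and> \<gamma> 0 = x \<and>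
     g = tangential \<Omega> x (D_v L x (vector_derivative \<gamma> (at 0))))"

section \<open>The constrained ergodic mean field game system\<close>

text \<open>The vector field is only specified on the support of \<open>m\<close>, at interior points where \<open>u\<close> is
  differentiable and at boundary points; it is set to 0 elsewhere, which concerns an \<open>m\<close>-null
  set for a solution. Note that
  \<^term>\<open>D_v\<close> of a Hamiltonian is its gradient in the momentum variable.\<close>

definition mfg_field :: "'a::euclidean_space set \<Rightarrow> ('a \<Rightarrow> 'a \<Rightarrow> real) \<Rightarrow>
    ('a \<Rightarrow> 'a measure \<Rightarrow> real) \<Rightarrow> ('a \<Rightarrow> real) \<Rightarrow> 'a measure \<Rightarrow> 'a \<Rightarrow> 'a" where
  "mfg_field \<Omega> L F u m x =
     (if x \<in> \<Omega> \<inter> spt m \<and> u differentiable (at x) then D_v (hamiltonian L) x (grad u x)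
      else if x \<in> frontier \<Omega> \<inter> spt m then
        D_v (hamiltonian L) x
          (tangential_grad \<Omega> u (L_mf L F m) (critical_value \<Omega> (H_mf L F m)) x
            + lambda_plus \<Omega> u x *\<^sub>R outward_normal \<Omega> x)
      else 0)"

text \<open>A smooth function on \<open>closure \<Omega>\<close> whose support lies in \<open>\<Omega>\<close> extends by 0 to a smooth
  function on the whole space; test functions are taken in this extended form.\<close>

definition mfg_solution :: "'a::euclidean_space set \<Rightarrow> ('a \<Rightarrow> 'a \<Rightarrow> real) \<Rightarrow>
    ('a \<Rightarrow> 'a measure \<Rightarrow> real) \<Rightarrow> real \<Rightarrow> ('a \<Rightarrow> real) \<Rightarrow> 'a measure \<Rightarrow> bool" where
  "mfg_solution \<Omega> L F c u m \<longleftrightarrow>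
     continuous_on (closure \<Omega>) u \<and> m \<in> prob_measures (closure \<Omega>) \<and>
     constrained_viscosity_solution \<Omega> (H_mf L F m) c u \<and>
     (AE x in m. u differentiable (at x within closure \<Omega>)) \<and>
     (\<exists>\<eta>. mather_measure \<Omega> (L_mf L F m) \<eta> \<and>
        m = distr \<eta> (restrict_space borel (closure \<Omega>)) fst) \<and>
     (\<forall>f. smooth f \<and> closure {x. f x \<noteq> 0} \<subseteq> \<Omega> \<longrightarrow>
        has_bochner_integral m (\<lambda>x. grad f x \<bullet> mfg_field \<Omega> L F u m x) 0)"

section \<open>Assumptions on the coupling\<close>

definition assm_F1 :: "'a::euclidean_space set \<Rightarrow> ('a \<Rightarrow> 'a measure \<Rightarrow> real) \<Rightarrow> bool" where
  "assm_F1 \<Omega> F \<longleftrightarrow> (\<forall>m\<in>prob_measures (closure \<Omega>). C2b (\<lambda>x. F x m)) \<and>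
     bdd_above ((\<lambda>m. C2_norm (\<lambda>x. F x m)) ` prob_measures (closure \<Omega>))"

definition assm_F2 :: "'a::euclidean_space set \<Rightarrow> ('a \<Rightarrow> 'a measure \<Rightarrow> real) \<Rightarrow> bool" where
  "assm_F2 \<Omega> F \<longleftrightarrow> bdd_above {\<bar>F x m1 - F x m2\<bar> / wasserstein1 m1 m2 | x m1 m2.
     m1 \<in> prob_measures (closure \<Omega>) \<and> m2 \<in> prob_measures (closure \<Omega>) \<and> m1 \<noteq> m2}"

definition assm_A2 :: "'a::euclidean_space set \<Rightarrow> ('a \<Rightarrow> 'a \<Rightarrow> real) \<Rightarrow>
    ('a \<Rightarrow> 'a measure \<Rightarrow> real) \<Rightarrow> bool" where
  "assm_A2 \<Omega> L F \<longleftrightarrow> (\<forall>m\<in>prob_measures (closure \<Omega>).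
     {x. is_arg_min (\<lambda>y. L y 0 + F y m) (\<lambda>_. True) x} \<inter> closure \<Omega> \<noteq> {})"

definition assm_F3 :: "'a::euclidean_space set \<Rightarrow> ('a \<Rightarrow> 'a measure \<Rightarrow> real) \<Rightarrow> bool" where
  "assm_F3 \<Omega> F \<longleftrightarrow> (\<exists>C>0. \<forall>m1\<in>prob_measures (closure \<Omega>). \<forall>m2\<in>prob_measures (closure \<Omega>).
     (\<integral>x. F x m1 - F x m2 \<partial>m1) - (\<integral>x. F x m1 - F x m2 \<partial>m2)
       \<ge> C * (LINT x:closure \<Omega>|lborel. (F x m1 - F x m2)\<^sup>2))"

end

theory Submission
  imports Defs
begin

text \<open>
  Reversibility makes \<open>L x\<close> minimal at zero velocity, so everything is governed by the rest cost
  \<open>f x m = L x 0 + F x m\<close>. The fixed-point condition on \<open>m\<close> becomes the variational inequality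
  \<open>\<integral>x. f x m \<partial>m \<le> f y m\<close> for \<open>y\<close> in \<open>closure \<Omega>\<close>. For measures on \<open>N + 1\<close> points it is solved
  approximately by Kuhn's combinatorial lemma, the weights being encoded by the stopping probabilities
  \<open>q \<in> [0, 1]\<^sup>N\<close>, for which optimality is a backward induction. One passes to the limit with Helly's and
  Skorohod's theorems, transporting \<open>closure \<Omega>\<close> to a compact set of reals.

  With \<open>c = - min f(\<sqdot>, m)\<close> the shifted Lagrangian is nonnegative and vanishes at the rest points. The
  solution \<open>u x\<close> is the least action needed to reach \<open>x\<close> from a rest point. It vanishes to
  first order at rest points, hence on the support of \<open>m\<close>, where the drift is then zero. The measure
  concentrated on the rest points is invariant because they are equilibria of the Euler--Lagrange
  flow; the flow itself has to be constructed, since the push-forward is only meaningful once the flow is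
  known to be measurable. Uniqueness is the Lasry--Lions monotonicity argument.
\<close>

section \<open>Couplings and the Wasserstein distance\<close>

text \<open>Kuhn's lemma lives on a cube, not on a simplex; stopping probabilities range over a cube
  independently of each other, and each coordinate has its own label, namely whether stopping there
  is cheaper than going on. All approximating measures are images of Lebesgue measure on the unit
  interval, so that \<open>wasserstein1\<close> is only ever bounded from above by an explicit
  coupling. The limit has to be coupled with the approximations as well: Skorohod's theorem supplies
  almost surely convergent representatives, but only for real distributions, and this is why
  \<open>closure \<Omega>\<close> is transported. (F2) bounds a quotient, which is 0 by convention
  when the distance vanishes; it becomes a Lipschitz bound only once distinct measures are known to
  have positive distance. \<open>critical_value\<close>, \<open>EL_flow\<close> and
  \<open>grad\<close> are definite descriptions, so existence and uniqueness precede any computation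
  with them. Minimising curves are never constructed: the supersolution inequality is an induction
  over all polygonal competitors.\<close>

lemma space_restrict_borel [simp]: "space (restrict_space borel K) = K"
  by (simp add: space_restrict_space)

lemma space_prob_measures: "m \<in> prob_measures K \<Longrightarrow> space m = K"
  unfolding prob_measures_def using sets_eq_imp_space_eq[of m "restrict_space borel K"] by simp

lemma prob_measures_prob: "m \<in> prob_measures K \<Longrightarrow> prob_space m"
  unfolding prob_measures_def by simp

lemma prob_measures_sets: "m \<in> prob_measures K \<Longrightarrow> sets m = sets (restrict_space borel K)"
  unfolding prob_measures_def by simp

lemma measurable_id_prob_measures: "m \<in> prob_measures K \<Longrightarrow> (\<lambda>x. x) \<in> measurable m borel"
  by (subst measurable_cong_sets[OF prob_measures_sets refl]) (auto intro: measurable_restrict_space1)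

lemma distr_in_prob_measures:
  assumes "prob_space M" "X \<in> measurable M (restrict_space borel K)"
  shows "distr M (restrict_space borel K) X \<in> prob_measures K"
  unfolding prob_measures_def using assms by (simp add: prob_space.prob_space_distr)

lemma continuous_on_measurable_prob_measures:
  fixes g :: "'a::topological_space \<Rightarrow> real"
  assumes "continuous_on K g" "sets m = sets (restrict_space borel K)"
  shows "g \<in> borel_measurable m"
  using borel_measurable_continuous_on_restrict[OF assms(1)] measurable_cong_sets[OF assms(2) refl] by blast

lemma integrable_prob_measures:
  fixes g :: "'a::topological_space \<Rightarrow> real"
  assumes "compact K" "continuous_on K g" "m \<in> prob_measures K"
  shows "integrable m g"
proof -
  interpret prob_space m using prob_measures_prob assms by blast
  obtain B where B: "\<forall>x\<in>K. \<bar>g x\<bar> \<le> B"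
    using compact_imp_bounded[OF compact_continuous_image[OF assms(2,1)]] unfolding bounded_iff by auto
  show ?thesis
    by (rule integrable_const_bound[where B=B])
       (use B space_prob_measures[OF assms(3)] prob_measures_sets[OF assms(3)] in
        \<open>auto intro!: AE_I2 continuous_on_measurable_prob_measures assms\<close>)
qed

text \<open>The joint law of \<open>X\<close> and \<open>Y\<close> is a coupling. All upper bounds
  for \<open>wasserstein1\<close> used below are of this kind, with both measures given as laws on
  one probability space.\<close>

lemma wasserstein1_distr_le:
  fixes X Y :: "'b \<Rightarrow> 'a::{second_countable_topology, metric_space}"
  assumes "prob_space M" and X: "X \<in> measurable M (restrict_space borel K)"
    and Y: "Y \<in> measurable M (restrict_space borel K)"
  shows "wasserstein1 (distr M (restrict_space borel K) X) (distr M (restrict_space borel K) Y)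
    \<le> (\<integral>w. dist (X w) (Y w) \<partial>M)"
proof -
  let ?N = "restrict_space borel K" 
  let ?\<pi> = "distr M (?N \<Otimes>\<^sub>M ?N) (\<lambda>w. (X w, Y w))"
  let ?m1 = "distr M ?N X" and ?m2 = "distr M ?N Y"
  have XY [measurable]: "(\<lambda>w. (X w, Y w)) \<in> measurable M (?N \<Otimes>\<^sub>M ?N)"
    using X Y by simp
  have id: "(\<lambda>x. x) \<in> measurable ?N borel"
    by (simp add: measurable_restrict_space1)
  have f: "fst \<in> measurable (?N \<Otimes>\<^sub>M ?N) borel" "snd \<in> measurable (?N \<Otimes>\<^sub>M ?N) borel"
    using measurable_compose[OF measurable_fst id] measurable_compose[OF measurable_snd id] by auto
  have d: "(\<lambda>z. dist (fst z) (snd z)) \<in> borel_measurable (?N \<Otimes>\<^sub>M ?N)"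
    using f by (rule borel_measurable_dist)
  have "?\<pi> \<in> couplings ?m1 ?m2"
  proof -
    have "sets ?\<pi> = sets (?m1 \<Otimes>\<^sub>M ?m2)"
      by (simp only: sets_distr) (rule sets_pair_measure_cong, auto)
    moreover have "distr ?\<pi> ?m1 fst = ?m1"
      using X Y by (subst distr_distr) (auto simp: o_def intro!: distr_cong)
    moreover have "distr ?\<pi> ?m2 snd = ?m2"
      using X Y by (subst distr_distr) (auto simp: o_def intro!: distr_cong)
    ultimately show ?thesis unfolding couplings_def by blast
  qed
  then have "wasserstein1 ?m1 ?m2 \<le> (\<integral>z. dist (fst z) (snd z) \<partial>?\<pi>)"
    unfolding wasserstein1_def
    by (intro cINF_lower) (auto intro!: bdd_belowI[where m=0])
  also have "\<dots> = (\<integral>w. dist (X w) (Y w) \<partial>M)"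
    using integral_distr[OF XY d] by simp
  finally show ?thesis .
qed

lemma couplings_nonempty:
  assumes "m1 \<in> prob_measures K" "m2 \<in> prob_measures K"
  shows "m1 \<Otimes>\<^sub>M m2 \<in> couplings m1 m2"
proof -
  interpret m1: prob_space m1 using assms prob_measures_prob by blast
  interpret m2: prob_space m2 using assms prob_measures_prob by blast
  interpret pair_prob_space m1 m2 ..
  have "distr (m1 \<Otimes>\<^sub>M m2) m1 fst = m1" by (rule m2.distr_pair_fst)
  moreover have "distr (m1 \<Otimes>\<^sub>M m2) m2 snd = m2"
  proof (rule measure_eqI)
    fix A assume A: "A \<in> sets (distr (m1 \<Otimes>\<^sub>M m2) m2 snd)"
    then have "A \<in> sets m2" by simp
    then have e: "snd -` A \<inter> space (m1 \<Otimes>\<^sub>M m2) = space m1 \<times> A"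
      using sets.sets_into_space by (auto simp: space_pair_measure)
    show "emeasure (distr (m1 \<Otimes>\<^sub>M m2) m2 snd) A = emeasure m2 A"
      using \<open>A \<in> sets m2\<close>
      by (simp add: emeasure_distr e m2.emeasure_pair_measure_Times m1.emeasure_space_1)
  qed simp
  ultimately show ?thesis unfolding couplings_def by blast
qed

text \<open>The elementary half of Kantorovich-Rubinstein duality: integrate
  \<open>g (fst z) - g (snd z)\<close> against an arbitrary coupling, then take the infimum.
  Dividing by \<open>C\<close> puts the bound under the infimum, so \<open>C = 0\<close>, where
  \<open>g\<close> is constant on \<open>K\<close>, is treated apart.\<close>

lemma lipschitz_integral_diff_le:
  fixes g :: "'a::{second_countable_topology, metric_space} \<Rightarrow> real"
  assumes K: "compact K" and m: "m1 \<in> prob_measures K" "m2 \<in> prob_measures K"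
    and g: "continuous_on K g" and lip: "\<And>x y. x \<in> K \<Longrightarrow> y \<in> K \<Longrightarrow> \<bar>g x - g y\<bar> \<le> C * dist x y" and C: "C \<ge> 0"
  shows "\<bar>(\<integral>x. g x \<partial>m1) - (\<integral>x. g x \<partial>m2)\<bar> \<le> C * wasserstein1 m1 m2"
proof (cases "C = 0")
  case True
  interpret m1: prob_space m1 using m prob_measures_prob by blast
  interpret m2: prob_space m2 using m prob_measures_prob by blast
  obtain x0 where x0: "x0 \<in> K" using m1.not_empty m space_prob_measures by fastforce
  have c: "g x = g x0" if "x \<in> K" for x using lip[OF that x0] True by simp
  have "(\<integral>x. g x \<partial>m1) = (\<integral>x. g x0 \<partial>m1)" "(\<integral>x. g x \<partial>m2) = (\<integral>x. g x0 \<partial>m2)"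
    by (rule Bochner_Integration.integral_cong; use c space_prob_measures m in blast)+
  then show ?thesis using True by (simp add: m1.prob_space m2.prob_space)
next
  case False
  with C have C: "C > 0" by simp
  have "\<bar>(\<integral>x. g x \<partial>m1) - (\<integral>x. g x \<partial>m2)\<bar> / C \<le> (\<integral>z. dist (fst z) (snd z) \<partial>\<pi>)" if pi: "\<pi> \<in> couplings m1 m2" for \<pi>
  proof -
    have s: "sets \<pi> = sets (m1 \<Otimes>\<^sub>M m2)" and d1: "distr \<pi> m1 fst = m1" and d2: "distr \<pi> m2 snd = m2"
      using pi unfolding couplings_def by auto
    have [measurable]: "fst \<in> measurable \<pi> m1" "snd \<in> measurable \<pi> m2"
      using measurable_cong_sets[OF s refl] measurable_fst measurable_snd by blast+
    have sp: "space \<pi> = K \<times> K"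
      using sets_eq_imp_space_eq[OF s] space_prob_measures[OF m(1)] space_prob_measures[OF m(2)] by (simp add: space_pair_measure)
    have v: "fst -` space m1 \<inter> space \<pi> = space \<pi>"
      unfolding sp space_prob_measures[OF m(1)] by auto
    \<comment> \<open>\<open>couplings\<close> does not ask for a probability measure; the total
      mass is inherited from the first marginal.\<close>
    have "emeasure \<pi> (space \<pi>) = emeasure (distr \<pi> m1 fst) (space m1)"
      by (subst emeasure_distr) (simp_all only: v, measurable)
    then interpret p: prob_space \<pi>
      unfolding d1 prob_space.emeasure_space_1[OF prob_measures_prob[OF m(1)]] by (rule prob_spaceI)
    note idm = measurable_id_prob_measures[OF m(1)] measurable_id_prob_measures[OF m(2)]
    have fb: "fst \<in> measurable \<pi> borel" "snd \<in> measurable \<pi> borel"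
      using measurable_compose[OF _ idm(1), of fst \<pi>] measurable_compose[OF _ idm(2), of snd \<pi>] by auto
    have db: "(\<lambda>z. dist (fst z) (snd z)) \<in> borel_measurable \<pi>"
      using fb by (rule borel_measurable_dist)
    have di: "integrable \<pi> (\<lambda>z. dist (fst z) (snd z))"
      by (rule p.integrable_const_bound[where B="diameter K"])
         (use sp db diameter_bounded_bound[OF compact_imp_bounded[OF K]] in \<open>auto intro!: AE_I2\<close>)
    have gm: "g \<in> borel_measurable m1" "g \<in> borel_measurable m2"
      using m prob_measures_sets g continuous_on_measurable_prob_measures by blast+
    have i1: "integrable \<pi> (\<lambda>z. g (fst z))" "integrable \<pi> (\<lambda>z. g (snd z))"
      using integrable_prob_measures[OF K g] m d1 d2
        integrable_distr_eq[of fst \<pi> m1 g] integrable_distr_eq[of snd \<pi> m2 g] gm by auto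
    have e1: "(\<integral>x. g x \<partial>m1) = (\<integral>z. g (fst z) \<partial>\<pi>)"
      using integral_distr[of fst \<pi> m1 g] gm d1 by simp
    have e2: "(\<integral>x. g x \<partial>m2) = (\<integral>z. g (snd z) \<partial>\<pi>)"
      using integral_distr[of snd \<pi> m2 g] gm d2 by simp
    have "\<bar>(\<integral>x. g x \<partial>m1) - (\<integral>x. g x \<partial>m2)\<bar> = \<bar>\<integral>z. g (fst z) - g (snd z) \<partial>\<pi>\<bar>"
      using e1 e2 i1 by simp
    also have "\<dots> \<le> (\<integral>z. \<bar>g (fst z) - g (snd z)\<bar> \<partial>\<pi>)" by (rule integral_abs_bound)
    also have "\<dots> \<le> (\<integral>z. C * dist (fst z) (snd z) \<partial>\<pi>)"
      using lip sp i1 di by (intro integral_mono) auto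
    finally show ?thesis using C di by (simp add: field_simps)
  qed
  then have "\<bar>(\<integral>x. g x \<partial>m1) - (\<integral>x. g x \<partial>m2)\<bar> / C \<le> wasserstein1 m1 m2"
    unfolding wasserstein1_def using couplings_nonempty[OF m] by (intro cINF_greatest) auto
  then show ?thesis using C by (simp add: field_simps)
qed

text \<open>The cut-offs \<open>max 0 (1 - k * infdist x B)\<close> are \<open>k\<close>-Lipschitz
  and decrease to the indicator of the closed set \<open>B\<close>, so distance zero forces
  agreement on closed sets, and these generate the Borel sets. With this the quotient in (F2) can be
  multiplied out.\<close>

lemma wasserstein1_eq_0_imp_eq:
  fixes K :: "'a::{second_countable_topology, metric_space} set"
  assumes K: "compact K" and m: "m1 \<in> prob_measures K" "m2 \<in> prob_measures K"
    and W: "wasserstein1 m1 m2 = 0"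
  shows "m1 = m2"
proof -
  interpret m1: prob_space m1 using m prob_measures_prob by blast
  interpret m2: prob_space m2 using m prob_measures_prob by blast
  have lim: "(\<lambda>k. \<integral>x. max 0 (1 - real k * infdist x B) \<partial>m) \<longlonglongrightarrow> measure m (B \<inter> K)"
    if B: "closed B" "B \<noteq> {}" and m: "m \<in> prob_measures K" for B and m :: "'a measure"
  proof -
    interpret prob_space m using m prob_measures_prob by blast
    have "(\<lambda>k. \<integral>x. max 0 (1 - real k * infdist x B) \<partial>m) \<longlonglongrightarrow> (\<integral>x. indicator B x \<partial>m)"
    proof (rule integral_dominated_convergence[where w="\<lambda>_. 1"])
      have "(indicator B :: 'a \<Rightarrow> real) \<in> borel_measurable (restrict_space borel K)"
        using B(1) by (intro measurable_restrict_space1 borel_measurable_indicator) simp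
      then show "(indicator B :: 'a \<Rightarrow> real) \<in> borel_measurable m"
        using measurable_cong_sets[OF prob_measures_sets[OF m] refl] by blast
      show "(\<lambda>x. max 0 (1 - real k * infdist x B)) \<in> borel_measurable m" for k
        by (rule continuous_on_measurable_prob_measures[OF _ prob_measures_sets[OF m]]) (intro continuous_intros)
      show "AE x in m. (\<lambda>k. max 0 (1 - real k * infdist x B)) \<longlonglongrightarrow> indicator B x"
      proof (rule AE_I2)
        fix x
        show "(\<lambda>k. max 0 (1 - real k * infdist x B)) \<longlonglongrightarrow> indicator B x"
        proof (cases "x \<in> B")
          case True then show ?thesis by simp
        next
          case False
          then have p: "infdist x B > 0"
            using B in_closed_iff_infdist_zero infdist_nonneg by (metis less_eq_real_def)
          have "\<forall>\<^sub>F k in sequentially. max 0 (1 - real k * infdist x B) = 0"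
            using eventually_ge_at_top[of "nat \<lceil>1 / infdist x B\<rceil>"]
          proof eventually_elim
            case (elim k)
            then have "1 / infdist x B \<le> real k" by linarith
            with p show ?case by (simp add: field_simps)
          qed
          with False show ?thesis by (simp add: tendsto_eventually)
        qed
      qed
      show "AE x in m. norm (max 0 (1 - real k * infdist x B)) \<le> 1" for k
        by (auto simp: infdist_nonneg)
    qed simp
    then show ?thesis by (simp add: space_prob_measures[OF m])
  qed
  have eqB: "emeasure m1 (B \<inter> K) = emeasure m2 (B \<inter> K)" if B: "closed B" for B
  proof (cases "B = {}")
    case False
    have "(\<integral>x. max 0 (1 - real k * infdist x B) \<partial>m1) = (\<integral>x. max 0 (1 - real k * infdist x B) \<partial>m2)" for k
    proof -
      have "\<bar>max 0 (1 - real k * infdist x B) - max 0 (1 - real k * infdist y B)\<bar> \<le> real k * dist x y" for x y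
      proof -
        have "\<bar>infdist x B - infdist y B\<bar> \<le> dist x y"
          using infdist_triangle_abs by blast
        then have "real k * \<bar>infdist x B - infdist y B\<bar> \<le> real k * dist x y" by (simp add: mult_left_mono)
        then have "\<bar>real k * infdist x B - real k * infdist y B\<bar> \<le> real k * dist x y"
          by (simp add: abs_mult flip: right_diff_distrib)
        then show ?thesis by linarith
      qed
      then have "\<bar>(\<integral>x. max 0 (1 - real k * infdist x B) \<partial>m1) - (\<integral>x. max 0 (1 - real k * infdist x B) \<partial>m2)\<bar> \<le> real k * wasserstein1 m1 m2"
        by (intro lipschitz_integral_diff_le[OF K m]) (auto intro!: continuous_intros)
      then show ?thesis using W by simp
    qed
    then have "measure m1 (B \<inter> K) = measure m2 (B \<inter> K)"
      using lim[OF B False m(1)] lim[OF B False m(2)] LIMSEQ_unique by simp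
    then show ?thesis by (simp add: m1.emeasure_eq_measure m2.emeasure_eq_measure)
  qed simp
  note idm = measurable_id_prob_measures
  have em: "emeasure (distr m borel (\<lambda>x. x)) A = emeasure m (A \<inter> K)" if "m \<in> prob_measures K" "A \<in> sets borel" for m :: "'a measure" and A
    using that(2) idm[OF that(1)] space_prob_measures[OF that(1)] by (simp add: emeasure_distr vimage_def Int_def)
  \<comment> \<open>Both measures are pushed to the Borel sets of the whole space, which the
    intersection-stable family of closed sets generates; \<open>eqA\<close> brings the equality back
    to \<open>K\<close>.\<close>
  have "distr m1 borel (\<lambda>x. x) = distr m2 borel (\<lambda>x. x)"
  proof (rule measure_eqI_generator_eq[where E="Collect closed" and \<Omega>=UNIV and A="\<lambda>_. UNIV"])
    show "Int_stable (Collect closed :: 'a set set)" by (auto simp: Int_stable_def)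
    show "sets (distr m1 borel (\<lambda>x. x)) = sigma_sets UNIV (Collect closed)"
      "sets (distr m2 borel (\<lambda>x. x)) = sigma_sets UNIV (Collect closed)"
      by (simp_all add: borel_eq_closed)
    show "\<And>X. X \<in> Collect closed \<Longrightarrow> emeasure (distr m1 borel (\<lambda>x. x)) X = emeasure (distr m2 borel (\<lambda>x. x)) X"
      using em m eqB by (metis borel_closed mem_Collect_eq)
    show "emeasure (distr m1 borel (\<lambda>x. x)) UNIV \<noteq> \<infinity>" 
      using em[OF m(1), of UNIV] by simp
  qed auto
  then have eqA: "emeasure m1 (A \<inter> K) = emeasure m2 (A \<inter> K)" if "A \<in> sets borel" for A
    using em m that by metis
  show ?thesis
  proof (rule measure_eqI)
    show "sets m1 = sets m2" using m prob_measures_sets by metis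
    fix A assume "A \<in> sets m1"
    then obtain B where "B \<in> sets borel" "A = B \<inter> K"
      using prob_measures_sets[OF m(1)] by (auto simp: sets_restrict_space)
    then show "emeasure m1 A = emeasure m2 A" using eqA by simp
  qed
qed

section \<open>Compact sets as continuous images of compact sets of reals\<close>

text \<open>Cantor space inside a product of real lines: it is compact by Tychonoff's theorem, and
  its digits enter the series below without conversion.\<close>

definition bit_seqs :: "(nat \<Rightarrow> real) set" where
  "bit_seqs = {b. \<forall>n. b n \<in> {0, 1}}"

lemma compact_bit_seqs: "compact bit_seqs"
proof -
  have "compactin (product_topology (\<lambda>i. euclidean) UNIV) (PiE UNIV (\<lambda>_. {0, 1::real}))"
    by (subst compactin_PiE) (simp add: finite_imp_compact)
  moreover have "PiE UNIV (\<lambda>_. {0, 1::real}) = bit_seqs"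
    by (auto simp: bit_seqs_def PiE_def Pi_def)
  ultimately show ?thesis by (metis compactin_euclidean_iff euclidean_product_topology)
qed

lemma bit_seqs_summable:
  fixes r :: real
  assumes "b \<in> bit_seqs" "0 \<le> r" "r < 1"
  shows "summable (\<lambda>k. b (h k) * r ^ k)"
proof (rule summable_comparison_test'[where N=0])
  show "summable (\<lambda>k. r ^ k)" using assms by (simp add: summable_geometric)
  fix n
  have "b (h n) \<in> {0, 1}" using assms(1) unfolding bit_seqs_def by blast
  then show "norm (b (h n) * r ^ n) \<le> r ^ n" using assms(2) by auto
qed

text \<open>Needed for two ratios: 1/3 embeds Cantor space into the reals, 1/2 covers intervals. The
  index map \<open>h\<close> extracts the digits that belong to one coordinate of a vector.\<close>

lemma continuous_on_digit_sum:
  fixes r :: real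
  assumes "0 \<le> r" "r < 1"
  shows "continuous_on bit_seqs (\<lambda>b. \<Sum>k. b (h k) * r ^ k)"
proof (rule uniform_limit_theorem)
  show "uniform_limit bit_seqs (\<lambda>n b. \<Sum>k<n. b (h k) * r ^ k) (\<lambda>b. \<Sum>k. b (h k) * r ^ k) sequentially"
  proof (rule Weierstrass_m_test)
    show "summable (\<lambda>k. r ^ k)" using assms by (simp add: summable_geometric)
    fix n b assume "b \<in> bit_seqs"
    then have "b (h n) \<in> {0, 1}" unfolding bit_seqs_def by blast
    then show "norm (b (h n) * r ^ n) \<le> r ^ n" using assms(1) by auto
  qed
  show "\<forall>\<^sub>F n in sequentially. continuous_on bit_seqs (\<lambda>b. \<Sum>k<n. b (h k) * r ^ k)"
    by (intro always_eventually allI continuous_intros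
        continuous_on_subset[OF continuous_on_product_coordinates]) auto
qed simp

text \<open>At the first difference the digit contributes \<open>(1/3) ^ k\<close>, whereas all
  later digits together can take away at most half of this. In base 2 the tail could make up for the
  digit, and injectivity would fail.\<close>

lemma ternary_less:
  assumes b: "b \<in> bit_seqs" "b' \<in> bit_seqs" and eq: "\<And>n. n < k \<Longrightarrow> b n = b' n" and k: "b k = 1" "b' k = 0"
  shows "(\<Sum>n. b' n * (1/3) ^ n) < (\<Sum>n. b n * (1/3::real) ^ n)"
proof -
  let ?f = "\<lambda>n. (b n - b' n) * (1/3::real) ^ n"
  have s: "summable (\<lambda>n. b n * (1/3::real) ^ n)" "summable (\<lambda>n. b' n * (1/3::real) ^ n)"
    using bit_seqs_summable[of b "1/3" "\<lambda>n. n"] bit_seqs_summable[of b' "1/3" "\<lambda>n. n"] b by auto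
  then have sf: "summable ?f" using summable_diff[OF s] by (simp add: algebra_simps)
  have "(\<Sum>n. ?f n) = (\<Sum>n. ?f (n + Suc k)) + sum ?f {..<Suc k}"
    by (rule suminf_split_initial_segment[OF sf])
  moreover have "sum ?f {..<Suc k} = (1/3) ^ k"
    using eq k by simp
  moreover have "(\<Sum>n. - ((1/3) ^ (Suc k) * (1/3::real) ^ n)) \<le> (\<Sum>n. ?f (n + Suc k))"
  proof (rule suminf_le)
    show "summable (\<lambda>n. ?f (n + Suc k))" by (rule summable_ignore_initial_segment[OF sf])
    show "summable (\<lambda>n. - ((1/3) ^ (Suc k) * (1/3::real) ^ n))"
      by (intro summable_minus summable_mult summable_geometric) auto
    fix n
    have "b (n + Suc k) \<in> {0,1}" "b' (n + Suc k) \<in> {0,1}" using b unfolding bit_seqs_def by blast+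
    then show "- ((1/3) ^ (Suc k) * (1/3::real) ^ n) \<le> ?f (n + Suc k)"
      by (auto simp: power_add mult.commute)
  qed
  moreover have "(\<Sum>n. - ((1/3) ^ (Suc k) * (1/3::real) ^ n)) = - ((1/3) ^ (Suc k) * (3/2))"
  proof -
    have "(\<lambda>n. (1/3::real) ^ n) sums (3/2)" using geometric_sums[of "1/3::real"] by simp
    then have "(\<lambda>n. - ((1/3) ^ (Suc k) * (1/3::real) ^ n)) sums - ((1/3) ^ (Suc k) * (3/2))"
      by (intro sums_minus sums_mult)
    then show ?thesis by (rule sums_unique[symmetric])
  qed
  moreover have "(1/3::real) ^ k > 0" "(1/3::real) ^ Suc k * (3/2) = (1/3) ^ k / 2" by simp_all
  ultimately have "(\<Sum>n. ?f n) > 0" by linarith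
  moreover have "(\<Sum>n. ?f n) = (\<Sum>n. b n * (1/3::real) ^ n) - (\<Sum>n. b' n * (1/3::real) ^ n)"
    using suminf_diff[OF s] by (simp add: algebra_simps)
  ultimately show ?thesis by simp
qed

lemma inj_on_ternary: "inj_on (\<lambda>b. \<Sum>n. b n * (1/3::real) ^ n) bit_seqs"
proof (rule inj_onI, rule ccontr)
  fix b b' assume b: "b \<in> bit_seqs" "b' \<in> bit_seqs" 
    and e: "(\<Sum>n. b n * (1/3::real) ^ n) = (\<Sum>n. b' n * (1/3) ^ n)" and ne: "b \<noteq> b'"
  define k where "k = (LEAST n. b n \<noteq> b' n)"
  obtain n where "b n \<noteq> b' n" using ne by auto
  then have k: "b k \<noteq> b' k" unfolding k_def by (rule LeastI)
  have l: "b n = b' n" if "n < k" for n using not_less_Least[of n "\<lambda>n. b n \<noteq> b' n"] that unfolding k_def by blast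
  have "b k \<in> {0,1}" "b' k \<in> {0,1}" using b unfolding bit_seqs_def by blast+
  with k consider "b k = 1 \<and> b' k = 0" | "b' k = 1 \<and> b k = 0" by auto
  then show False
    using ternary_less[of b b' k] ternary_less[of b' b k] b l e by cases auto
qed

text \<open>The weights start at \<open>(1/2) ^ 0\<close>, so the digits sum to
  \<open>2 * x\<close>.\<close>

lemma binary_expansion:
  fixes x :: real
  assumes "0 \<le> x" "x < 1"
  obtains b where "b \<in> bit_seqs" "(\<Sum>k. b k * (1/2) ^ k) = 2 * x"
proof
  let ?b = "\<lambda>k. of_int (\<lfloor>2 ^ Suc k * x\<rfloor> - 2 * \<lfloor>2 ^ k * x\<rfloor>) :: real"
  have "\<lfloor>2 ^ Suc k * x\<rfloor> - 2 * \<lfloor>2 ^ k * x\<rfloor> \<in> {0, 1}" for k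
  proof -
    have e: "2 ^ Suc k * x = 2 * (2 ^ k * x)" by simp
    have "2 * \<lfloor>2 ^ k * x\<rfloor> \<le> \<lfloor>2 * (2 ^ k * x)\<rfloor> \<and> \<lfloor>2 * (2 ^ k * x)\<rfloor> \<le> 2 * \<lfloor>2 ^ k * x\<rfloor> + 1"
      by linarith
    then show ?thesis unfolding e by auto
  qed
  then have "?b k \<in> {0, 1}" for k
    by (metis insert_iff of_int_0 of_int_1 singletonD)
  then show "?b \<in> bit_seqs" unfolding bit_seqs_def by blast
  \<comment> \<open>The digits telescope to a dyadic truncation of \<open>x\<close>; the initial
    term \<open>\<lfloor>x\<rfloor>\<close> vanishes because \<open>0 \<le> x\<close> and
    \<open>x < 1\<close>.\<close>
  have p: "(\<Sum>k<n. ?b k * (1/2) ^ k) = 2 * (of_int \<lfloor>2 ^ n * x\<rfloor> * (1/2) ^ n)" for n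
  proof (induction n)
    case 0 then show ?case using assms by (simp add: floor_eq_iff)
  next
    case (Suc n) then show ?case by (simp add: field_simps)
  qed
  have "(\<lambda>n. of_int \<lfloor>2 ^ n * x\<rfloor> * (1/2::real) ^ n) \<longlonglongrightarrow> x"
  proof (rule tendsto_sandwich[of "\<lambda>n. x - (1/2) ^ n" _ _ "\<lambda>_. x"])
    have "x - (1/2) ^ n \<le> of_int \<lfloor>2 ^ n * x\<rfloor> * (1/2::real) ^ n \<and> of_int \<lfloor>2 ^ n * x\<rfloor> * (1/2::real) ^ n \<le> x" for n
    proof -
      have "(2 ^ n * x - 1) * (1/2::real) ^ n \<le> of_int \<lfloor>2 ^ n * x\<rfloor> * (1/2::real) ^ n"
        by (intro mult_right_mono) (linarith, simp)
      moreover have "of_int \<lfloor>2 ^ n * x\<rfloor> * (1/2::real) ^ n \<le> (2 ^ n * x) * (1/2) ^ n"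
        by (intro mult_right_mono) (linarith, simp)
      moreover have "(2::real) ^ n * (1/2) ^ n = 1" by (simp flip: power_mult_distrib)
      then have "(2 ^ n * x) * (1/2) ^ n = x" "(2 ^ n * x - 1) * (1/2::real) ^ n = x - (1/2) ^ n"
        by (simp_all add: left_diff_distrib)
      ultimately show ?thesis by (simp only:)
    qed
    then show "\<forall>\<^sub>F n in sequentially. x - (1/2) ^ n \<le> of_int \<lfloor>2 ^ n * x\<rfloor> * (1/2::real) ^ n"
       "\<forall>\<^sub>F n in sequentially. of_int \<lfloor>2 ^ n * x\<rfloor> * (1/2::real) ^ n \<le> x" by auto
    show "(\<lambda>n. x - (1/2) ^ n) \<longlonglongrightarrow> x"
      using tendsto_diff[OF tendsto_const LIMSEQ_power_zero[of "1/2::real"], of x] by simp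
  qed simp
  then have "(\<lambda>k. ?b k * (1/2) ^ k) sums (2 * x)"
    unfolding sums_def p by (intro tendsto_mult tendsto_const)
  then show "(\<Sum>k. ?b k * (1/2) ^ k) = 2 * x" by (rule sums_unique[symmetric])
qed

text \<open>Base-2 digits, one sequence per coordinate, map Cantor space onto a set containing
  \<open>K\<close>; the base-3 map embeds it into the reals. On the closed preimage of
  \<open>K\<close> the embedding has a continuous inverse, and the composite covers
  \<open>K\<close>. Theorems on real distributions thereby serve measures on
  \<open>K\<close>.\<close>

lemma compact_eq_continuous_image_real_compact:
  fixes K :: "'a::euclidean_space set"
  assumes "compact K"
  obtains C :: "real set" and g where "compact C" "continuous_on C g" "g ` C = K"
proof -
  obtain R where R: "R > 0" "\<forall>x\<in>K. norm x < R"
    using compact_imp_bounded[OF assms] bounded_pos_less by blast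
  obtain idx :: "'a \<Rightarrow> nat" where idx: "inj_on idx Basis"
    using finite_imp_inj_to_nat_seg[OF finite_Basis] by metis
  \<comment> \<open>\<open>prod_encode\<close> packs the digit sequences of all coordinates into
    one. A digit sum \<open>2 * t\<close> is sent to \<open>-R + 2 * R * t\<close>, so
    \<open>[0, 1)\<close> covers \<open>[-R, R)\<close>; the strict bound by \<open>R\<close> keeps
    \<open>t\<close> below 1.\<close>
  define \<Phi> :: "(nat \<Rightarrow> real) \<Rightarrow> 'a" where
    "\<Phi> b = (\<Sum>i\<in>Basis. (-R + R * (\<Sum>k. b (prod_encode (idx i, k)) * (1/2) ^ k)) *\<^sub>R i)" for b
  let ?c = "\<lambda>b. \<Sum>n. b n * (1/3::real) ^ n"
  have cc: "continuous_on bit_seqs ?c"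
    using continuous_on_digit_sum[of "1/3" "\<lambda>n. n"] by simp
  have cP: "continuous_on bit_seqs \<Phi>"
    unfolding \<Phi>_def using continuous_on_digit_sum[of "1/2"]
    by (intro continuous_intros) auto
  have sur: "K \<subseteq> \<Phi> ` bit_seqs"
  proof
    fix x assume x: "x \<in> K"
    have "\<exists>b\<in>bit_seqs. (\<Sum>k. b k * (1/2) ^ k) = 2 * ((x \<bullet> i + R) / (2 * R))" if i: "i \<in> Basis" for i
    proof -
      have "\<bar>x \<bullet> i\<bar> < R" using Basis_le_norm[OF i, of x] R(2) x by force
      then have "0 \<le> (x \<bullet> i + R) / (2 * R)" "(x \<bullet> i + R) / (2 * R) < 1"
        using R(1) by (auto simp: field_simps)
      then show ?thesis using binary_expansion by metis
    qed
    then obtain \<beta> where \<beta>: "\<And>i. i \<in> Basis \<Longrightarrow> \<beta> i \<in> bit_seqs \<and> (\<Sum>k. \<beta> i k * (1/2) ^ k) = 2 * ((x \<bullet> i + R) / (2 * R))"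
      by metis
    define b where "b n = (case prod_decode n of (j, k) \<Rightarrow> if j \<in> idx ` Basis then \<beta> (inv_into Basis idx j) k else 0)" for n
    have b: "b (prod_encode (idx i, k)) = \<beta> i k" if "i \<in> Basis" for i k
      using that idx by (simp add: b_def)
    have bb: "b \<in> bit_seqs"
      unfolding bit_seqs_def
    proof (intro CollectI allI)
      fix n
      obtain j k where jk: "prod_decode n = (j, k)" by force
      show "b n \<in> {0, 1}"
      proof (cases "j \<in> idx ` Basis")
        case True
        then have "inv_into Basis idx j \<in> Basis" by (rule inv_into_into)
        then have "\<beta> (inv_into Basis idx j) k \<in> {0,1}" using \<beta> unfolding bit_seqs_def by blast
        then show ?thesis using True by (simp add: b_def jk)
      qed (simp add: b_def jk)
    qed
    have "-R + R * (\<Sum>k. b (prod_encode (idx i, k)) * (1/2) ^ k) = x \<bullet> i" if i: "i \<in> Basis" for i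
    proof -
      have "(\<Sum>k. b (prod_encode (idx i, k)) * (1/2) ^ k) = 2 * ((x \<bullet> i + R) / (2 * R))"
        using \<beta>[OF i] b[OF i] by simp
      then show ?thesis using R(1) by (simp only:) (simp add: field_simps)
    qed
    then have "\<Phi> b = (\<Sum>i\<in>Basis. (x \<bullet> i) *\<^sub>R i)"
      unfolding \<Phi>_def by simp
    then show "x \<in> \<Phi> ` bit_seqs" using bb by (auto simp: euclidean_representation)
  qed
  define B where "B = bit_seqs \<inter> \<Phi> -` K"
  have "closed bit_seqs" using compact_bit_seqs compact_imp_closed by blast
  then have "closed B" unfolding B_def
    using continuous_on_closed_vimage cP compact_imp_closed[OF assms] by (metis inf_commute)
  then have cB: "compact B" unfolding B_def using compact_bit_seqs
    by (metis closed_Int_compact inf.idem inf_assoc inf_commute)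
  have BB: "B \<subseteq> bit_seqs" unfolding B_def by auto
  have inj: "inj_on ?c B" using inj_on_ternary BB inj_on_subset by blast
  define d where "d = inv_into B ?c"
  have dB: "\<forall>b\<in>B. d (?c b) = b" unfolding d_def using inv_into_f_f[OF inj] by blast
  have cd: "continuous_on (?c ` B) d"
    by (rule continuous_on_inv[OF continuous_on_subset[OF cc BB] cB dB])
  have dim: "d ` ?c ` B = B" using dB by force
  show ?thesis
  proof
    show "compact (?c ` B)" using compact_continuous_image continuous_on_subset[OF cc BB] cB by blast
    show "continuous_on (?c ` B) (\<Phi> \<circ> d)"
      by (rule continuous_on_compose[OF cd]) (use dim cP BB continuous_on_subset in metis)
    have "(\<Phi> \<circ> d) ` ?c ` B = \<Phi> ` B" by (simp only: image_comp[symmetric] dim)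
    also have "\<dots> = K" unfolding B_def using sur by auto
    finally show "(\<Phi> \<circ> d) ` ?c ` B = K" .
  qed
qed

section \<open>Approximate equilibria by backward induction\<close>

text \<open>Expected payoff of a walk through 0, 1, ..., \<open>n\<close> that stops at
  \<open>i\<close> with probability \<open>q i\<close> and then collects \<open>g i\<close>.
  Stopping at the last point is forced, so \<open>n\<close> free probabilities describe weights on
  \<open>n + 1\<close> points.\<close>

primrec bwd :: "nat \<Rightarrow> (nat \<Rightarrow> real) \<Rightarrow> (nat \<Rightarrow> real) \<Rightarrow> real" where
  "bwd 0 q g = g 0"
| "bwd (Suc n) q g = q 0 * g 0 + (1 - q 0) * bwd n (\<lambda>i. q (Suc i)) (\<lambda>i. g (Suc i))"

lemma bwd_bound:
  assumes "\<And>i. i \<le> n \<Longrightarrow> \<bar>g i\<bar> \<le> G" "\<And>i. i < n \<Longrightarrow> 0 \<le> q i \<and> q i \<le> 1"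
  shows "\<bar>bwd n q g\<bar> \<le> G"
  using assms
proof (induction n arbitrary: q g)
  case (Suc n)
  have b: "\<bar>bwd n (\<lambda>i. q (Suc i)) (\<lambda>i. g (Suc i))\<bar> \<le> G" using Suc by simp
  have q: "0 \<le> q 0" "q 0 \<le> 1" and g: "\<bar>g 0\<bar> \<le> G" using Suc.prems by auto
  have "\<bar>bwd (Suc n) q g\<bar> \<le> \<bar>q 0 * g 0\<bar> + \<bar>(1 - q 0) * bwd n (\<lambda>i. q (Suc i)) (\<lambda>i. g (Suc i))\<bar>" by simp
  also have "\<dots> \<le> q 0 * G + (1 - q 0) * G"
    using b q g by (intro add_mono) (simp_all add: abs_mult mult_left_mono)
  finally show ?case by (simp add: algebra_simps)
qed simp

lemma bwd_lipschitz:
  assumes "\<And>i. i \<le> n \<Longrightarrow> \<bar>g i\<bar> \<le> G" "\<And>i. i \<le> n \<Longrightarrow> \<bar>g' i\<bar> \<le> G" "\<And>i. i \<le> n \<Longrightarrow> \<bar>g i - g' i\<bar> \<le> e"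
    "\<And>i. i < n \<Longrightarrow> 0 \<le> q i \<and> q i \<le> 1" "\<And>i. i < n \<Longrightarrow> 0 \<le> q' i \<and> q' i \<le> 1"
  shows "\<bar>bwd n q g - bwd n q' g'\<bar> \<le> e + 2 * G * (\<Sum>j<n. \<bar>q j - q' j\<bar>)"
  using assms
proof (induction n arbitrary: q g q' g')
  case (Suc n)
  let ?b = "bwd n (\<lambda>i. q (Suc i)) (\<lambda>i. g (Suc i))" and ?b' = "bwd n (\<lambda>i. q' (Suc i)) (\<lambda>i. g' (Suc i))"
  let ?S = "\<Sum>j<n. \<bar>q (Suc j) - q' (Suc j)\<bar>"
  have IH: "\<bar>?b - ?b'\<bar> \<le> e + 2 * G * ?S" using Suc by simp
  have b': "\<bar>?b'\<bar> \<le> G" using Suc.prems by (intro bwd_bound) auto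
  have g': "\<bar>g' 0\<bar> \<le> G" and g: "\<bar>g 0 - g' 0\<bar> \<le> e" using Suc.prems by auto
  have q: "0 \<le> q 0" "q 0 \<le> 1" using Suc.prems by auto
  have G: "0 \<le> G" using g' by linarith
  have S0: "0 \<le> ?S" by (simp add: sum_nonneg)
  \<comment> \<open>Changing one stopping probability swaps the payoff at 0 against the continuation
    value; both are bounded by \<open>G\<close>, whence the factor \<open>2 * G\<close>.\<close>
  have "bwd (Suc n) q g - bwd (Suc n) q' g' =
    q 0 * (g 0 - g' 0) + (1 - q 0) * (?b - ?b') + (q 0 - q' 0) * (g' 0 - ?b')"
    by (simp add: algebra_simps)
  also have "\<bar>\<dots>\<bar> \<le> q 0 * \<bar>g 0 - g' 0\<bar> + (1 - q 0) * \<bar>?b - ?b'\<bar> + \<bar>q 0 - q' 0\<bar> * \<bar>g' 0 - ?b'\<bar>"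
    using q by (auto simp: abs_mult intro!: order_trans[OF abs_triangle_ineq] add_mono)
  also have "\<dots> \<le> q 0 * (e + 2 * G * ?S) + (1 - q 0) * (e + 2 * G * ?S) + \<bar>q 0 - q' 0\<bar> * (2 * G)"
  proof (intro add_mono mult_left_mono)
    show "\<bar>g 0 - g' 0\<bar> \<le> e + 2 * G * ?S" using g G S0 by (simp add: add_increasing2)
    show "\<bar>g' 0 - ?b'\<bar> \<le> 2 * G" using b' g' by linarith
  qed (use IH q in auto)
  also have "\<dots> = e + 2 * G * (\<Sum>j<Suc n. \<bar>q j - q' j\<bar>)"
    by (subst sum.lessThan_Suc_shift) (simp add: algebra_simps)
  finally show ?case .
qed simp

text \<open>Summation by parts: the product is the probability of getting past \<open>i\<close>. In
  this form the expected payoff can be compared with an integral over the thresholds of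
  \<open>step_index\<close>.\<close>

lemma bwd_eq_sum:
  "bwd n q g = g 0 + (\<Sum>i<n. (\<Prod>j<Suc i. 1 - q j) * (g (Suc i) - g i))"
proof (induction n arbitrary: q g)
  case (Suc n)
  have "bwd (Suc n) q g = g 0 + (1 - q 0) * (g (Suc 0) - g 0) +
     (\<Sum>i<n. (1 - q 0) * (\<Prod>j<Suc i. 1 - q (Suc j)) * (g (Suc (Suc i)) - g (Suc i)))"
    by (simp add: Suc.IH sum_distrib_left algebra_simps del: prod.lessThan_Suc)
  also have "\<dots> = g 0 + (\<Sum>i<Suc n. (\<Prod>j<Suc i. 1 - q j) * (g (Suc i) - g i))"
    by (subst sum.lessThan_Suc_shift) (simp add: prod.lessThan_Suc_shift del: prod.lessThan_Suc)
  finally show ?case .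
qed simp

text \<open>Kuhn's lemma yields a cell in which each coordinate \<open>i\<close> sees both labels,
  so at its corner stopping at \<open>i\<close> and going on are almost equally good, unless
  \<open>q i\<close> is at the end of \<open>[0, 1]\<close> that the better choice demands. Being
  nearly optimal in each single step, for costs frozen at \<open>q\<close>, adds up along the walk
  to near optimality against every pure choice \<open>j\<close>.\<close>

lemma approx_equilibrium:
  fixes f :: "nat \<Rightarrow> (nat \<Rightarrow> real) \<Rightarrow> real"
  assumes bd: "\<And>i q. i \<le> N \<Longrightarrow> (\<forall>j<N. 0 \<le> q j \<and> q j \<le> 1) \<Longrightarrow> \<bar>f i q\<bar> \<le> G"
    and lip: "\<And>i q q'. i \<le> N \<Longrightarrow> (\<forall>j<N. 0 \<le> q j \<and> q j \<le> 1) \<Longrightarrow> (\<forall>j<N. 0 \<le> q' j \<and> q' j \<le> 1) \<Longrightarrow>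
      \<bar>f i q - f i q'\<bar> \<le> A * (\<Sum>j<N. \<bar>q j - q' j\<bar>)"
    and A: "A \<ge> 0" and eps: "\<epsilon> > 0"
  obtains q where "\<forall>j<N. 0 \<le> q j \<and> q j \<le> 1" "\<And>j. j \<le> N \<Longrightarrow> bwd N q (\<lambda>i. f i q) \<le> f j q + \<epsilon>"
proof -
  \<comment> \<open>Value of the walk started at \<open>k\<close>. The costs are still evaluated at
    the whole vector \<open>q\<close>, including the probabilities before \<open>k\<close>.\<close>
  define V where "V k q = bwd (N - k) (\<lambda>i. q (k + i)) (\<lambda>i. f (k + i) q)" for k q
  have G: "G \<ge> 0" using bd[of 0 "\<lambda>_. 0"] by fastforce
  have VN: "V N q = f N q" for q by (simp add: V_def)
  have V0: "V 0 q = bwd N q (\<lambda>i. f i q)" for q by (simp add: V_def)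
  have VS: "V k q = q k * f k q + (1 - q k) * V (Suc k) q" if "k < N" for k q
  proof -
    have "N - k = Suc (N - Suc k)" using that by simp
    then show ?thesis unfolding V_def by simp
  qed
  have Vb: "\<bar>V k q\<bar> \<le> G" if "k \<le> N" "\<forall>j<N. 0 \<le> q j \<and> q j \<le> 1" for k q
    unfolding V_def using that bd by (intro bwd_bound) auto
  have Vl: "\<bar>V k q - V k q'\<bar> \<le> (A + 2 * G) * (\<Sum>j<N. \<bar>q j - q' j\<bar>)"
    if k: "k \<le> N" and q: "\<forall>j<N. 0 \<le> q j \<and> q j \<le> 1" "\<forall>j<N. 0 \<le> q' j \<and> q' j \<le> 1" for k q q'
  proof -
    have "\<bar>V k q - V k q'\<bar> \<le> A * (\<Sum>j<N. \<bar>q j - q' j\<bar>) + 2 * G * (\<Sum>j<N - k. \<bar>q (k + j) - q' (k + j)\<bar>)"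
      unfolding V_def using k q bd lip by (intro bwd_lipschitz) auto
    moreover have "(\<Sum>j<N - k. \<bar>q (k + j) - q' (k + j)\<bar>) = (\<Sum>j\<in>{k..<N}. \<bar>q j - q' j\<bar>)"
      by (rule sum.reindex_bij_witness[where i="\<lambda>j. j - k" and j="\<lambda>j. k + j"]) auto
    moreover have "(\<Sum>j\<in>{k..<N}. \<bar>q j - q' j\<bar>) \<le> (\<Sum>j<N. \<bar>q j - q' j\<bar>)" by (rule sum_mono2) auto
    ultimately have "\<bar>V k q - V k q'\<bar> \<le> A * (\<Sum>j<N. \<bar>q j - q' j\<bar>) + 2 * G * (\<Sum>j<N. \<bar>q j - q' j\<bar>)"
      using G mult_left_mono[of "\<Sum>j\<in>{k..<N}. \<bar>q j - q' j\<bar>" "\<Sum>j<N. \<bar>q j - q' j\<bar>" "2 * G"] by simp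
    then show ?thesis by (simp add: distrib_right)
  qed
  \<comment> \<open>Divided by \<open>p\<close>, the first summand bounds the joint oscillation of
    \<open>f i\<close> and \<open>V (Suc i)\<close> over a cell of mesh \<open>1 / p\<close>; the
    second pays for \<open>q i\<close> ending one mesh width short of 1.\<close>
  define B where "B = (2 * A + 2 * G) * real N + 2 * G"
  have B: "B \<ge> 0" using A G by (simp add: B_def)
  obtain p :: nat where p1: "real p > real (N + 1) * B / \<epsilon>" using reals_Archimedean2 by blast
  moreover have "real (N + 1) * B / \<epsilon> \<ge> 0" using B eps by simp
  ultimately have "real p > 0" by linarith
  then have p: "real p > real (N + 1) * B / \<epsilon>" "p > 0" using p1 by simp_all
  define \<eta> where "\<eta> = B / real p"
  have \<eta>0: "\<eta> \<ge> 0" using B by (simp add: \<eta>_def)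
  have \<eta>\<epsilon>: "real (N + 1) * \<eta> \<le> \<epsilon>" using p eps by (simp add: \<eta>_def field_simps)
  define sc where "sc x j = real (x j) / real p" for x :: "nat \<Rightarrow> nat" and j
  \<comment> \<open>Label 0 asks to raise \<open>q i\<close>, because stopping at \<open>i\<close>
    costs no more than going on, and label 1 asks to lower it; the two opposite faces carry the
    labels that Kuhn's lemma prescribes.\<close>
  define label where "label x i = (if x i = 0 then 0 else if x i = p then 1
      else if f i (sc x) \<le> V (Suc i) (sc x) then 0 else 1 :: nat)" for x i
  obtain y where y: "\<forall>i<N. y i < p" and
    rs: "\<forall>i<N. \<exists>r s. (\<forall>j<N. y j \<le> r j \<and> r j \<le> y j + 1) \<and> (\<forall>j<N. y j \<le> s j \<and> s j \<le> y j + 1) \<and> label r i \<noteq> label s i"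
    by (rule kuhn_lemma[of p N label]) (use p in \<open>auto simp: label_def\<close>)
  \<comment> \<open>The lower corner of the cell. If a vertex lies on the face 0, then
    \<open>q i\<close> is exactly 0; if it lies on the opposite face, \<open>q i\<close> may be only
    \<open>1 - 1 / p\<close>, hence the asymmetry in \<open>step\<close>.\<close>
  define q where "q = sc y"
  have qc: "\<forall>j<N. 0 \<le> q j \<and> q j \<le> 1" using y p(2) by (auto simp: q_def sc_def field_simps less_imp_le)
  have step: "(q i = 0 \<or> f i q \<le> V (Suc i) q + \<eta>) \<and> (1 - q i \<le> 1 / real p \<or> V (Suc i) q \<le> f i q + \<eta>)"
    if i: "i < N" for i
  proof -
    obtain r s where r: "\<forall>j<N. y j \<le> r j \<and> r j \<le> y j + 1" and s: "\<forall>j<N. y j \<le> s j \<and> s j \<le> y j + 1"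
      and l: "label r i = 0" "label s i = 1"
    proof -
      obtain r s where *: "\<forall>j<N. y j \<le> r j \<and> r j \<le> y j + 1" "\<forall>j<N. y j \<le> s j \<and> s j \<le> y j + 1" "label r i \<noteq> label s i"
        using rs i by blast
      have "label r i \<in> {0,1}" "label s i \<in> {0,1}" by (auto simp: label_def)
      then have "label r i = 0 \<and> label s i = 1 \<or> label s i = 0 \<and> label r i = 1" using *(3) by auto
      then show thesis using that * by blast
    qed
    have close: "(\<forall>j<N. 0 \<le> sc r j \<and> sc r j \<le> 1) \<and> \<bar>f i (sc r) - f i q\<bar> + \<bar>V (Suc i) (sc r) - V (Suc i) q\<bar> \<le> \<eta>"
      if r: "\<forall>j<N. y j \<le> r j \<and> r j \<le> y j + 1" for r
    proof -
      have rc: "\<forall>j<N. 0 \<le> sc r j \<and> sc r j \<le> 1"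
      proof (intro allI impI conjI)
        fix j assume "j < N"
        then have "r j \<le> y j + 1" "y j < p" using r y by blast+
        then have "r j \<le> p" by linarith
        then show "sc r j \<le> 1" using p(2) by (simp add: sc_def)
      qed (simp add: sc_def)
      have "\<bar>sc r j - q j\<bar> \<le> 1 / real p" if "j < N" for j
      proof -
        have "y j \<le> r j" "r j \<le> y j + 1" using r that by blast+
        then have "\<bar>real (r j) - real (y j)\<bar> \<le> 1" by linarith
        then have "\<bar>real (r j) - real (y j)\<bar> / real p \<le> 1 / real p" by (simp add: divide_right_mono)
        then show ?thesis unfolding q_def sc_def by (simp flip: diff_divide_distrib)
      qed
      then have "(\<Sum>j<N. \<bar>sc r j - q j\<bar>) \<le> (\<Sum>j<N. 1 / real p)" by (intro sum_mono) auto
      then have S: "(\<Sum>j<N. \<bar>sc r j - q j\<bar>) \<le> real N / real p" by simp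
      have "\<bar>f i (sc r) - f i q\<bar> + \<bar>V (Suc i) (sc r) - V (Suc i) q\<bar> \<le> 
        A * (\<Sum>j<N. \<bar>sc r j - q j\<bar>) + (A + 2 * G) * (\<Sum>j<N. \<bar>sc r j - q j\<bar>)"
        using i rc qc by (intro add_mono lip Vl) auto
      also have "\<dots> = (2 * A + 2 * G) * (\<Sum>j<N. \<bar>sc r j - q j\<bar>)" by (simp add: algebra_simps)
      also have "\<dots> \<le> (2 * A + 2 * G) * (real N / real p)"
        using S A G by (intro mult_left_mono) auto
      also have "\<dots> \<le> \<eta>" using p(2) G by (simp add: \<eta>_def B_def field_simps)
      finally show ?thesis using rc by blast
    qed
    have 1: "q i = 0 \<or> f i q \<le> V (Suc i) q + \<eta>"
    proof (cases "r i = 0")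
      case True
      then have "y i = 0" using r i by auto
      then show ?thesis by (simp add: q_def sc_def)
    next
      case False
      then have "f i (sc r) \<le> V (Suc i) (sc r)" using l(1) unfolding label_def by (auto split: if_splits)
      then show ?thesis using close[OF r] by linarith
    qed
    have 2: "1 - q i \<le> 1 / real p \<or> V (Suc i) q \<le> f i q + \<eta>"
    proof (cases "s i = p")
      case True
      then have "real p \<le> real (y i) + 1" using s i by force
      then have "(real p - real (y i)) / real p \<le> 1 / real p" using p(2) by (intro divide_right_mono) auto
      then show ?thesis using p(2) by (simp add: q_def sc_def diff_divide_distrib)
    next
      case False
      then have "f i (sc s) > V (Suc i) (sc s)" using l(2) unfolding label_def by (auto split: if_splits)
      then show ?thesis using close[OF s] by linarith
    qed
    from 1 2 show ?thesis by blast
  qed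
  have G\<eta>: "2 * G / real p \<le> \<eta>" using A by (simp add: \<eta>_def B_def divide_right_mono G)
  have a: "V i q \<le> f i q + \<eta>" if i: "i < N" for i
  proof -
    have e: "V i q - f i q = (1 - q i) * (V (Suc i) q - f i q)" using VS[OF i] by (simp add: algebra_simps)
    have q01: "0 \<le> 1 - q i" "1 - q i \<le> 1" using qc i by auto
    from step[OF i] consider "1 - q i \<le> 1 / real p" | "V (Suc i) q - f i q \<le> \<eta>" by fastforce
    then have "(1 - q i) * (V (Suc i) q - f i q) \<le> \<eta>"
    proof cases
      case 1
      have "V (Suc i) q - f i q \<le> 2 * G" using Vb[of "Suc i" q] bd[of i q] i qc by fastforce
      then have "(1 - q i) * (V (Suc i) q - f i q) \<le> (1 - q i) * (2 * G)" using q01 by (simp add: mult_left_mono)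
      also have "\<dots> \<le> 1 / real p * (2 * G)" using 1 G by (intro mult_right_mono) auto
      finally show ?thesis using G\<eta> by simp
    next
      case 2
      then have "(1 - q i) * (V (Suc i) q - f i q) \<le> (1 - q i) * \<eta>" using q01 by (simp add: mult_left_mono)
      also have "\<dots> \<le> 1 * \<eta>" using q01 \<eta>0 by (intro mult_right_mono) auto
      finally show ?thesis by simp
    qed
    then show ?thesis using e by linarith
  qed
  have b: "V i q \<le> V (Suc i) q + \<eta>" if i: "i < N" for i
  proof -
    have e: "V i q - V (Suc i) q = q i * (f i q - V (Suc i) q)" using VS[OF i] by (simp add: algebra_simps)
    have q01: "0 \<le> q i" "q i \<le> 1" using qc i by auto
    from step[OF i] consider "q i = 0" | "f i q - V (Suc i) q \<le> \<eta>" by fastforce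
    then have "q i * (f i q - V (Suc i) q) \<le> \<eta>"
    proof cases
      case 2
      then have "q i * (f i q - V (Suc i) q) \<le> q i * \<eta>" using q01 by (simp add: mult_left_mono)
      also have "\<dots> \<le> 1 * \<eta>" using q01 \<eta>0 by (intro mult_right_mono) auto
      finally show ?thesis by simp
    qed (use \<eta>0 in simp)
    then show ?thesis using e by linarith
  qed
  \<comment> \<open>Skipping ahead to \<open>k\<close> loses \<open>\<eta>\<close> per step;
    together with \<open>a\<close> at \<open>k\<close> there are at most \<open>N + 1\<close>
    losses.\<close>
  have c: "V 0 q \<le> V k q + real k * \<eta>" if "k \<le> N" for k
    using that
  proof (induction k)
    case (Suc k)
    then show ?case using b[of k] by (simp add: algebra_simps)
  qed simp
  show ?thesis
  proof
    show "\<forall>j<N. 0 \<le> q j \<and> q j \<le> 1" by (rule qc)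
    fix j assume j: "j \<le> N"
    have "V j q \<le> f j q + \<eta>" using a[of j] VN \<eta>0 j by (cases "j = N") auto
    then have "V 0 q \<le> f j q + real (j + 1) * \<eta>" using c[OF j] by (simp add: algebra_simps)
    also have "real (j + 1) * \<eta> \<le> real (N + 1) * \<eta>" using j \<eta>0 by (intro mult_right_mono) auto
    also have "\<dots> \<le> \<epsilon>" by (rule \<eta>\<epsilon>)
    finally show "bwd N q (\<lambda>i. f i q) \<le> f j q + \<epsilon>" using V0 by simp
  qed
qed

section \<open>Equilibrium measures\<close>

text \<open>For nondecreasing thresholds, the last index whose threshold is at most
  \<open>w\<close>: the quantile function of a law on 0, ..., \<open>N\<close>. The value
  \<open>c 0\<close> is never inspected.\<close>

primrec step_index :: "(nat \<Rightarrow> real) \<Rightarrow> nat \<Rightarrow> real \<Rightarrow> nat" where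
  "step_index c 0 w = 0"
| "step_index c (Suc N) w = (if c (Suc N) \<le> w then Suc N else step_index c N w)"

lemma measurable_step_index: "step_index c N \<in> measurable borel (count_space UNIV)"
proof (induction N)
  case (Suc N)
  have "Measurable.pred borel (\<lambda>w. c (Suc N) \<le> w)" by measurable
  then have "(\<lambda>w. if c (Suc N) \<le> w then Suc N else step_index c N w) \<in> measurable borel (count_space UNIV)"
    using Suc by (intro measurable_If) (auto simp: pred_def)
  then show ?case by (simp add: fun_eq_iff cong: measurable_cong)
qed simp

text \<open>Monotone thresholds are passed in order, so \<open>g\<close> at the index reached is
  \<open>g 0\<close> plus the increments at all thresholds passed. Integrated over \<open>w\<close>
  this is the sum in \<open>bwd_eq_sum\<close>.\<close>

lemma step_index_telescope:
  fixes g :: "nat \<Rightarrow> real"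
  assumes "\<And>i. i < N \<Longrightarrow> c i \<le> c (Suc i)"
  shows "g (step_index c N w) = g 0 + (\<Sum>i<N. indicator {c (Suc i)..} w * (g (Suc i) - g i))"
  using assms
proof (induction N)
  case (Suc N)
  have IH: "g (step_index c N w) = g 0 + (\<Sum>i<N. indicator {c (Suc i)..} w * (g (Suc i) - g i))"
    using Suc by simp
  show ?case
  proof (cases "c (Suc N) \<le> w")
    case True
    have "c N \<le> w" using Suc.prems[of N] True by simp
    then have "step_index c N w = N" by (cases N) auto
    then show ?thesis using True IH by simp
  qed (use IH in simp)
qed simp

text \<open>The index can change at \<open>w\<close> only if some threshold moves across
  \<open>w\<close>; this dominates the transport cost by a sum of indicators.\<close>

lemma step_index_diff:
  assumes "step_index c N w \<noteq> step_index c' N w"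
  shows "1 \<le> (\<Sum>i<N. \<bar>indicator {c (Suc i)..} w - indicator {c' (Suc i)..} w :: real\<bar>)"
proof -
  obtain i where i: "i < N" "(c (Suc i) \<le> w) \<noteq> (c' (Suc i) \<le> w)"
    using assms by (induction N) (auto simp: less_Suc_eq split: if_splits)
  have "1 = \<bar>indicator {c (Suc i)..} w - indicator {c' (Suc i)..} w :: real\<bar>"
    using i(2) by (auto simp: indicator_def)
  also have "\<dots> \<le> (\<Sum>i<N. \<bar>indicator {c (Suc i)..} w - indicator {c' (Suc i)..} w :: real\<bar>)"
    using i(1) by (intro member_le_sum) auto
  finally show ?thesis .
qed

abbreviation unit_lebesgue :: "real measure" where
  "unit_lebesgue \<equiv> uniform_measure lborel {0..1}"

lemma prob_space_unit_lebesgue: "prob_space unit_lebesgue"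
  by (rule prob_space_uniform_measure) auto

lemma measure_unit_lebesgue: "B \<in> sets borel \<Longrightarrow> measure unit_lebesgue B = measure lborel ({0..1} \<inter> B)"
  by (subst measure_uniform_measure) auto

lemma measure_unit_lebesgue_atLeast:
  assumes "0 \<le> c" "c \<le> 1"
  shows "measure unit_lebesgue {c..} = 1 - c"
proof -
  have "{0..1} \<inter> {c..} = {c..1}" using assms by auto
  then show ?thesis using assms by (simp add: measure_unit_lebesgue)
qed

lemma integral_indicator_diff_le:
  "(\<integral>w. \<bar>indicator {c..} w - indicator {c'..} w :: real\<bar> \<partial>unit_lebesgue) \<le> \<bar>c - c'\<bar>"
proof -
  interpret prob_space unit_lebesgue by (rule prob_space_unit_lebesgue)
  have "(\<integral>w. \<bar>indicator {c..} w - indicator {c'..} w :: real\<bar> \<partial>unit_lebesgue)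
    = (\<integral>w. indicator {min c c'..<max c c'} w \<partial>unit_lebesgue)"
    by (rule Bochner_Integration.integral_cong) (auto simp: indicator_def)
  also have "\<dots> = measure unit_lebesgue {min c c'..<max c c'}"
    by simp
  also have "\<dots> \<le> measure lborel {min c c'..<max c c'}"
    by (subst measure_unit_lebesgue, simp, rule measure_mono_fmeasurable) (auto simp: fmeasurable_def)
  also have "\<dots> = \<bar>c - c'\<bar>" by auto
  finally show ?thesis .
qed

text \<open>Stopping probabilities \<open>q\<close> become the law of
  \<open>x (step_index (c q) N w)\<close> for uniform \<open>w\<close>. Moving the thresholds moves
  this law by a controlled amount in \<open>wasserstein1\<close>, so the costs are Lipschitz in
  \<open>q\<close>. The index map \<open>Y\<close>, not just its law, is returned, because the limit
  argument transports it to the reals.\<close>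

lemma approx_equilibrium_measure:
  fixes K :: "'a::{second_countable_topology, metric_space} set"
  assumes K: "compact K" and x: "\<And>i::nat. x i \<in> K"
    and cont: "\<And>m. m \<in> prob_measures K \<Longrightarrow> continuous_on K (\<lambda>x. f x m)"
    and lip: "\<And>m1 m2 x. m1 \<in> prob_measures K \<Longrightarrow> m2 \<in> prob_measures K \<Longrightarrow> x \<in> K \<Longrightarrow>
      \<bar>f x m1 - f x m2\<bar> \<le> C * wasserstein1 m1 m2" and C: "C \<ge> 0" and eps: "\<epsilon> > 0"
  obtains Y where "Y \<in> measurable unit_lebesgue (count_space UNIV)"
    "\<And>j. j \<le> N \<Longrightarrow> (\<integral>y. f y (distr unit_lebesgue (restrict_space borel K) (\<lambda>w. x (Y w)))
        \<partial>(distr unit_lebesgue (restrict_space borel K) (\<lambda>w. x (Y w))))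
      \<le> f (x j) (distr unit_lebesgue (restrict_space borel K) (\<lambda>w. x (Y w))) + \<epsilon>"
proof -
  interpret U: prob_space unit_lebesgue by (rule prob_space_unit_lebesgue)
  \<comment> \<open>The probability of having stopped before \<open>i\<close>; for
    \<open>i < N\<close> the interval from \<open>c q i\<close> to \<open>c q (Suc i)\<close> is the
    set of \<open>w\<close> sent to \<open>x i\<close>, up to endpoints.\<close>
  define c where "c q i = 1 - (\<Prod>j<i. 1 - q j)" for q :: "nat \<Rightarrow> real" and i
  define M where "M q = distr unit_lebesgue (restrict_space borel K) (\<lambda>w. x (step_index (c q) N w))" for q
  define D where "D = diameter K"
  have D: "dist a b \<le> D" if "a \<in> K" "b \<in> K" for a b
    using that diameter_bounded_bound[OF compact_imp_bounded[OF K]] D_def by blast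
  have D0: "D \<ge> 0" using D[of "x 0" "x 0"] x by simp
  have Ym: "step_index (c q) N \<in> measurable unit_lebesgue (count_space UNIV)" for q
    using measurable_step_index by simp
  have xY: "(\<lambda>w. x (step_index (c q) N w)) \<in> measurable unit_lebesgue (restrict_space borel K)" for q
    by (rule measurable_compose[OF Ym]) (use x in auto)
  have M: "M q \<in> prob_measures K" for q
    unfolding M_def by (rule distr_in_prob_measures[OF prob_space_unit_lebesgue xY])
  have c01: "0 \<le> c q i \<and> c q i \<le> 1 \<and> c q i \<le> c q (Suc i)" if "\<forall>j<N. 0 \<le> q j \<and> q j \<le> 1" "i < N" for q i
  proof -
    have p: "0 \<le> (\<Prod>j<i. 1 - q j)" "(\<Prod>j<i. 1 - q j) \<le> 1"
      using that by (auto intro!: prod_nonneg prod_le_1)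
    then have "(\<Prod>j<i. 1 - q j) * (1 - q i) \<le> (\<Prod>j<i. 1 - q j)"
      using that by (simp add: mult_left_le)
    with p show ?thesis by (simp add: c_def)
  qed
  have cS: "0 \<le> c q (Suc i) \<and> c q (Suc i) \<le> 1" if "\<forall>j<N. 0 \<le> q j \<and> q j \<le> 1" "i < N" for q i
  proof -
    have "0 \<le> (\<Prod>j<Suc i. 1 - q j)" "(\<Prod>j<Suc i. 1 - q j) \<le> 1"
      using that by (auto intro!: prod_nonneg prod_le_1 simp del: prod.lessThan_Suc)
    then show ?thesis unfolding c_def by linarith
  qed
  have W: "wasserstein1 (M q) (M q') \<le> D * real N * (\<Sum>j<N. \<bar>q j - q' j\<bar>)"
    if q: "\<forall>j<N. 0 \<le> q j \<and> q j \<le> 1" "\<forall>j<N. 0 \<le> q' j \<and> q' j \<le> 1" for q q'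
  proof -
    let ?d = "\<lambda>w. \<Sum>i<N. \<bar>indicator {c q (Suc i)..} w - indicator {c q' (Suc i)..} w :: real\<bar>"
    have int: "integrable unit_lebesgue (\<lambda>w. \<bar>indicator {c q (Suc i)..} w - indicator {c q' (Suc i)..} w :: real\<bar>)" for i
      by (rule U.integrable_const_bound[where B=1]) (auto simp: indicator_def)
    have "wasserstein1 (M q) (M q') \<le> (\<integral>w. dist (x (step_index (c q) N w)) (x (step_index (c q') N w)) \<partial>unit_lebesgue)"
      unfolding M_def by (rule wasserstein1_distr_le[OF prob_space_unit_lebesgue xY xY])
    also have "\<dots> \<le> (\<integral>w. D * ?d w \<partial>unit_lebesgue)"
    proof (rule integral_mono_AE')
      show "integrable unit_lebesgue (\<lambda>w. D * ?d w)"
        using int by (intro integrable_mult_right integrable_sum) auto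
      show "AE w in unit_lebesgue. dist (x (step_index (c q) N w)) (x (step_index (c q') N w)) \<le> D * ?d w"
      proof (rule AE_I2)
        fix w
        show "dist (x (step_index (c q) N w)) (x (step_index (c q') N w)) \<le> D * ?d w"
        proof (cases "step_index (c q) N w = step_index (c q') N w")
          case False
          have "dist (x (step_index (c q) N w)) (x (step_index (c q') N w)) \<le> D * 1" using D x by simp
          also have "\<dots> \<le> D * ?d w" using step_index_diff[OF False] D0 by (rule mult_left_mono)
          finally show ?thesis .
        qed (use D0 in \<open>simp add: sum_nonneg\<close>)
      qed
    qed (use D0 in \<open>auto intro!: AE_I2 mult_nonneg_nonneg sum_nonneg\<close>)
    also have "\<dots> = D * (\<Sum>i<N. \<integral>w. \<bar>indicator {c q (Suc i)..} w - indicator {c q' (Suc i)..} w :: real\<bar> \<partial>unit_lebesgue)"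
      by (simp only: integral_mult_right_zero Bochner_Integration.integral_sum[OF int])
    also have "\<dots> \<le> D * (\<Sum>i<N. \<Sum>j<N. \<bar>q j - q' j\<bar>)"
    proof (intro mult_left_mono sum_mono D0)
      fix i assume "i \<in> {..<N}"
      then have i: "i < N" by simp
      have "\<bar>c q (Suc i) - c q' (Suc i)\<bar> = norm ((\<Prod>j<Suc i. 1 - q j) - (\<Prod>j<Suc i. 1 - q' j))"
        unfolding c_def real_norm_def by linarith
      also have "\<dots> \<le> (\<Sum>j<Suc i. norm ((1 - q j) - (1 - q' j)))"
        by (rule norm_prod_diff) (use q i in auto)
      also have "\<dots> = (\<Sum>j<Suc i. \<bar>q j - q' j\<bar>)"
        by (intro sum.cong) auto
      also have "\<dots> \<le> (\<Sum>j<N. \<bar>q j - q' j\<bar>)" using i by (intro sum_mono2) auto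
      finally show "(\<integral>w. \<bar>indicator {c q (Suc i)..} w - indicator {c q' (Suc i)..} w :: real\<bar> \<partial>unit_lebesgue) \<le> (\<Sum>j<N. \<bar>q j - q' j\<bar>)"
        using integral_indicator_diff_le[of "c q (Suc i)" "c q' (Suc i)"] by linarith
    qed
    finally show ?thesis by simp
  qed
  define A where "A = C * D * real N"
  have A: "A \<ge> 0" using C D0 by (simp add: A_def)
  have flip: "\<bar>f (x i) (M q) - f (x i) (M q')\<bar> \<le> A * (\<Sum>j<N. \<bar>q j - q' j\<bar>)"
    if q: "\<forall>j<N. 0 \<le> q j \<and> q j \<le> 1" "\<forall>j<N. 0 \<le> q' j \<and> q' j \<le> 1" for i q q'
  proof -
    have "\<bar>f (x i) (M q) - f (x i) (M q')\<bar> \<le> C * wasserstein1 (M q) (M q')" using lip M x by blast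
    also have "\<dots> \<le> C * (D * real N * (\<Sum>j<N. \<bar>q j - q' j\<bar>))" using W[OF q] C by (rule mult_left_mono)
    finally show ?thesis by (simp add: A_def algebra_simps)
  qed
  \<comment> \<open>A bound on the whole cube: the values at the corner \<open>q = 0\<close> plus
    the largest possible variation, the cube having l1-diameter \<open>N\<close>.\<close>
  define G where "G = (\<Sum>i\<le>N. \<bar>f (x i) (M (\<lambda>_. 0))\<bar>) + A * real N"
  have Gb: "\<bar>f (x i) (M q)\<bar> \<le> G" if i: "i \<le> N" and q: "\<forall>j<N. 0 \<le> q j \<and> q j \<le> 1" for i q
  proof -
    have "\<bar>f (x i) (M q) - f (x i) (M (\<lambda>_. 0))\<bar> \<le> A * (\<Sum>j<N. \<bar>q j - 0\<bar>)"
      using flip[OF q, of "\<lambda>_. 0"] by simp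
    also have "\<dots> \<le> A * (\<Sum>j<N. 1)" using q A by (intro mult_left_mono sum_mono) auto
    finally have "\<bar>f (x i) (M q) - f (x i) (M (\<lambda>_. 0))\<bar> \<le> A * real N" by simp
    moreover have "\<bar>f (x i) (M (\<lambda>_. 0))\<bar> \<le> (\<Sum>i\<le>N. \<bar>f (x i) (M (\<lambda>_. 0))\<bar>)"
      using i by (intro member_le_sum) auto
    ultimately show ?thesis unfolding G_def by linarith
  qed
  obtain q where q: "\<forall>j<N. 0 \<le> q j \<and> q j \<le> 1" and e: "\<And>j. j \<le> N \<Longrightarrow> bwd N q (\<lambda>i. f (x i) (M q)) \<le> f (x j) (M q) + \<epsilon>"
    using approx_equilibrium[of N "\<lambda>i q. f (x i) (M q)" G A \<epsilon>] Gb flip A eps by blast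
  have int: "(\<integral>y. f y (M q) \<partial>M q) = bwd N q (\<lambda>i. f (x i) (M q))"
  proof -
    let ?g = "\<lambda>i. f (x i) (M q)"
    have "(\<integral>y. f y (M q) \<partial>M q) = (\<integral>w. ?g (step_index (c q) N w) \<partial>unit_lebesgue)"
      unfolding M_def by (rule integral_distr[OF xY])
       (rule continuous_on_measurable_prob_measures[OF cont[OF M, unfolded M_def]], simp)
    also have "\<dots> = (\<integral>w. ?g 0 + (\<Sum>i<N. indicator {c q (Suc i)..} w * (?g (Suc i) - ?g i)) \<partial>unit_lebesgue)"
      using c01[OF q] by (intro Bochner_Integration.integral_cong step_index_telescope) auto
    also have "\<dots> = ?g 0 + (\<Sum>i<N. measure unit_lebesgue {c q (Suc i)..} * (?g (Suc i) - ?g i))"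
    proof -
      have i: "integrable unit_lebesgue (\<lambda>w. indicator {c q (Suc i)..} w * (?g (Suc i) - ?g i))" for i
        by (intro integrable_mult_left U.integrable_const_bound[where B=1]) (auto simp: indicator_def)
      have s: "integrable unit_lebesgue (\<lambda>w. \<Sum>i<N. indicator {c q (Suc i)..} w * (?g (Suc i) - ?g i))"
        using i by (rule Bochner_Integration.integrable_sum)
      have m: "(\<integral>w. indicator {c q (Suc i)..} w * (?g (Suc i) - ?g i) \<partial>unit_lebesgue)
          = measure unit_lebesgue {c q (Suc i)..} * (?g (Suc i) - ?g i)" for i
        by (simp only: integral_mult_left_zero) simp
      have "(\<integral>w. ?g 0 \<partial>unit_lebesgue) = ?g 0" using U.prob_space by (simp del: space_uniform_measure)
      then show ?thesis
        by (simp only: Bochner_Integration.integral_add[OF U.integrable_const s] Bochner_Integration.integral_sum[OF i] m)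
    qed
    also have "\<dots> = ?g 0 + (\<Sum>i<N. (\<Prod>j<Suc i. 1 - q j) * (?g (Suc i) - ?g i))"
    proof -
      have "measure unit_lebesgue {c q (Suc i)..} = (\<Prod>j<Suc i. 1 - q j)" if "i < N" for i
        using measure_unit_lebesgue_atLeast[of "c q (Suc i)"] cS[OF q that]
        unfolding c_def by linarith
      then show ?thesis by (intro arg_cong2[where f="(+)"] sum.cong refl) (simp only: lessThan_iff)
    qed
    also have "\<dots> = bwd N q ?g" by (rule bwd_eq_sum[symmetric])
    finally show ?thesis .
  qed
  show ?thesis
  proof (rule that[of "step_index (c q) N"])
    fix j assume "j \<le> N"
    then have "(\<integral>y. f y (M q) \<partial>M q) \<le> f (x j) (M q) + \<epsilon>" using e int by simp
    then show "(\<integral>y. f y (distr unit_lebesgue (restrict_space borel K) (\<lambda>w. x (step_index (c q) N w)))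
        \<partial>(distr unit_lebesgue (restrict_space borel K) (\<lambda>w. x (step_index (c q) N w))))
      \<le> f (x j) (distr unit_lebesgue (restrict_space borel K) (\<lambda>w. x (step_index (c q) N w))) + \<epsilon>"
      unfolding M_def .
  qed (rule Ym)
qed

text \<open>Stage \<open>n\<close> is \<open>1 / (n + 1)\<close>-optimal against the first
  \<open>n + 1\<close> points of a dense sequence. In the limit the inequality holds against all
  these points, and continuity of the cost gives the rest of \<open>K\<close>.\<close>

lemma exists_equilibrium_measure:
  fixes K :: "'a::euclidean_space set"
  assumes K: "compact K" "K \<noteq> {}"
    and cont: "\<And>m. m \<in> prob_measures K \<Longrightarrow> continuous_on K (\<lambda>x. f x m)"
    and lip: "\<And>m1 m2 x. m1 \<in> prob_measures K \<Longrightarrow> m2 \<in> prob_measures K \<Longrightarrow> x \<in> K \<Longrightarrow>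
      \<bar>f x m1 - f x m2\<bar> \<le> C * wasserstein1 m1 m2" and C: "C \<ge> 0"
  obtains m where "m \<in> prob_measures K" "\<And>y. y \<in> K \<Longrightarrow> (\<integral>x. f x m \<partial>m) \<le> f y m"
proof -
  interpret U: prob_space unit_lebesgue by (rule prob_space_unit_lebesgue)
  let ?NK = "restrict_space borel K"
  obtain T where T: "countable T" "T \<subseteq> K" "K \<subseteq> closure T" using separable by blast
  have "T \<noteq> {}" using T K by auto
  define x where "x = from_nat_into T"
  have xT: "range x = T" unfolding x_def using range_from_nat_into[OF \<open>T \<noteq> {}\<close> T(1)] by simp
  have x: "x i \<in> K" for i using xT T(2) by blast
  obtain Cs :: "real set" and g where Cs: "compact Cs" "continuous_on Cs g" "g ` Cs = K"
    using compact_eq_continuous_image_real_compact[OF K(1)] by blast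
  \<comment> \<open>Any right inverse of \<open>g\<close> will do: it is applied only to the
    countably many values \<open>x (Y n w)\<close>, so its measurability is no issue.\<close>
  define h where "h y = (SOME s. s \<in> Cs \<and> g s = y)" for y
  have h: "h y \<in> Cs \<and> g (h y) = y" if "y \<in> K" for y
    unfolding h_def by (rule someI_ex) (use that Cs(3) in blast)
  define M where "M Y = distr unit_lebesgue ?NK (\<lambda>w. x (Y w))" for Y :: "real \<Rightarrow> nat"
  have "\<exists>Y. Y \<in> measurable unit_lebesgue (count_space UNIV) \<and>
      (\<forall>j\<le>n. (\<integral>y. f y (M Y) \<partial>M Y) \<le> f (x j) (M Y) + 1 / real (Suc n))" for n
  proof -
    have "1 / real (Suc n) > 0" by simp
    show ?thesis
    proof (rule approx_equilibrium_measure[where f=f and x=x and N=n, OF K(1) x cont lip C \<open>1 / real (Suc n) > 0\<close>])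
      fix Y assume Y: "Y \<in> measurable unit_lebesgue (count_space UNIV)"
        "\<And>j. j \<le> n \<Longrightarrow> (\<integral>y. f y (distr unit_lebesgue (restrict_space borel K) (\<lambda>w. x (Y w)))
          \<partial>(distr unit_lebesgue (restrict_space borel K) (\<lambda>w. x (Y w))))
        \<le> f (x j) (distr unit_lebesgue (restrict_space borel K) (\<lambda>w. x (Y w))) + 1 / real (Suc n)"
      show ?thesis
        unfolding M_def by (intro exI[of _ Y] conjI allI impI Y)
    qed
  qed
  then obtain Y where Y: "\<And>n. Y n \<in> measurable unit_lebesgue (count_space UNIV)"
    and eq: "\<And>n j. j \<le> n \<Longrightarrow> (\<integral>y. f y (M (Y n)) \<partial>M (Y n)) \<le> f (x j) (M (Y n)) + 1 / real (Suc n)"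
    by metis
  define S where "S n w = h (x (Y n w))" for n w
  have SCs: "S n w \<in> Cs" for n w using h x S_def by simp
  have Sm: "S n \<in> borel_measurable unit_lebesgue" for n
    unfolding S_def by (rule measurable_compose[OF Y]) auto
  define \<nu> where "\<nu> n = distr unit_lebesgue borel (S n)" for n
  have nu: "real_distribution (\<nu> n)" for n unfolding \<nu>_def using Sm by (rule U.real_distribution_distr)
  obtain R where R: "R > 0" "\<forall>s\<in>Cs. norm s < R" using compact_imp_bounded[OF Cs(1)] bounded_pos_less by blast
  have "tight \<nu>"
    unfolding tight_def
  proof (intro conjI allI impI)
    fix e :: real assume "e > 0"
    have "measure (\<nu> n) {-R<..R} = 1" for n
    proof -
      have "S n -` {-R<..R} \<inter> space unit_lebesgue = space unit_lebesgue"
        using R SCs by (auto simp: abs_less_iff) (metis abs_less_iff minus_less_iff, metis abs_less_iff less_imp_le)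
      then show ?thesis unfolding \<nu>_def using Sm by (subst measure_distr) (auto simp: U.prob_space[simplified])
    qed
    then show "\<exists>a b. a < b \<and> (\<forall>n. 1 - e < measure (\<nu> n) {a<..b})"
      using R(1) \<open>e > 0\<close> by (intro exI[of _ "-R"] exI[of _ R]) auto
  qed (rule nu)
  then obtain r M' where r: "strict_mono (r::nat\<Rightarrow>nat)" and M': "real_distribution M'" "weak_conv_m (\<nu> \<circ> r) M'"
    using tight_imp_convergent_subsubsequence[of \<nu> "\<lambda>n. n"] by (auto simp: o_def strict_mono_def)
  obtain \<Omega> :: "real measure" and Z :: "nat \<Rightarrow> real \<Rightarrow> real" and Z' where
    Om: "prob_space \<Omega>" and Z: "\<And>n. Z n \<in> measurable \<Omega> borel" "\<And>n. distr \<Omega> borel (Z n) = (\<nu> \<circ> r) n"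
    and Z': "Z' \<in> measurable \<Omega> lborel" and lim: "\<And>w. w \<in> space \<Omega> \<Longrightarrow> (\<lambda>n. Z n w) \<longlonglongrightarrow> Z' w"
  proof -
    have nur: "real_distribution ((\<nu> \<circ> r) n)" for n using nu by simp
    from Skorohod[OF nur M'] that show thesis by blast
  qed
  interpret Om: prob_space \<Omega> by (rule Om)
  \<comment> \<open>Skorohod's variables take values in \<open>Cs\<close> only almost surely; off
    \<open>Cs\<close> the map is given the value \<open>x 0\<close>, which keeps it Borel with
    values in \<open>K\<close>.\<close>
  define g' where "g' s = (if s \<in> Cs then g s else x 0)" for s
  have g'K: "g' s \<in> K" for s using x Cs(3) g'_def by auto
  have "g' \<in> borel_measurable borel"
    unfolding g'_def
    by (rule borel_measurable_continuous_on_if) (use Cs compact_imp_closed in \<open>auto intro: borel_closed\<close>)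
  then have g'm: "g' \<in> measurable borel ?NK"
    using g'K by (intro measurable_restrict_space2) auto
  have gZ: "(\<lambda>w. g' (Z n w)) \<in> measurable \<Omega> ?NK" for n
    using measurable_compose[OF Z(1) g'm] .
  have gZ': "(\<lambda>w. g' (Z' w)) \<in> measurable \<Omega> ?NK"
    using measurable_compose[OF _ g'm, of Z' \<Omega>] Z' by simp
  define m where "m = distr \<Omega> ?NK (\<lambda>w. g' (Z' w))"
  have m: "m \<in> prob_measures K" unfolding m_def by (rule distr_in_prob_measures[OF Om gZ'])
  have Mr: "M (Y (r n)) = distr \<Omega> ?NK (\<lambda>w. g' (Z n w))" for n
  proof -
    have "distr \<Omega> ?NK (\<lambda>w. g' (Z n w)) = distr (distr \<Omega> borel (Z n)) ?NK g'"
      using distr_distr[OF g'm Z(1)] by (simp add: o_def)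
    also have "\<dots> = distr (distr unit_lebesgue borel (S (r n))) ?NK g'"
      unfolding Z(2) by (simp add: \<nu>_def)
    also have "\<dots> = distr unit_lebesgue ?NK (\<lambda>w. g' (S (r n) w))"
      using distr_distr[OF g'm Sm] by (simp add: o_def)
    also have "(\<lambda>w. g' (S (r n) w)) = (\<lambda>w. x (Y (r n) w))"
      using h x by (auto simp: S_def g'_def)
    finally show ?thesis unfolding M_def by simp
  qed
  have MP: "M (Y (r n)) \<in> prob_measures K" for n
    unfolding Mr by (rule distr_in_prob_measures[OF Om gZ])
  have ZCs: "AE w in \<Omega>. \<forall>n. Z n w \<in> Cs"
  proof (subst AE_all_countable, rule allI)
    fix n
    have "AE s in distr \<Omega> borel (Z n). s \<in> Cs"
      unfolding Z(2) o_def \<nu>_def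
      by (subst AE_distr_iff[OF Sm]) (use SCs Cs(1) compact_imp_closed in \<open>auto intro: borel_closed\<close>)
    then show "AE w in \<Omega>. Z n w \<in> Cs"
      by (subst (asm) AE_distr_iff[OF Z(1)]) (use Cs(1) compact_imp_closed in \<open>auto intro: borel_closed\<close>)
  qed
  have conv: "AE w in \<Omega>. (\<lambda>n. g' (Z n w)) \<longlonglongrightarrow> g' (Z' w)"
    using ZCs AE_space
  proof eventually_elim
    case (elim w)
    note True = elim(2)
    have "Z' w \<in> Cs" using closed_sequentially[OF compact_imp_closed[OF Cs(1)], of "\<lambda>n. Z n w"] elim lim[OF True] by blast
    then have "(\<lambda>n. g (Z n w)) \<longlonglongrightarrow> g (Z' w)"
      using continuous_on_tendsto_compose[OF Cs(2) lim[OF True]] elim by simp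
    then show ?case using elim \<open>Z' w \<in> Cs\<close> by (simp add: g'_def)
  qed
  define D where "D = diameter K"
  have D: "dist a b \<le> D" if "a \<in> K" "b \<in> K" for a b
    using that diameter_bounded_bound[OF compact_imp_bounded[OF K(1)]] D_def by blast
  have dm: "(\<lambda>w. dist (g' (Z n w)) (g' (Z' w))) \<in> borel_measurable \<Omega>" for n
    using gZ[of n] gZ' measurable_restrict_space2_iff by (intro borel_measurable_dist) blast+
  \<comment> \<open>On Skorohod's space the approximations and the limit are coupled, so almost sure
    convergence with bounded distances controls \<open>wasserstein1\<close>.\<close>
  have "(\<lambda>n. \<integral>w. dist (g' (Z n w)) (g' (Z' w)) \<partial>\<Omega>) \<longlonglongrightarrow> (\<integral>w. 0 \<partial>\<Omega>)"
  proof (rule integral_dominated_convergence[where w="\<lambda>_. D"])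
    show "AE w in \<Omega>. (\<lambda>n. dist (g' (Z n w)) (g' (Z' w))) \<longlonglongrightarrow> 0"
      using conv by eventually_elim (simp add: tendsto_dist_iff[symmetric])
  qed (use dm D g'K in auto)
  then have dl: "(\<lambda>n. \<integral>w. dist (g' (Z n w)) (g' (Z' w)) \<partial>\<Omega>) \<longlonglongrightarrow> 0" by simp
  have fl: "\<bar>f y (M (Y (r n))) - f y m\<bar> \<le> C * (\<integral>w. dist (g' (Z n w)) (g' (Z' w)) \<partial>\<Omega>)" if "y \<in> K" for n y
  proof -
    have "\<bar>f y (M (Y (r n))) - f y m\<bar> \<le> C * wasserstein1 (M (Y (r n))) m" by (rule lip[OF MP m that])
    also have "\<dots> \<le> C * (\<integral>w. dist (g' (Z n w)) (g' (Z' w)) \<partial>\<Omega>)"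
      using C wasserstein1_distr_le[OF Om gZ gZ'] unfolding Mr m_def by (simp add: mult_left_mono)
    finally show ?thesis .
  qed
  have cl: "(\<lambda>n. C * (\<integral>w. dist (g' (Z n w)) (g' (Z' w)) \<partial>\<Omega>)) \<longlonglongrightarrow> 0"
    using tendsto_mult[OF tendsto_const dl, of C] by simp
  have fconv: "(\<lambda>n. f y (M (Y (r n)))) \<longlonglongrightarrow> f y m" if "y \<in> K" for y
    using Lim_null_comparison[OF _ cl, of "\<lambda>n. f y (M (Y (r n))) - f y m"] fl[OF that]
    by (simp add: LIM_zero_iff)
  have i1: "(\<lambda>n. \<integral>y. f y m \<partial>(M (Y (r n)))) \<longlonglongrightarrow> (\<integral>y. f y m \<partial>m)"
  proof -
    have fm: "(\<lambda>y. f y m) \<in> borel_measurable ?NK"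
      by (rule borel_measurable_continuous_on_restrict[OF cont[OF m]])
    obtain B where B: "\<forall>y\<in>K. \<bar>f y m\<bar> \<le> B"
      using compact_imp_bounded[OF compact_continuous_image[OF cont[OF m] K(1)]] unfolding bounded_iff by auto
    have "(\<lambda>n. \<integral>w. f (g' (Z n w)) m \<partial>\<Omega>) \<longlonglongrightarrow> (\<integral>w. f (g' (Z' w)) m \<partial>\<Omega>)"
    proof (rule integral_dominated_convergence[where w="\<lambda>_. B"])
      show "AE w in \<Omega>. (\<lambda>n. f (g' (Z n w)) m) \<longlonglongrightarrow> f (g' (Z' w)) m"
        using conv by eventually_elim (rule continuous_on_tendsto_compose[OF cont[OF m]], use g'K in auto)
    qed (use B g'K measurable_compose[OF gZ fm] measurable_compose[OF gZ' fm] in auto)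
    then show ?thesis unfolding Mr using integral_distr[OF gZ fm] integral_distr[OF gZ' fm] by (simp add: m_def)
  qed
  \<comment> \<open>Both integrand and measure vary: \<open>i2\<close> changes the integrand
    uniformly by the Lipschitz bound, \<open>i1\<close> changes the measure under a fixed continuous
    integrand.\<close>
  have i2: "(\<lambda>n. (\<integral>y. f y (M (Y (r n))) \<partial>(M (Y (r n)))) - (\<integral>y. f y m \<partial>(M (Y (r n))))) \<longlonglongrightarrow> 0"
  proof (rule Lim_null_comparison[OF _ cl], intro always_eventually allI)
    fix n
    interpret Mn: prob_space "M (Y (r n))" using MP prob_measures_prob by blast
    have int: "integrable (M (Y (r n))) (\<lambda>y. f y (M (Y (r n))))" "integrable (M (Y (r n))) (\<lambda>y. f y m)"
      using integrable_prob_measures[OF K(1) cont[OF MP] MP] integrable_prob_measures[OF K(1) cont[OF m] MP] by auto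
    have "\<bar>(\<integral>y. f y (M (Y (r n))) \<partial>(M (Y (r n)))) - (\<integral>y. f y m \<partial>(M (Y (r n))))\<bar>
       = \<bar>\<integral>y. f y (M (Y (r n))) - f y m \<partial>(M (Y (r n)))\<bar>" using int by simp
    also have "\<dots> \<le> (\<integral>y. \<bar>f y (M (Y (r n))) - f y m\<bar> \<partial>(M (Y (r n))))" by (rule integral_abs_bound)
    also have "\<dots> \<le> (\<integral>y. C * (\<integral>w. dist (g' (Z n w)) (g' (Z' w)) \<partial>\<Omega>) \<partial>(M (Y (r n))))"
      using int fl space_prob_measures[OF MP[of n]] by (intro integral_mono) auto
    also have "\<dots> = C * (\<integral>w. dist (g' (Z n w)) (g' (Z' w)) \<partial>\<Omega>)" by (simp add: Mn.prob_space[simplified])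
    finally show "norm ((\<integral>y. f y (M (Y (r n))) \<partial>(M (Y (r n)))) - (\<integral>y. f y m \<partial>(M (Y (r n)))))
      \<le> C * (\<integral>w. dist (g' (Z n w)) (g' (Z' w)) \<partial>\<Omega>)" by simp
  qed
  have iconv: "(\<lambda>n. \<integral>y. f y (M (Y (r n))) \<partial>(M (Y (r n)))) \<longlonglongrightarrow> (\<integral>y. f y m \<partial>m)"
    using tendsto_add[OF i2 i1] by simp
  have le: "(\<integral>y. f y m \<partial>m) \<le> f (x j) m" for j
  proof (rule tendsto_le[OF _ _ iconv])
    have "(\<lambda>n. 1 / real (Suc (r n))) \<longlonglongrightarrow> 0"
      using LIMSEQ_subseq_LIMSEQ[OF LIMSEQ_inverse_real_of_nat r] by (simp add: o_def inverse_eq_divide)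
    then show "(\<lambda>n. f (x j) (M (Y (r n))) + 1 / real (Suc (r n))) \<longlonglongrightarrow> f (x j) m"
      using tendsto_add[OF fconv[OF x[of j]]] by fastforce
    show "\<forall>\<^sub>F n in sequentially. (\<integral>y. f y (M (Y (r n))) \<partial>(M (Y (r n)))) \<le> f (x j) (M (Y (r n))) + 1 / real (Suc (r n))"
      using eventually_ge_at_top[of j]
    proof eventually_elim
      case (elim n)
      then have "j \<le> r n" using seq_suble[OF r, of n] by linarith
      then show ?case by (rule eq)
    qed
  qed simp
  have "(\<integral>x. f x m \<partial>m) \<le> f y m" if y: "y \<in> K" for y
  proof -
    obtain s where s: "\<And>n. s n \<in> T" "s \<longlonglongrightarrow> y" using T(3) y closure_sequential[of y T] by blast
    have "(\<lambda>n. f (s n) m) \<longlonglongrightarrow> f y m"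
      by (rule continuous_on_tendsto_compose[OF cont[OF m] s(2) y]) (intro always_eventually allI, use s(1) T(2) in blast)
    moreover have "(\<integral>x. f x m \<partial>m) \<le> f (s n) m" for n using s(1)[of n] xT le by fastforce
    ultimately show ?thesis by (intro LIMSEQ_le_const) auto
  qed
  with m that show ?thesis by blast
qed

section \<open>Flows of locally Lipschitz vector fields\<close>

lemma antiderivative_exists:
  fixes g :: "real \<Rightarrow> 'b::euclidean_space"
  assumes "continuous_on UNIV g"
  obtains F where "F 0 = 0" "\<And>t. (F has_vector_derivative g t) (at t)"
proof -
  have "isCont g x" for x using assms by (simp add: continuous_on_eq_continuous_at)
  then obtain F where F: "\<And>t. (F has_vector_derivative g t) (at t)"
    using einterval_antiderivative[of "-\<infinity>" "\<infinity>" g] by auto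
  have "((\<lambda>t. F t - F 0) has_vector_derivative g t) (at t)" for t
    using has_vector_derivative_diff[OF F has_vector_derivative_const[of "F 0"]] by simp
  then show ?thesis using that[of "\<lambda>t. F t - F 0"] by simp
qed

lemma norm_le_exp_of_derivative_aux:
  fixes F :: "real \<Rightarrow> 'b::real_normed_vector"
  assumes F: "F 0 = 0" "\<And>t. (F has_vector_derivative g t) (at t)"
    and g: "\<And>t. norm (g t) \<le> D * exp (k * \<bar>t\<bar>)" and k: "k > 0" and t: "t \<ge> 0"
  shows "norm (F t) \<le> D / k * exp (k * t)"
proof (cases "t = 0")
  case True
  have "0 \<le> D" using g[of 0] norm_ge_zero[of "g 0"] by (simp only: abs_zero mult_zero_right exp_zero mult_1_right)
  then show ?thesis using True F k by simp
next
  case False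
  have D: "0 \<le> D" using g[of 0] norm_ge_zero[of "g 0"] by (simp only: abs_zero mult_zero_right exp_zero mult_1_right)
  have "norm (F t - F 0) \<le> D / k * exp (k * t) - D / k * exp (k * 0)"
  proof (rule differentiable_bound_general[where f'=g and \<phi>'="\<lambda>s. D * exp (k * s)"])
    show "0 < t" using t False by simp
    show "continuous_on {0..t} F"
      using F(2) has_vector_derivative_continuous continuous_at_imp_continuous_on by blast
    show "continuous_on {0..t} (\<lambda>s. D / k * exp (k * s))" by (intro continuous_intros)
    show "((\<lambda>s. D / k * exp (k * s)) has_vector_derivative D * exp (k * x)) (at x)" for x
      using k unfolding has_real_derivative_iff_has_vector_derivative[symmetric]
      by (auto intro!: derivative_eq_intros)
    show "norm (g x) \<le> D * exp (k * x)" if "0 < x" for x using g[of x] that by simp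
  qed (rule F(2))
  also have "\<dots> \<le> D / k * exp (k * t)" using D k by simp
  finally show ?thesis using F by simp
qed

lemma has_vector_derivative_reflect:
  assumes "(F has_vector_derivative g) (at (- t))"
  shows "((\<lambda>t. F (- t)) has_vector_derivative - g) (at t)"
proof -
  have "((F \<circ> uminus) has_vector_derivative (- 1) *\<^sub>R g) (at t)"
    by (rule vector_diff_chain_at) (auto intro!: derivative_eq_intros assms)
  then show ?thesis by (simp add: o_def)
qed

text \<open>With the exponential weight, integration from 0 is an operator of norm at most
  \<open>1 / k\<close> on the whole line.\<close>

lemma norm_le_exp_of_derivative:
  fixes F :: "real \<Rightarrow> 'b::real_normed_vector"
  assumes F: "F 0 = 0" "\<And>t. (F has_vector_derivative g t) (at t)"
    and g: "\<And>t. norm (g t) \<le> D * exp (k * \<bar>t\<bar>)" and k: "k > 0"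
  shows "norm (F t) \<le> D / k * exp (k * \<bar>t\<bar>)"
proof (cases "t \<ge> 0")
  case True
  then show ?thesis using norm_le_exp_of_derivative_aux[OF assms] by simp
next
  case False
  have "norm (F (- (- t))) \<le> D / k * exp (k * (- t))"
    by (rule norm_le_exp_of_derivative_aux[where g="\<lambda>t. - g (- t)"])
       (use F g[of "- _"] k False in \<open>auto intro!: has_vector_derivative_reflect\<close>)
  then show ?thesis using False by simp
qed

text \<open>Picard iteration in a space of functions weighted by \<open>exp (- k * |t|)\<close>: the
  integral operator contracts on the whole line at once, and no local solutions have to be glued.
  The unknown \<open>G\<close> is the weighted deviation from \<open>z\<close>, a bounded continuous
  function.\<close>

lemma picard_lindelof_global:
  fixes X :: "'b::euclidean_space \<Rightarrow> 'b"
  assumes lip: "\<And>a b. norm (X a - X b) \<le> K * norm (a - b)"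
  obtains y where "y 0 = z" "\<And>t. (y has_vector_derivative X (y t)) (at t)"
proof -
  have K0: "K \<ge> 0"
  proof -
    obtain i :: 'b where "i \<in> Basis" using nonempty_Basis by blast
    then have "norm (X i - X 0) \<le> K" using lip[of i 0] by simp
    then show ?thesis by (rule order_trans[OF norm_ge_zero])
  qed
  have cX: "continuous_on UNIV X"
  proof (rule lipschitz_on_continuous_on[OF lipschitz_onI])
    fix a b :: 'b
    show "dist (X a) (X b) \<le> K * dist a b" using lip by (simp add: dist_norm)
  qed (rule K0)
  \<comment> \<open>Twice the Lipschitz constant makes the contraction factor \<open>K / k\<close>
    at most 1/2; the 1 keeps \<open>k\<close> positive when \<open>K = 0\<close>.\<close>
  define k where "k = 2 * K + 1"
  have k: "k > 0" "K / k \<le> 1/2" using K0 by (auto simp: k_def field_simps)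
  let ?w = "\<lambda>(G :: real \<Rightarrow>\<^sub>C 'b) s. z + exp (k * \<bar>s\<bar>) *\<^sub>R G s"
  have cG: "continuous_on UNIV (\<lambda>s. X (?w G s))" for G
    by (intro continuous_on_compose2[OF cX] continuous_intros) auto
  \<comment> \<open>A chosen antiderivative vanishing at 0 stands for the integral from 0 to
    \<open>t\<close>, for either sign of \<open>t\<close>.\<close>
  define A where "A g = (SOME F :: real \<Rightarrow> 'b. F 0 = 0 \<and> (\<forall>t. (F has_vector_derivative g t) (at t)))" for g
  have A: "A g 0 = 0 \<and> (\<forall>t. (A g has_vector_derivative g t) (at t))" if "continuous_on UNIV g" for g
  proof -
    have "\<exists>F :: real \<Rightarrow> 'b. F 0 = 0 \<and> (\<forall>t. (F has_vector_derivative g t) (at t))"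
      using antiderivative_exists[OF that] by metis
    from someI_ex[OF this] show ?thesis unfolding A_def .
  qed
  note AG = A[OF cG]
  have Wb: "norm (X (?w G s)) \<le> (norm (X z) + K * norm G) * exp (k * \<bar>s\<bar>)" for G s
  proof -
    have "norm (X (?w G s)) \<le> norm (X z) + norm (X (?w G s) - X z)"
      using norm_triangle_ineq[of "X z" "X (?w G s) - X z"] by simp
    also have "norm (X (?w G s) - X z) \<le> K * norm (?w G s - z)" by (rule lip)
    also have "norm (?w G s - z) = exp (k * \<bar>s\<bar>) * norm (G s)" by simp
    also have "K * (exp (k * \<bar>s\<bar>) * norm (G s)) \<le> K * (exp (k * \<bar>s\<bar>) * norm G)"
      using K0 norm_bounded[of G s] by (intro mult_left_mono) auto
    also have "norm (X z) + K * (exp (k * \<bar>s\<bar>) * norm G) \<le> norm (X z) * exp (k * \<bar>s\<bar>) + K * (exp (k * \<bar>s\<bar>) * norm G)"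
      using k mult_left_mono[of 1 "exp (k * \<bar>s\<bar>)" "norm (X z)"] by simp
    finally show ?thesis by (simp add: algebra_simps)
  qed
  define \<Phi> where "\<Phi> G = Bcontfun (\<lambda>t. exp (- (k * \<bar>t\<bar>)) *\<^sub>R A (\<lambda>s. X (?w G s)) t)" for G
  have \<Phi>: "\<Phi> G t = exp (- (k * \<bar>t\<bar>)) *\<^sub>R A (\<lambda>s. X (?w G s)) t" for G t
  proof -
    have c: "continuous_on UNIV (A (\<lambda>s. X (?w G s)))"
      using AG[of G] has_vector_derivative_continuous continuous_at_imp_continuous_on by blast
    have "(\<lambda>t. exp (- (k * \<bar>t\<bar>)) *\<^sub>R A (\<lambda>s. X (?w G s)) t) \<in> bcontfun"
    proof (rule bcontfun_normI)
      show "continuous_on UNIV (\<lambda>t. exp (- (k * \<bar>t\<bar>)) *\<^sub>R A (\<lambda>s. X (?w G s)) t)"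
        by (intro continuous_intros c)
      fix t
      have "norm (A (\<lambda>s. X (?w G s)) t) \<le> (norm (X z) + K * norm G) / k * exp (k * \<bar>t\<bar>)"
        by (rule norm_le_exp_of_derivative) (use AG Wb k in auto)
      then have "exp (- (k * \<bar>t\<bar>)) * norm (A (\<lambda>s. X (?w G s)) t) \<le> exp (- (k * \<bar>t\<bar>)) * ((norm (X z) + K * norm G) / k * exp (k * \<bar>t\<bar>))"
        by (intro mult_left_mono) auto
      also have "\<dots> = (norm (X z) + K * norm G) / k * (exp (- (k * \<bar>t\<bar>)) * exp (k * \<bar>t\<bar>))"
        by (simp only: ac_simps)
      also have "exp (- (k * \<bar>t\<bar>)) * exp (k * \<bar>t\<bar>) = 1" by (simp flip: exp_add)
      finally show "norm (exp (- (k * \<bar>t\<bar>)) *\<^sub>R A (\<lambda>s. X (?w G s)) t) \<le> (norm (X z) + K * norm G) / k"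
        by simp
    qed
    then show ?thesis by (simp add: \<Phi>_def Bcontfun_inverse)
  qed
  have contr: "dist (\<Phi> G) (\<Phi> G') \<le> 1/2 * dist G G'" for G G'
  proof (rule dist_bound)
    fix t
    let ?F = "\<lambda>t. A (\<lambda>s. X (?w G s)) t - A (\<lambda>s. X (?w G' s)) t"
    have "norm (?F t) \<le> (K * dist G G') / k * exp (k * \<bar>t\<bar>)"
    proof (rule norm_le_exp_of_derivative[where g="\<lambda>s. X (?w G s) - X (?w G' s)"])
      show "(?F has_vector_derivative X (?w G t) - X (?w G' t)) (at t)" for t
        using AG by (intro has_vector_derivative_diff) auto
      show "norm (X (?w G s) - X (?w G' s)) \<le> K * dist G G' * exp (k * \<bar>s\<bar>)" for s
      proof -
        have "norm (X (?w G s) - X (?w G' s)) \<le> K * norm (?w G s - ?w G' s)" by (rule lip)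
        also have "norm (?w G s - ?w G' s) = exp (k * \<bar>s\<bar>) * dist (G s) (G' s)"
          by (simp add: dist_norm flip: scaleR_diff_right)
        also have "K * \<dots> \<le> K * (exp (k * \<bar>s\<bar>) * dist G G')"
          using K0 dist_bounded[of G s G'] by (intro mult_left_mono) auto
        finally show ?thesis by (simp add: algebra_simps)
      qed
    qed (use AG k in auto)
    then have "exp (- (k * \<bar>t\<bar>)) * norm (?F t) \<le> exp (- (k * \<bar>t\<bar>)) * ((K * dist G G') / k * exp (k * \<bar>t\<bar>))"
      by (intro mult_left_mono) auto
    also have "\<dots> = K / k * dist G G' * (exp (- (k * \<bar>t\<bar>)) * exp (k * \<bar>t\<bar>))" by simp
    also have "exp (- (k * \<bar>t\<bar>)) * exp (k * \<bar>t\<bar>) = 1" by (simp flip: exp_add)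
    also have "K / k * dist G G' * 1 = K / k * dist G G'" by simp
    also have "\<dots> \<le> 1/2 * dist G G'" using k(2) by (rule mult_right_mono) simp
    finally show "dist (\<Phi> G t) (\<Phi> G' t) \<le> 1/2 * dist G G'"
      unfolding \<Phi> dist_norm by (simp flip: scaleR_diff_right)
  qed
  obtain G where G: "\<Phi> G = G"
    using banach_fix_type[of "1/2" \<Phi>] contr by auto
  let ?y = "?w G"
  have y: "?y t = z + A (\<lambda>s. X (?y s)) t" for t
  proof -
    have "exp (k * \<bar>t\<bar>) *\<^sub>R G t = exp (k * \<bar>t\<bar>) *\<^sub>R \<Phi> G t" using G by simp
    also have "\<dots> = A (\<lambda>s. X (?y s)) t" unfolding \<Phi> by (simp flip: exp_add)
    finally show ?thesis by simp
  qed
  show ?thesis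
  proof
    show "?y 0 = z" using y[of 0] AG by simp
    have "((\<lambda>t. z + A (\<lambda>s. X (?y s)) t) has_vector_derivative X (?y t)) (at t)" for t
      using AG[of G] by (auto intro!: derivative_eq_intros)
    then show "(?y has_vector_derivative X (?y t)) (at t)" for t unfolding y[symmetric] .
  qed
qed

text \<open>The weighted squared distance \<open>exp (- 2 * K * t) * |y - z|^2\<close> is
  nonincreasing; squaring avoids differentiating the norm at 0.\<close>

lemma gronwall_aux:
  fixes y z :: "real \<Rightarrow> 'b::real_inner"
  assumes y: "\<And>t. 0 \<le> t \<Longrightarrow> t \<le> T \<Longrightarrow> (y has_vector_derivative f t) (at t)"
    and z: "\<And>t. 0 \<le> t \<Longrightarrow> t \<le> T \<Longrightarrow> (z has_vector_derivative g t) (at t)"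
    and le: "\<And>t. 0 \<le> t \<Longrightarrow> t \<le> T \<Longrightarrow> norm (f t - g t) \<le> K * norm (y t - z t)"
    and T: "T \<ge> 0"
  shows "norm (y T - z T) \<le> exp (K * T) * norm (y 0 - z 0)"
proof -
  let ?\<phi> = "\<lambda>t. exp (- (2 * K * t)) * ((y t - z t) \<bullet> (y t - z t))"
  have "?\<phi> T \<le> ?\<phi> 0"
  proof (rule DERIV_nonpos_imp_nonincreasing[OF T])
    fix t assume t: "0 \<le> t" "t \<le> T"
    let ?d = "y t - z t" and ?e = "f t - g t"
    have "((\<lambda>t. y t - z t) has_vector_derivative ?e) (at t)" using y z t by (intro has_vector_derivative_diff) auto
    then have d: "((\<lambda>t. y t - z t) has_derivative (\<lambda>h. h *\<^sub>R ?e)) (at t)"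
      by (simp add: has_vector_derivative_def)
    have "((\<lambda>t. (y t - z t) \<bullet> (y t - z t)) has_derivative (\<lambda>h. ?d \<bullet> (h *\<^sub>R ?e) + (h *\<^sub>R ?e) \<bullet> ?d)) (at t)"
      by (rule has_derivative_inner[OF d d])
    then have "((\<lambda>t. (y t - z t) \<bullet> (y t - z t)) has_real_derivative 2 * (?d \<bullet> ?e)) (at t)"
      unfolding has_field_derivative_def
      by (rule has_derivative_eq_rhs) (auto simp: inner_commute algebra_simps)
    moreover have "((\<lambda>t. exp (- (2 * K * t))) has_real_derivative exp (- (2 * K * t)) * (- (2 * K))) (at t)"
      by (auto intro!: derivative_eq_intros)
    ultimately have "(?\<phi> has_real_derivative exp (- (2 * K * t)) * (- (2 * K)) * (?d \<bullet> ?d) + 2 * (?d \<bullet> ?e) * exp (- (2 * K * t))) (at t)"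
      by (rule DERIV_mult[rotated])
    moreover have "exp (- (2 * K * t)) * (- (2 * K)) * (?d \<bullet> ?d) + 2 * (?d \<bullet> ?e) * exp (- (2 * K * t)) \<le> 0"
    proof -
      have "?d \<bullet> ?e \<le> norm ?d * norm ?e" by (rule norm_cauchy_schwarz)
      also have "\<dots> \<le> norm ?d * (K * norm ?d)" using le t by (intro mult_left_mono) auto
      also have "\<dots> = K * (?d \<bullet> ?d)" by (simp add: dot_square_norm power2_eq_square)
      finally have "exp (- (2 * K * t)) * (2 * (?d \<bullet> ?e) - 2 * K * (?d \<bullet> ?d)) \<le> 0"
        by (intro mult_nonneg_nonpos) auto
      then show ?thesis by (simp add: algebra_simps)
    qed
    ultimately show "\<exists>l. (?\<phi> has_real_derivative l) (at t) \<and> l \<le> 0" by blast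
  qed
  then have "exp (2 * K * T) * ?\<phi> T \<le> exp (2 * K * T) * ?\<phi> 0" by (intro mult_left_mono) auto
  then have "(y T - z T) \<bullet> (y T - z T) \<le> exp (2 * K * T) * ((y 0 - z 0) \<bullet> (y 0 - z 0))"
    by (simp add: exp_minus field_simps)
  also have "exp (2 * K * T) = exp (K * T) * exp (K * T)" by (simp flip: exp_add)
  finally have "(norm (y T - z T))\<^sup>2 \<le> (exp (K * T) * norm (y 0 - z 0))\<^sup>2"
    by (simp add: dot_square_norm power2_eq_square algebra_simps)
  then show ?thesis by (rule power2_le_imp_le) simp
qed

lemma gronwall:
  fixes y z :: "real \<Rightarrow> 'b::real_inner"
  assumes y: "\<And>t. \<bar>t\<bar> \<le> T \<Longrightarrow> (y has_vector_derivative f t) (at t)"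
    and z: "\<And>t. \<bar>t\<bar> \<le> T \<Longrightarrow> (z has_vector_derivative g t) (at t)"
    and le: "\<And>t. \<bar>t\<bar> \<le> T \<Longrightarrow> norm (f t - g t) \<le> K * norm (y t - z t)"
    and t: "\<bar>t\<bar> \<le> T"
  shows "norm (y t - z t) \<le> exp (K * \<bar>t\<bar>) * norm (y 0 - z 0)"
proof (cases "t \<ge> 0")
  case True
  then have "norm (y t - z t) \<le> exp (K * t) * norm (y 0 - z 0)"
    using t by (intro gronwall_aux[OF y z le]) auto
  then show ?thesis using True by simp
next
  case False
  have "norm (y (- (- t)) - z (- (- t))) \<le> exp (K * (- t)) * norm (y (- 0) - z (- 0))"
  proof (rule gronwall_aux[where f="\<lambda>s. - f (- s)" and g="\<lambda>s. - g (- s)"])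
    fix s assume s: "0 \<le> s" "s \<le> - t"
    then have s': "\<bar>- s\<bar> \<le> T" using t False by simp
    show "((\<lambda>s. y (- s)) has_vector_derivative - f (- s)) (at s)"
      "((\<lambda>s. z (- s)) has_vector_derivative - g (- s)) (at s)"
      using y[OF s'] z[OF s'] by (auto intro: has_vector_derivative_reflect)
    show "norm (- f (- s) - - g (- s)) \<le> K * norm (y (- s) - z (- s))"
      using le[OF s'] by (simp add: norm_minus_commute)
  qed (use False in auto)
  then show ?thesis using False by simp
qed

text \<open>The field is cut off to a globally Lipschitz one, whose solution exists for all times.
  The a priori bound must hold for the cut-off field too, before its solution is known to stay where
  nothing was changed; hence \<open>bound\<close> speaks of all rescalings of \<open>X\<close> by
  factors in \<open>[0, 1]\<close>.\<close>

theorem locally_lipschitz_flow: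
  fixes X :: "'b::euclidean_space \<Rightarrow> 'b"
  assumes loc: "\<And>R. \<exists>K. \<forall>a\<in>cball 0 R. \<forall>b\<in>cball 0 R. norm (X a - X b) \<le> K * norm (a - b)"
    and bound: "\<And>R T. \<exists>B. \<forall>(\<kappa>::'b \<Rightarrow> real) y. (\<forall>z. 0 \<le> \<kappa> z \<and> \<kappa> z \<le> 1) \<and> norm (y 0) \<le> R \<and>
        (\<forall>t. (y has_vector_derivative \<kappa> (y t) *\<^sub>R X (y t)) (at t)) \<longrightarrow> (\<forall>t. \<bar>t\<bar> \<le> T \<longrightarrow> norm (y t) \<le> B)"
  obtains \<Phi> where "\<And>z. \<Phi> z 0 = z" "\<And>z t. (\<Phi> z has_vector_derivative X (\<Phi> z t)) (at t)"
    "\<And>y t. (\<And>s. (y has_vector_derivative X (y s)) (at s)) \<Longrightarrow> y t = \<Phi> (y 0) t"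
    "\<And>t. continuous_on UNIV (\<lambda>z. \<Phi> z t)"
proof -
  obtain Kf where Kf: "\<And>R a b. a \<in> cball 0 R \<Longrightarrow> b \<in> cball 0 R \<Longrightarrow> norm (X a - X b) \<le> Kf R * norm (a - b)"
    using loc by metis
  obtain Bf where Bf: "\<And>R T \<kappa> y t. (\<forall>z. 0 \<le> \<kappa> z \<and> \<kappa> z \<le> 1) \<Longrightarrow> norm (y 0) \<le> R \<Longrightarrow>
      (\<forall>t. (y has_vector_derivative \<kappa> (y t) *\<^sub>R X (y t)) (at t)) \<Longrightarrow> \<bar>t\<bar> \<le> T \<Longrightarrow> norm (y t) \<le> Bf R T"
    using bound by metis
  have uniq: "norm (y t - z t) \<le> exp (Kf B * \<bar>t\<bar>) * norm (y 0 - z 0)"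
    if "\<And>s. \<bar>s\<bar> \<le> T \<Longrightarrow> (y has_vector_derivative X (y s)) (at s)" "\<And>s. \<bar>s\<bar> \<le> T \<Longrightarrow> (z has_vector_derivative X (z s)) (at s)"
      "\<And>s. \<bar>s\<bar> \<le> T \<Longrightarrow> norm (y s) \<le> B" "\<And>s. \<bar>s\<bar> \<le> T \<Longrightarrow> norm (z s) \<le> B" "\<bar>t\<bar> \<le> T" for y z T B t
    by (rule gronwall[of T y "\<lambda>s. X (y s)" z "\<lambda>s. X (z s)"]) (use that Kf in auto)
  have ex: "\<exists>y. y 0 = z \<and> (\<forall>t. (y has_vector_derivative X (y t)) (at t))" for z
  proof -
    have local: "\<exists>y. y 0 = z \<and> (\<forall>t. \<bar>t\<bar> \<le> real n \<longrightarrow> (y has_vector_derivative X (y t)) (at t) \<and> norm (y t) \<le> Bf (norm z) (real n))" for n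
    proof -
      define B where "B = max 0 (Bf (norm z) (real n))"
      \<comment> \<open>The factor is 1 on the ball of radius \<open>B\<close> and 0 outside radius
        \<open>B + 1\<close>. Evaluating \<open>X\<close> at the projection onto the larger ball
        uses its Lipschitz bound only there, and the product with the factor is the same.\<close>
      define \<kappa> where "\<kappa> w = max 0 (min 1 (B + 1 - norm w))" for w :: 'b
      define P where "P = closest_point (cball (0::'b) (B + 1))"
      define X' where "X' w = \<kappa> w *\<^sub>R X (P w)" for w
      have B: "B \<ge> 0" by (simp add: B_def)
      have Pc: "P w \<in> cball 0 (B + 1)" for w
        unfolding P_def using B by (intro closest_point_in_set) auto
      have Pl: "norm (P a - P b) \<le> norm (a - b)" for a b
        using closest_point_lipschitz[of "cball (0::'b) (B+1)" a b] B by (simp add: P_def dist_norm)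
      have \<kappa>01: "0 \<le> \<kappa> w \<and> \<kappa> w \<le> 1" for w by (simp add: \<kappa>_def)
      have \<kappa>l: "\<bar>\<kappa> a - \<kappa> b\<bar> \<le> norm (a - b)" for a b
      proof -
        have "\<bar>norm a - norm b\<bar> \<le> norm (a - b)" by (rule norm_triangle_ineq3)
        then show ?thesis unfolding \<kappa>_def by linarith
      qed
      have X': "X' w = \<kappa> w *\<^sub>R X w" for w
      proof (cases "norm w \<le> B + 1")
        case True
        then show ?thesis unfolding X'_def P_def by (simp add: closest_point_self)
      next
        case False
        then show ?thesis unfolding X'_def \<kappa>_def by simp
      qed
      have K0: "0 \<le> Kf (B + 1)"
      proof -
        obtain i :: 'b where i: "i \<in> Basis" using nonempty_Basis by blast
        then have "norm (X i - X 0) \<le> Kf (B + 1) * norm (i - 0)" using B by (intro Kf) auto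
        then have "norm (X i - X 0) \<le> Kf (B + 1)" using i by simp
        then show ?thesis by (rule order_trans[OF norm_ge_zero])
      qed
      define M where "M = norm (X 0) + Kf (B + 1) * (B + 1)"
      have M: "norm (X (P w)) \<le> M" for w
      proof -
        have "norm (X (P w) - X 0) \<le> Kf (B + 1) * norm (P w - 0)" using Pc B by (intro Kf) auto
        also have "\<dots> \<le> Kf (B + 1) * (B + 1)" using Pc[of w] K0 by (intro mult_left_mono) auto
        finally show ?thesis using norm_triangle_ineq2[of "X (P w)" "X 0"] by (simp add: M_def)
      qed
      have "norm (X' a - X' b) \<le> (M + Kf (B + 1)) * norm (a - b)" for a b
      proof -
        have "X' a - X' b = (\<kappa> a - \<kappa> b) *\<^sub>R X (P a) + \<kappa> b *\<^sub>R (X (P a) - X (P b))"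
          unfolding X'_def by (simp add: algebra_simps)
        then have "norm (X' a - X' b) \<le> \<bar>\<kappa> a - \<kappa> b\<bar> * norm (X (P a)) + \<kappa> b * norm (X (P a) - X (P b))"
          using norm_triangle_ineq[of "(\<kappa> a - \<kappa> b) *\<^sub>R X (P a)" "\<kappa> b *\<^sub>R (X (P a) - X (P b))"] \<kappa>01[of b] by simp
        also have "\<dots> \<le> norm (a - b) * M + 1 * (Kf (B + 1) * norm (a - b))"
        proof (intro add_mono mult_mono)
          have "norm (X (P a) - X (P b)) \<le> Kf (B + 1) * norm (P a - P b)" by (intro Kf Pc)
          also have "\<dots> \<le> Kf (B + 1) * norm (a - b)" using Pl K0 by (intro mult_left_mono)
          finally show "norm (X (P a) - X (P b)) \<le> Kf (B + 1) * norm (a - b)" .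
        qed (use \<kappa>l M \<kappa>01 in auto)
        finally show ?thesis by (simp add: algebra_simps)
      qed
      then obtain y where y: "y 0 = z" "\<And>t. (y has_vector_derivative X' (y t)) (at t)"
        using picard_lindelof_global[of X' "M + Kf (B + 1)" z] by blast
      have b: "norm (y t) \<le> Bf (norm z) (real n)" if "\<bar>t\<bar> \<le> real n" for t
        by (rule Bf[of \<kappa>]) (use \<kappa>01 y that X' in auto)
      have "(y has_vector_derivative X (y t)) (at t)" if "\<bar>t\<bar> \<le> real n" for t
      proof -
        have "norm (y t) \<le> B" using b[OF that] by (simp add: B_def)
        then have "\<kappa> (y t) = 1" by (simp add: \<kappa>_def)
        then show ?thesis using y(2)[of t] X' by simp
      qed
      then show ?thesis using y(1) b by blast
    qed
    then obtain Y where Y: "\<And>n. Y n 0 = z" "\<And>n t. \<bar>t\<bar> \<le> real n \<Longrightarrow> (Y n has_vector_derivative X (Y n t)) (at t)"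
      and Yb: "\<And>n t. \<bar>t\<bar> \<le> real n \<Longrightarrow> norm (Y n t) \<le> Bf (norm z) (real n)"
      by metis
    have same: "Y n t = Y k t" if "\<bar>t\<bar> \<le> real n" "\<bar>t\<bar> \<le> real k" for n k t
    proof -
      let ?B = "max (Bf (norm z) (real n)) (Bf (norm z) (real k))"
      have "norm (Y n t - Y k t) \<le> exp (Kf ?B * \<bar>t\<bar>) * norm (Y n 0 - Y k 0)"
      proof (rule uniq[where T="\<bar>t\<bar>"])
        fix s assume "\<bar>s\<bar> \<le> \<bar>t\<bar>"
        then have s: "\<bar>s\<bar> \<le> real n" "\<bar>s\<bar> \<le> real k" using that by linarith+
        show "(Y n has_vector_derivative X (Y n s)) (at s)" "(Y k has_vector_derivative X (Y k s)) (at s)"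
          using Y s by auto
        show "norm (Y n s) \<le> ?B" "norm (Y k s) \<le> ?B" using Yb[OF s(1)] Yb[OF s(2)] by auto
      qed simp
      then show ?thesis using Y(1) by simp
    qed
    \<comment> \<open>The solutions on the windows \<open>[-n, n]\<close> agree on common intervals
      by \<open>same\<close>, so any window containing \<open>t\<close> gives the same
      value.\<close>
    define y where "y t = Y (nat \<lceil>\<bar>t\<bar>\<rceil>) t" for t
    have ceil: "\<bar>t\<bar> \<le> real (nat \<lceil>\<bar>t\<bar>\<rceil>)" for t :: real by linarith
    have yY: "y t = Y n t" if "\<bar>t\<bar> \<le> real n" for t n
      unfolding y_def by (rule same[OF ceil that])
    have "(y has_vector_derivative X (y t)) (at t)" for t
    proof -
      obtain n where n: "\<bar>t\<bar> < real n" using reals_Archimedean2 by blast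
      have d: "(Y n has_vector_derivative X (Y n t)) (at t)" using Y(2) n by simp
      have "t \<in> {- real n<..<real n}" using n by (auto simp: abs_less_iff)
      then have "(y has_vector_derivative X (Y n t)) (at t)"
        by (rule has_vector_derivative_transform_within_open[OF d open_greaterThanLessThan])
           (auto simp: yY abs_less_iff intro!: yY[symmetric])
      then show ?thesis using yY[of t n] n by simp
    qed
    moreover have "y 0 = z" using yY[of 0 0] Y(1) by simp
    ultimately show ?thesis by blast
  qed
  then obtain \<Phi> where \<Phi>: "\<And>z. \<Phi> z 0 = z" "\<And>z t. (\<Phi> z has_vector_derivative X (\<Phi> z t)) (at t)"
    by metis
  have b: "norm (y t) \<le> Bf R T" if "norm (y 0) \<le> R" "\<And>s. (y has_vector_derivative X (y s)) (at s)" "\<bar>t\<bar> \<le> T" for y R T t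
    by (rule Bf[of "\<lambda>_. 1"]) (use that in auto)
  show ?thesis
  proof (rule that[OF \<Phi>])
    fix y t assume y: "\<And>s. (y has_vector_derivative X (y s)) (at s)"
    have "norm (y t - \<Phi> (y 0) t) \<le> exp (Kf (Bf (norm (y 0)) \<bar>t\<bar>) * \<bar>t\<bar>) * norm (y 0 - \<Phi> (y 0) 0)"
      by (rule uniq[where T="\<bar>t\<bar>"]) (use y \<Phi> in \<open>auto intro!: b\<close>)
    then show "y t = \<Phi> (y 0) t" by (simp add: \<Phi>(1))
  next
    fix t
    show "continuous_on UNIV (\<lambda>z. \<Phi> z t)"
      unfolding continuous_on_eq_continuous_at[OF open_UNIV] continuous_at_eps_delta
    proof (intro ballI allI impI)
      fix z :: 'b and e :: real assume e: "e > 0"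
      let ?E = "exp (Kf (Bf (norm z + 1) \<bar>t\<bar>) * \<bar>t\<bar>)"
      have "norm (\<Phi> z' t - \<Phi> z t) < e" if "norm (z' - z) < min 1 (e / ?E)" for z' :: 'b
      proof -
        have z': "norm z' \<le> norm z + 1" using that norm_triangle_ineq2[of z' z] by simp
        have "norm (\<Phi> z' t - \<Phi> z t) \<le> ?E * norm (\<Phi> z' 0 - \<Phi> z 0)"
          by (rule uniq[where T="\<bar>t\<bar>"]) (use \<Phi> z' in \<open>auto intro!: b\<close>)
        also have "\<dots> < ?E * (e / ?E)" using that by (intro mult_strict_left_mono) (auto simp: \<Phi>(1))
        finally show ?thesis by simp
      qed
      then show "\<exists>d>0. \<forall>x'. dist x' z < d \<longrightarrow> dist (\<Phi> x' t) (\<Phi> z t) < e"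
        using e by (intro exI[of _ "min 1 (e / ?E)"]) (auto simp: dist_norm)
    qed
  qed
qed

section \<open>Gradients\<close>

lemma GDERIV_unique:
  assumes "GDERIV f x :> D"
  shows "grad f x = D"
  unfolding grad_def
proof (rule the_equality)
  show "GDERIV f x :> D" by (rule assms)
  fix D' assume "GDERIV f x :> D'"
  then have "(\<lambda>h. h \<bullet> D') = (\<lambda>h. h \<bullet> D)"
    using assms unfolding gderiv_def by (rule has_derivative_unique)
  then have "(D' - D) \<bullet> D' = (D' - D) \<bullet> D" by (rule fun_cong)
  then have "(D' - D) \<bullet> (D' - D) = 0" by (simp add: inner_diff_right)
  then show "D' = D" by simp
qed

lemma differentiable_imp_GDERIV:
  fixes f :: "'a::euclidean_space \<Rightarrow> real"
  assumes "f differentiable (at x)"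
  shows "GDERIV f x :> grad f x" and "dir_deriv h f x = h \<bullet> grad f x"
    and "grad f x = (\<Sum>i\<in>Basis. dir_deriv i f x *\<^sub>R i)"
proof -
  let ?D = "\<Sum>i\<in>Basis. dir_deriv i f x *\<^sub>R i"
  have d: "(f has_derivative frechet_derivative f (at x)) (at x)"
    using assms frechet_derivative_works by blast
  then have lin: "linear (frechet_derivative f (at x))" using has_derivative_linear by blast
  have e: "frechet_derivative f (at x) h = h \<bullet> ?D" for h
  proof -
    have "frechet_derivative f (at x) h = frechet_derivative f (at x) (\<Sum>i\<in>Basis. (h \<bullet> i) *\<^sub>R i)"
      by (simp add: euclidean_representation)
    also have "\<dots> = (\<Sum>i\<in>Basis. (h \<bullet> i) * dir_deriv i f x)"
      by (simp add: linear_sum[OF lin] linear_cmul[OF lin] dir_deriv_def)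
    also have "\<dots> = h \<bullet> ?D" by (simp add: inner_sum_right mult.commute)
    finally show ?thesis .
  qed
  have "(\<lambda>h. h \<bullet> ?D) = frechet_derivative f (at x)" using e by auto
  then have "GDERIV f x :> ?D" unfolding gderiv_def using d by simp
  moreover from this have g: "grad f x = ?D" by (rule GDERIV_unique)
  ultimately show "GDERIV f x :> grad f x" by simp
  show "grad f x = ?D" by (rule g)
  show "dir_deriv h f x = h \<bullet> grad f x" using e[of h] g by (simp only: dir_deriv_def)
qed

lemma Ck_1_imp_continuous_grad:
  assumes "Ck 1 f"
  shows "continuous_on UNIV (grad f)"
proof -
  have "grad f = (\<lambda>x. \<Sum>i\<in>Basis. dir_deriv i f x *\<^sub>R i)"
    using assms differentiable_imp_GDERIV(3) by (auto simp: numeral_eq_Suc)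
  moreover have "continuous_on UNIV (\<lambda>x. \<Sum>i\<in>Basis. dir_deriv i f x *\<^sub>R i)"
    using assms by (intro continuous_intros) (auto simp: numeral_eq_Suc)
  ultimately show ?thesis by simp
qed

lemma Ck_2D:
  assumes "Ck 2 f"
  shows "f differentiable (at x)" "dir_deriv h f differentiable (at x)" "Ck 1 (dir_deriv h f)" "Ck 1 f"
proof -
  show "f differentiable (at x)" "dir_deriv h f differentiable (at x)" "Ck 1 (dir_deriv h f)"
    using assms by (auto simp: numeral_2_eq_2)
  have "continuous_on UNIV (dir_deriv h f)" for h
    using assms by (auto simp: numeral_2_eq_2 intro!: continuous_at_imp_continuous_on differentiable_imp_continuous_within)
  then show "Ck 1 f" using assms by (auto simp: numeral_2_eq_2)
qed

lemma Ck_2_grad_differentiable: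
  assumes "Ck 2 f"
  shows "grad f differentiable (at x)"
proof -
  have "grad f = (\<lambda>x. \<Sum>i\<in>Basis. dir_deriv i f x *\<^sub>R i)"
    using differentiable_imp_GDERIV(3) Ck_2D(1)[OF assms] by auto
  moreover have "(\<lambda>x. \<Sum>i\<in>Basis. dir_deriv i f x *\<^sub>R i) differentiable (at x)"
    using Ck_2D(2)[OF assms] by (intro differentiable_sum differentiable_scaleR) auto
  ultimately show ?thesis by simp
qed

lemma Ck_1_lipschitz_cball:
  assumes "Ck 1 f"
  obtains K where "K \<ge> 0" "\<And>a b. a \<in> cball 0 R \<Longrightarrow> b \<in> cball 0 R \<Longrightarrow> \<bar>f a - f b\<bar> \<le> K * norm (a - b)"
proof -
  have "continuous_on (cball 0 R) (grad f)"
    using Ck_1_imp_continuous_grad[OF assms] continuous_on_subset by blast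
  then have "bounded (grad f ` cball 0 R)"
    by (intro compact_imp_bounded compact_continuous_image) auto
  then obtain K where K: "K > 0" "\<forall>y\<in>grad f ` cball 0 R. norm y \<le> K" using bounded_pos by blast
  have fd: "f differentiable (at x)" for x using assms by simp
  have "norm (f a - f b) \<le> K * norm (a - b)" if "a \<in> cball 0 R" "b \<in> cball 0 R" for a b
  proof (rule differentiable_bound[of "cball 0 R" f "\<lambda>x h. h \<bullet> grad f x"])
    fix x assume x: "x \<in> cball (0::'a) R"
    show "(f has_derivative (\<lambda>h. h \<bullet> grad f x)) (at x within cball 0 R)"
      using differentiable_imp_GDERIV(1)[OF fd] unfolding gderiv_def by (rule has_derivative_at_withinI)
    show "onorm (\<lambda>h. h \<bullet> grad f x) \<le> K"
    proof (rule onorm_bound)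
      fix h
      have "norm (h \<bullet> grad f x) \<le> norm h * norm (grad f x)" by (simp add: Cauchy_Schwarz_ineq2)
      also have "\<dots> \<le> norm h * K" using K x by (intro mult_left_mono) auto
      finally show "norm (h \<bullet> grad f x) \<le> K * norm h" by (simp add: mult.commute)
    qed (use K in simp)
  qed (use that in auto)
  then show ?thesis using that[of K] K by simp
qed

lemma Ck_2_grad_lipschitz_cball:
  assumes "Ck 2 f"
  obtains K where "K \<ge> 0" "\<And>a b. a \<in> cball 0 R \<Longrightarrow> b \<in> cball 0 R \<Longrightarrow> norm (grad f a - grad f b) \<le> K * norm (a - b)"
proof -
  have "\<exists>K. K \<ge> 0 \<and> (\<forall>a\<in>cball 0 R. \<forall>b\<in>cball 0 R. \<bar>dir_deriv i f a - dir_deriv i f b\<bar> \<le> K * norm (a - b))" for i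
    by (rule Ck_1_lipschitz_cball[OF Ck_2D(3)[OF assms], of R i]) blast
  then obtain K where K: "\<And>i. K i \<ge> 0"
    "\<And>i a b. a \<in> cball 0 R \<Longrightarrow> b \<in> cball 0 R \<Longrightarrow> \<bar>dir_deriv i f a - dir_deriv i f b\<bar> \<le> K i * norm (a - b)"
    by metis
  have "norm (grad f a - grad f b) \<le> (\<Sum>i\<in>Basis. K i) * norm (a - b)" if "a \<in> cball 0 R" "b \<in> cball 0 R" for a b
  proof -
    have "(grad f a - grad f b) \<bullet> i = dir_deriv i f a - dir_deriv i f b" for i
      using differentiable_imp_GDERIV(2)[OF Ck_2D(1)[OF assms]] by (simp add: inner_diff_right inner_commute[of _ i])
    then have "norm (grad f a - grad f b) \<le> (\<Sum>i\<in>Basis. \<bar>dir_deriv i f a - dir_deriv i f b\<bar>)"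
      using norm_le_l1[of "grad f a - grad f b"] by simp
    also have "\<dots> \<le> (\<Sum>i\<in>Basis. K i * norm (a - b))" by (intro sum_mono K that)
    finally show ?thesis by (simp add: sum_distrib_right)
  qed
  then show ?thesis using that[of "\<Sum>i\<in>Basis. K i"] K(1) by (simp add: sum_nonneg)
qed

lemma locally_lipschitz_imp_continuous:
  fixes f :: "'a::real_normed_vector \<Rightarrow> 'b::real_normed_vector"
  assumes "\<And>R. \<exists>K. \<forall>a\<in>cball 0 R. \<forall>b\<in>cball 0 R. norm (f a - f b) \<le> K * norm (a - b)"
  shows "continuous_on UNIV f"
  unfolding continuous_on_eq_continuous_at[OF open_UNIV]
proof
  fix x :: 'a
  obtain K where K: "\<And>a b. a \<in> cball 0 (norm x + 1) \<Longrightarrow> b \<in> cball 0 (norm x + 1) \<Longrightarrow> norm (f a - f b) \<le> K * norm (a - b)"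
    using assms by metis
  have "isCont f x"
    unfolding isCont_def LIM_def
  proof (intro allI impI)
    fix e :: real assume e: "e > 0"
    show "\<exists>d>0. \<forall>y. y \<noteq> x \<and> dist y x < d \<longrightarrow> dist (f y) (f x) < e"
    proof (intro exI[of _ "min 1 (e / (\<bar>K\<bar> + 1))"] conjI allI impI)
      fix y assume y: "y \<noteq> x \<and> dist y x < min 1 (e / (\<bar>K\<bar> + 1))"
      have "norm y \<le> norm x + 1" using y norm_triangle_ineq2[of y x] by (simp add: dist_norm)
      then have "norm (f y - f x) \<le> K * norm (y - x)" by (intro K) auto
      also have "\<dots> \<le> (\<bar>K\<bar> + 1) * norm (y - x)" by (intro mult_right_mono) auto
      also have "\<dots> < (\<bar>K\<bar> + 1) * (e / (\<bar>K\<bar> + 1))" using y by (intro mult_strict_left_mono) (auto simp: dist_norm)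
      finally show "dist (f y) (f x) < e" by (simp add: dist_norm)
    qed (use e in auto)
  qed
  then show "isCont f x" .
qed

text \<open>Meant for functions known only through two-sided quadratic estimates, such as the energy
  and the Hamiltonian below, where no formula is differentiated.\<close>

lemma has_derivative_quadratic:
  fixes f :: "'a::real_normed_vector \<Rightarrow> 'b::real_normed_vector"
  assumes "bounded_linear f'" and "d > 0" and C: "C \<ge> 0"
    and q: "\<And>y. norm (y - x) < d \<Longrightarrow> norm (f y - f x - f' (y - x)) \<le> C * (norm (y - x))\<^sup>2"
  shows "(f has_derivative f') (at x)"
  unfolding has_derivative_at_alt
proof (intro conjI allI impI assms(1))
  fix e :: real assume e: "e > 0"
  show "\<exists>d>0. \<forall>y. norm (y - x) < d \<longrightarrow> norm (f y - f x - f' (y - x)) \<le> e * norm (y - x)"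
  proof (intro exI[of _ "min d (e / (C + 1))"] conjI allI impI)
    fix y assume y: "norm (y - x) < min d (e / (C + 1))"
    have "norm (f y - f x - f' (y - x)) \<le> C * norm (y - x) * norm (y - x)"
      using q[of y] y by (simp add: power2_eq_square)
    also have "C * norm (y - x) \<le> (C + 1) * (e / (C + 1))" using y C by (intro mult_mono) auto
    also have "\<dots> = e" using C by simp
    finally show "norm (f y - f x - f' (y - x)) \<le> e * norm (y - x)" by (simp add: mult_right_mono)
  qed (use e C assms(2) in auto)
qed

lemma mvt_segment:
  fixes f :: "'a::real_inner \<Rightarrow> real"
  assumes "\<And>z. GDERIV f z :> g z"
  obtains t where "0 < t" "t < 1" "f b - f a = (b - a) \<bullet> g (a + t *\<^sub>R (b - a))"
proof -
  have d: "((\<lambda>t. f (a + t *\<^sub>R (b - a))) has_real_derivative (b - a) \<bullet> g (a + t *\<^sub>R (b - a))) (at t)" for t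
  proof -
    have "((\<lambda>t. a + t *\<^sub>R (b - a)) has_derivative (\<lambda>h. h *\<^sub>R (b - a))) (at t)"
      by (auto intro!: derivative_eq_intros)
    from has_derivative_compose[OF this assms[unfolded gderiv_def]]
    show ?thesis unfolding has_field_derivative_def
      by (rule has_derivative_eq_rhs) (auto simp: mult.commute)
  qed
  obtain t where "0 < t" "t < 1" "f (a + 1 *\<^sub>R (b - a)) - f (a + 0 *\<^sub>R (b - a)) = (1 - 0) * ((b - a) \<bullet> g (a + t *\<^sub>R (b - a)))"
    by (rule exE[OF MVT2[OF zero_less_one d]]) blast
  then show ?thesis using that by simp
qed

section \<open>Reversible Tonelli Lagrangians\<close>

locale reversible_tonelli =
  fixes L :: "'a::euclidean_space \<Rightarrow> 'a \<Rightarrow> real"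
  assumes tonelli: "strict_tonelli L" and reversible: "reversible L"
begin

abbreviation Lpair :: "'a \<times> 'a \<Rightarrow> real" where
  "Lpair \<equiv> (\<lambda>(x, v). L x v)"

lemma Ck_Lpair: "Ck 2 Lpair"
  using tonelli unfolding strict_tonelli_def by blast

lemma GDERIV_Lpair: "GDERIV Lpair z :> grad Lpair z"
  by (rule differentiable_imp_GDERIV(1)[OF Ck_2D(1)[OF Ck_Lpair]])

lemma GDERIV_x: "GDERIV (\<lambda>y. L y v) x :> fst (grad Lpair (x, v))"
proof -
  have "((\<lambda>y. (y, v)) has_derivative (\<lambda>h. (h, 0))) (at x)"
    by (auto intro!: derivative_eq_intros)
  from has_derivative_compose[OF this GDERIV_Lpair[unfolded gderiv_def]]
  have "((\<lambda>y. L y v) has_derivative (\<lambda>h. h \<bullet> fst (grad Lpair (x, v)))) (at x)"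
    by (simp add: inner_prod_def)
  then show ?thesis unfolding gderiv_def .
qed

lemma GDERIV_v: "GDERIV (L x) v :> snd (grad Lpair (x, v))"
proof -
  have "((\<lambda>y. (x, y)) has_derivative (\<lambda>h. (0, h))) (at v)"
    by (auto intro!: derivative_eq_intros)
  from has_derivative_compose[OF this GDERIV_Lpair[unfolded gderiv_def]]
  have "((\<lambda>v. L x v) has_derivative (\<lambda>h. h \<bullet> snd (grad Lpair (x, v)))) (at v)"
    by (simp add: inner_prod_def)
  then show ?thesis unfolding gderiv_def .
qed

lemma D_x_eq: "D_x L x v = fst (grad Lpair (x, v))"
  unfolding D_x_def by (rule GDERIV_unique[OF GDERIV_x])

lemma D_v_eq: "D_v L x v = snd (grad Lpair (x, v))"
  unfolding D_v_def by (rule GDERIV_unique[OF GDERIV_v])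

lemma GDERIV_D_x: "GDERIV (\<lambda>y. L y v) x :> D_x L x v"
  unfolding D_x_eq by (rule GDERIV_x)

lemma GDERIV_D_v: "GDERIV (L x) v :> D_v L x v"
  unfolding D_v_eq by (rule GDERIV_v)

lemma D_v_differentiable: "(D_v L x has_derivative D_vv L x v) (at v)"
proof -
  have "(\<lambda>v. (x, v)) differentiable (at v)"
    by (rule differentiableI[where f'="\<lambda>h. (0, h)"]) (auto intro!: derivative_eq_intros)
  then have "(grad Lpair \<circ> (\<lambda>v. (x, v))) differentiable (at v)"
    by (rule differentiable_chain_at) (rule Ck_2_grad_differentiable[OF Ck_Lpair])
  then obtain D where "((grad Lpair \<circ> (\<lambda>v. (x, v))) has_derivative D) (at v)"
    unfolding differentiable_def by blast
  then have "((\<lambda>v. snd ((grad Lpair \<circ> (\<lambda>v. (x, v))) v)) has_derivative (\<lambda>h. snd (D h))) (at v)"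
    by (rule has_derivative_snd)
  then have "D_v L x differentiable (at v)" unfolding differentiable_def D_v_eq o_def by blast
  then show ?thesis unfolding D_vv_def using frechet_derivative_works by blast
qed

lemma continuous_Lpair: "continuous_on UNIV Lpair"
  using Ck_2D(1)[OF Ck_Lpair] by (auto intro!: continuous_at_imp_continuous_on differentiable_imp_continuous_within)

lemma D_v_0: "D_v L x 0 = 0"
proof -
  have "((\<lambda>v. - v) has_derivative uminus) (at (0::'a))"
    by (auto intro!: derivative_eq_intros)
  moreover have "(L x has_derivative (\<lambda>h. h \<bullet> D_v L x 0)) (at (- 0))"
    using GDERIV_D_v[of x 0] by (simp add: gderiv_def)
  ultimately have "((\<lambda>v. L x (- v)) has_derivative (\<lambda>h. (- h) \<bullet> D_v L x 0)) (at 0)"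
    by (rule has_derivative_compose)
  moreover have "(\<lambda>v. L x (- v)) = L x" using reversible unfolding reversible_def by auto
  ultimately have "GDERIV (L x) 0 :> - D_v L x 0" by (simp add: gderiv_def)
  from GDERIV_unique[OF this] have "D_v L x 0 = - D_v L x 0" by (simp add: D_v_def)
  then have "D_v L x 0 + D_v L x 0 = 0" by (metis add.right_inverse)
  then have "2 *\<^sub>R D_v L x 0 = 0" by (simp add: scaleR_2)
  then show ?thesis by simp
qed

definition C1 :: real where
  "C1 = (SOME C. C > 0 \<and> (\<forall>x v h. (h \<bullet> h) / C \<le> D_vv L x v h \<bullet> h \<and> D_vv L x v h \<bullet> h \<le> C * (h \<bullet> h)))"

lemma C1: "C1 > 0" "(h \<bullet> h) / C1 \<le> D_vv L x v h \<bullet> h" "D_vv L x v h \<bullet> h \<le> C1 * (h \<bullet> h)"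
proof -
  have "\<exists>C. C > 0 \<and> (\<forall>x v h. (h \<bullet> h) / C \<le> D_vv L x v h \<bullet> h \<and> D_vv L x v h \<bullet> h \<le> C * (h \<bullet> h))"
    using tonelli unfolding strict_tonelli_def by blast
  from someI_ex[OF this, folded C1_def] show "C1 > 0" "(h \<bullet> h) / C1 \<le> D_vv L x v h \<bullet> h"
    "D_vv L x v h \<bullet> h \<le> C1 * (h \<bullet> h)" by auto
qed

lemma L0_bounded: obtains C3 where "C3 > 0" "\<And>x. \<bar>L x 0\<bar> \<le> C3"
proof -
  obtain C where "C > 0" and C: "\<forall>x. \<bar>L x 0\<bar> + norm (D_x L x 0) + norm (D_v L x 0) \<le> C"
    using tonelli unfolding strict_tonelli_def by blast
  have "\<bar>L x 0\<bar> \<le> C" for x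
  proof -
    have "\<bar>L x 0\<bar> + norm (D_x L x 0) + norm (D_v L x 0) \<le> C" using C by blast
    moreover have "0 \<le> norm (D_x L x 0)" "0 \<le> norm (D_v L x 0)" by simp_all
    ultimately show ?thesis by linarith
  qed
  then show ?thesis using that \<open>C > 0\<close> by blast
qed

text \<open>Mean value theorem for
  \<open>t \<mapsto> D_v L x (v + t (w - v)) \<bullet> (w - v)\<close>, whose derivative is the
  Hessian form controlled by ellipticity.\<close>

lemma D_v_monotone:
  shows "norm (w - v)^2 / C1 \<le> (D_v L x w - D_v L x v) \<bullet> (w - v)"
    and "(D_v L x w - D_v L x v) \<bullet> (w - v) \<le> C1 * norm (w - v)^2"
proof -
  let ?h = "w - v"
  have d: "((\<lambda>t. D_v L x (v + t *\<^sub>R ?h) \<bullet> ?h) has_real_derivative D_vv L x (v + t *\<^sub>R ?h) ?h \<bullet> ?h) (at t)" for t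
  proof -
    have "((\<lambda>t. v + t *\<^sub>R ?h) has_derivative (\<lambda>s. s *\<^sub>R ?h)) (at t)"
      by (auto intro!: derivative_eq_intros)
    from has_derivative_compose[OF this D_v_differentiable]
    have "((\<lambda>t. D_v L x (v + t *\<^sub>R ?h) \<bullet> ?h) has_derivative (\<lambda>s. D_vv L x (v + t *\<^sub>R ?h) (s *\<^sub>R ?h) \<bullet> ?h)) (at t)"
      by (rule has_derivative_inner_left)
    then show ?thesis unfolding has_field_derivative_def
      by (rule has_derivative_eq_rhs)
        (auto simp: linear_cmul[OF has_derivative_linear[OF D_v_differentiable]])
  qed
  obtain t where "D_v L x (v + 1 *\<^sub>R ?h) \<bullet> ?h - D_v L x (v + 0 *\<^sub>R ?h) \<bullet> ?h = (1 - 0) * (D_vv L x (v + t *\<^sub>R ?h) ?h \<bullet> ?h)"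
    by (rule exE[OF MVT2[OF zero_less_one d]]) blast
  then have "(D_v L x w - D_v L x v) \<bullet> ?h = D_vv L x (v + t *\<^sub>R ?h) ?h \<bullet> ?h"
    by (simp add: inner_diff_left)
  then show "norm (w - v)^2 / C1 \<le> (D_v L x w - D_v L x v) \<bullet> (w - v)"
    "(D_v L x w - D_v L x v) \<bullet> (w - v) \<le> C1 * norm (w - v)^2"
    using C1(2)[of ?h x "v + t *\<^sub>R ?h"] C1(3)[of x "v + t *\<^sub>R ?h" ?h] by (auto simp: dot_square_norm)
qed

lemma L_convex: "L x w \<ge> L x v + D_v L x v \<bullet> (w - v)"
proof -
  obtain t where t: "0 < t" "t < 1" and e: "L x w - L x v = (w - v) \<bullet> D_v L x (v + t *\<^sub>R (w - v))"
    by (rule mvt_segment[OF GDERIV_D_v])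
  have "0 \<le> norm (v + t *\<^sub>R (w - v) - v)^2 / C1" using C1(1) by simp
  also have "\<dots> \<le> (D_v L x (v + t *\<^sub>R (w - v)) - D_v L x v) \<bullet> (t *\<^sub>R (w - v))"
    using D_v_monotone(1)[of "v + t *\<^sub>R (w - v)" v x] by simp
  finally have "0 \<le> (D_v L x (v + t *\<^sub>R (w - v)) - D_v L x v) \<bullet> (w - v)"
    using t by (simp add: zero_le_mult_iff)
  moreover have "L x w - L x v = D_v L x (v + t *\<^sub>R (w - v)) \<bullet> (w - v)"
    using e by (simp only: inner_commute)
  ultimately show ?thesis unfolding inner_diff_left by linarith
qed

lemma L_min_0: "L x 0 \<le> L x v"
  using L_convex[of x 0 v] by (simp add: D_v_0)

lemma L_upper: "L x v \<le> L x 0 + C1 * norm v^2"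
proof -
  obtain t where t: "0 < t" "t < 1" and e: "L x v - L x 0 = (v - 0) \<bullet> D_v L x (0 + t *\<^sub>R (v - 0))"
    by (rule mvt_segment[OF GDERIV_D_v])
  have "D_v L x (t *\<^sub>R v) \<bullet> (t *\<^sub>R v) \<le> C1 * norm (t *\<^sub>R v)^2"
    using D_v_monotone(2)[of x "t *\<^sub>R v" 0] by (simp add: D_v_0)
  then have "t * (D_v L x (t *\<^sub>R v) \<bullet> v) \<le> t * (C1 * t * norm v^2)"
    using t by (simp add: power2_eq_square algebra_simps)
  then have "D_v L x (t *\<^sub>R v) \<bullet> v \<le> C1 * t * norm v^2" using t by simp
  also have "\<dots> \<le> C1 * 1 * norm v^2" using t C1(1) by (intro mult_right_mono mult_left_mono) auto
  finally show ?thesis using e by (simp add: inner_commute)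
qed

text \<open>Convexity is used through the midpoint \<open>v / 2\<close>: from there to
  \<open>v\<close> the increment is at least the slope at \<open>v / 2\<close>, which strong
  monotonicity bounds below. This costs a constant, 4 in place of 2, and saves an
  integration.\<close>

lemma L_lower: "L x 0 + norm v^2 / (4 * C1) \<le> L x v"
proof -
  have "norm ((1/2) *\<^sub>R v - 0)^2 / C1 \<le> D_v L x ((1/2) *\<^sub>R v) \<bullet> ((1/2) *\<^sub>R v)"
    using D_v_monotone(1)[of "(1/2) *\<^sub>R v" 0 x] by (simp add: D_v_0)
  moreover have "L x ((1/2) *\<^sub>R v) + D_v L x ((1/2) *\<^sub>R v) \<bullet> (v - (1/2) *\<^sub>R v) \<le> L x v"
    by (rule L_convex)
  moreover have "v - (1/2) *\<^sub>R v = (1/2) *\<^sub>R v" using scaleR_left_diff_distrib[of 1 "1/2" v] by simp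
  moreover have "norm ((1/2) *\<^sub>R v - 0)^2 / C1 = norm v^2 / (4 * C1)"
    by (simp add: power2_eq_square)
  ultimately show ?thesis using L_min_0[of x "(1/2) *\<^sub>R v"] by simp
qed

text \<open>This is the critical point equation of \<open>L x v - p \<bullet> v\<close>. The radius
  \<open>R\<close> is where quadratic growth beats the linear term, so a minimum over the ball is a
  minimum over the whole space.\<close>

lemma D_v_surj: "\<exists>v. D_v L x v = p"
proof -
  define R where "R = norm p * (4 * C1)"
  have R: "R \<ge> 0" using C1(1) by (simp add: R_def)
  have G: "GDERIV (\<lambda>v. L x v - p \<bullet> v) v :> D_v L x v - p" for v
  proof -
    have "((\<lambda>v. L x v - p \<bullet> v) has_derivative (\<lambda>h. h \<bullet> D_v L x v - p \<bullet> h)) (at v)"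
      using GDERIV_D_v[of x v] unfolding gderiv_def by (auto intro!: derivative_eq_intros)
    then show ?thesis unfolding gderiv_def by (simp add: inner_diff_right inner_commute)
  qed
  have "continuous_on (cball 0 R) (\<lambda>v. L x v - p \<bullet> v)"
    using G unfolding gderiv_def by (meson has_derivative_continuous continuous_at_imp_continuous_on)
  then obtain v where v: "v \<in> cball 0 R" "\<forall>w\<in>cball 0 R. L x v - p \<bullet> v \<le> L x w - p \<bullet> w"
    using continuous_attains_inf[of "cball (0::'a) R" "\<lambda>v. L x v - p \<bullet> v"] R by auto
  have "L x v - p \<bullet> v \<le> L x w - p \<bullet> w" for w
  proof (cases "norm w \<le> R")
    case True then show ?thesis using v by simp
  next
    case False
    have "0 \<in> cball (0::'a) R" using R by simp
    then have "L x v - p \<bullet> v \<le> L x 0 - p \<bullet> 0" using v(2) by blast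
    moreover have "L x 0 \<le> L x w - norm w^2 / (4 * C1)" using L_lower[of x w] by linarith
    moreover have "norm p * norm w \<le> norm w^2 / (4 * C1)"
    proof -
      have "norm p * (4 * C1) * norm w \<le> norm w * norm w" using False by (intro mult_right_mono) (auto simp: R_def)
      then show ?thesis using C1(1) by (simp add: power2_eq_square field_simps)
    qed
    moreover have "p \<bullet> w \<le> norm p * norm w" by (rule norm_cauchy_schwarz)
    ultimately show ?thesis by (simp only: inner_zero_right)
  qed
  then have "(\<lambda>h. h \<bullet> (D_v L x v - p)) = (\<lambda>h. 0)"
    by (intro has_derivative_local_min[OF G[of v, unfolded gderiv_def]] always_eventually allI)
  then have "(D_v L x v - p) \<bullet> (D_v L x v - p) = 0" by metis
  then show ?thesis by auto
qed

lemma D_v_inj: "D_v L x v = D_v L x w \<Longrightarrow> v = w"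
  using D_v_monotone(1)[of v w x] C1(1) by (simp add: divide_le_0_iff)

text \<open>The inverse Legendre map, that is, the velocity with momentum \<open>p\<close>, or
  \<open>D_pH\<close>.\<close>

definition V :: "'a \<Rightarrow> 'a \<Rightarrow> 'a" where
  "V x p = (THE v. D_v L x v = p)"

lemma D_v_V: "D_v L x (V x p) = p"
  unfolding V_def by (rule theI') (use D_v_surj D_v_inj in metis)

lemma V_D_v: "V x (D_v L x v) = v"
  using D_v_V D_v_inj by blast

lemma V_bound: "norm (V x p) \<le> C1 * norm p"
proof -
  have "norm (V x p)^2 / C1 \<le> p \<bullet> V x p"
    using D_v_monotone(1)[of "V x p" 0 x] by (simp add: D_v_0 D_v_V)
  also have "\<dots> \<le> norm p * norm (V x p)" by (rule norm_cauchy_schwarz)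
  finally have "norm (V x p) * norm (V x p) \<le> (C1 * norm p) * norm (V x p)"
    using C1(1) by (simp add: power2_eq_square field_simps)
  then show ?thesis using C1(1) by (cases "V x p = 0") auto
qed

lemma grad_lipschitz:
  obtains K where "K \<ge> 0"
    "\<And>x v y w. norm x \<le> R \<Longrightarrow> norm v \<le> R \<Longrightarrow> norm y \<le> R \<Longrightarrow> norm w \<le> R \<Longrightarrow>
       norm (D_x L x v - D_x L y w) \<le> K * (norm (x - y) + norm (v - w))"
    "\<And>x v y w. norm x \<le> R \<Longrightarrow> norm v \<le> R \<Longrightarrow> norm y \<le> R \<Longrightarrow> norm w \<le> R \<Longrightarrow>
       norm (D_v L x v - D_v L y w) \<le> K * (norm (x - y) + norm (v - w))"
proof -
  obtain K where K: "K \<ge> 0" "\<And>a b. a \<in> cball 0 (2 * R) \<Longrightarrow> b \<in> cball 0 (2 * R) \<Longrightarrow>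
      norm (grad Lpair a - grad Lpair b) \<le> K * norm (a - b)"
    using Ck_2_grad_lipschitz_cball[OF Ck_Lpair, of "2 * R"] by blast
  have "norm (D_x L x v - D_x L y w) \<le> K * (norm (x - y) + norm (v - w)) \<and>
       norm (D_v L x v - D_v L y w) \<le> K * (norm (x - y) + norm (v - w))"
    if "norm x \<le> R" "norm v \<le> R" "norm y \<le> R" "norm w \<le> R" for x v y w
  proof -
    have "norm (x, v) \<le> 2 * R" "norm (y, w) \<le> 2 * R"
      using norm_Pair_le[of x v] norm_Pair_le[of y w] that by linarith+
    then have "norm (grad Lpair (x, v) - grad Lpair (y, w)) \<le> K * norm ((x, v) - (y, w))"
      by (intro K) auto
    also have "\<dots> \<le> K * (norm (x - y) + norm (v - w))"
      using K(1) norm_Pair_le[of "x - y" "v - w"] by (intro mult_left_mono) auto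
    finally have "norm (grad Lpair (x, v) - grad Lpair (y, w)) \<le> K * (norm (x - y) + norm (v - w))" .
    moreover obtain a b where ab: "grad Lpair (x, v) - grad Lpair (y, w) = (a, b)" by force
    moreover have "D_x L x v - D_x L y w = a" "D_v L x v - D_v L y w = b"
      using ab unfolding D_x_eq D_v_eq by (metis fst_conv fst_diff, metis snd_conv snd_diff)
    moreover have "norm a \<le> norm (a, b)" "norm b \<le> norm (a, b)" by (rule norm_fst_le norm_snd_le)+
    ultimately show ?thesis by simp
  qed
  then show ?thesis by (intro that[OF K(1)]) blast+
qed

text \<open>Both velocities are compared at the same base point \<open>y\<close>: strong
  monotonicity bounds their distance by that of their momenta, and changing the base point in
  \<open>D_v L\<close> costs a Lipschitz constant. The enlarged radius \<open>R'\<close> contains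
  the velocities as well.\<close>

lemma V_lipschitz:
  obtains K where "K \<ge> 0"
    "\<And>x p y q. norm x \<le> R \<Longrightarrow> norm p \<le> R \<Longrightarrow> norm y \<le> R \<Longrightarrow> norm q \<le> R \<Longrightarrow>
      norm (V x p - V y q) \<le> K * (norm (x - y) + norm (p - q))"
proof -
  define R' where "R' = max R (C1 * R)"
  obtain K where K: "K \<ge> 0" "\<And>x v y w. norm x \<le> R' \<Longrightarrow> norm v \<le> R' \<Longrightarrow> norm y \<le> R' \<Longrightarrow> norm w \<le> R' \<Longrightarrow>
       norm (D_x L x v - D_x L y w) \<le> K * (norm (x - y) + norm (v - w))"
     "\<And>x v y w. norm x \<le> R' \<Longrightarrow> norm v \<le> R' \<Longrightarrow> norm y \<le> R' \<Longrightarrow> norm w \<le> R' \<Longrightarrow>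
       norm (D_v L x v - D_v L y w) \<le> K * (norm (x - y) + norm (v - w))"
    by (fact grad_lipschitz)
  have "norm (V x p - V y q) \<le> C1 * (K + 1) * (norm (x - y) + norm (p - q))"
    if n: "norm x \<le> R" "norm p \<le> R" "norm y \<le> R" "norm q \<le> R" for x p y q
  proof -
    let ?v = "V x p" and ?w = "V y q"
    have v: "norm ?v \<le> R'" using order_trans[OF V_bound mult_left_mono[OF n(2) less_imp_le[OF C1(1)]]] by (simp add: R'_def le_max_iff_disj)
    have "norm (?v - ?w)^2 / C1 \<le> (D_v L y ?v - q) \<bullet> (?v - ?w)"
      using D_v_monotone(1)[of ?v ?w y] by (simp add: D_v_V)
    also have "\<dots> \<le> norm (D_v L y ?v - q) * norm (?v - ?w)" by (rule norm_cauchy_schwarz)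
    finally have *: "norm (?v - ?w) * norm (?v - ?w) \<le> (C1 * norm (D_v L y ?v - q)) * norm (?v - ?w)"
      using C1(1) by (simp add: power2_eq_square field_simps)
    have "norm (?v - ?w) \<le> C1 * norm (D_v L y ?v - q)"
    proof (cases "?v = ?w")
      case False
      then show ?thesis using * by simp
    qed (use C1(1) in simp)
    also have "norm (D_v L y ?v - q) \<le> norm (D_v L y ?v - p) + norm (p - q)"
      using norm_triangle_ineq[of "D_v L y ?v - p" "p - q"] by simp
    also have "D_v L y ?v - p = D_v L y ?v - D_v L x ?v" by (simp add: D_v_V)
    also have "norm (D_v L y ?v - D_v L x ?v) \<le> K * (norm (y - x) + norm (?v - ?v))"
      using n v by (intro K) (auto simp: R'_def)
    also have "C1 * (K * (norm (y - x) + norm (?v - ?v)) + norm (p - q)) \<le> C1 * ((K + 1) * (norm (x - y) + norm (p - q)))"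
      using C1(1) K(1) by (intro mult_left_mono) (auto simp: norm_minus_commute algebra_simps)
    finally show ?thesis using C1(1) by (simp add: mult.assoc)
  qed
  then show ?thesis using that[of "C1 * (K + 1)"] C1(1) K(1) by simp
qed

end

section \<open>The Euler--Lagrange flow\<close>

context reversible_tonelli
begin

text \<open>The Hamiltonian, written with its maximiser \<open>V x p\<close> instead of a
  supremum.\<close>

definition energy :: "'a \<Rightarrow> 'a \<Rightarrow> real" where
  "energy x p = p \<bullet> V x p - L x (V x p)"

lemma energy_ge: "p \<bullet> w - L x w \<le> energy x p"
  using L_convex[of x "V x p" w] unfolding energy_def by (simp add: D_v_V inner_diff_right)

text \<open>An envelope argument: the energy is a maximum over velocities, so inserting the old
  maximiser at the new point bounds its increment below, and inserting the new maximiser at the old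
  point bounds it above. Only the Lipschitz bound for \<open>V\<close> enters, not a derivative of
  it.\<close>

lemma has_derivative_energy:
  "((\<lambda>z. energy (fst z) (snd z)) has_derivative
     (\<lambda>h. snd h \<bullet> V x p - fst h \<bullet> D_x L x (V x p))) (at (x, p))"
proof -
  define R where "R = norm x + norm p + 1"
  define R' where "R' = max R (C1 * R)"
  obtain K1 where K1: "K1 \<ge> 0" "\<And>x p y q. norm x \<le> R \<Longrightarrow> norm p \<le> R \<Longrightarrow> norm y \<le> R \<Longrightarrow> norm q \<le> R \<Longrightarrow>
      norm (V x p - V y q) \<le> K1 * (norm (x - y) + norm (p - q))"
    by (fact V_lipschitz)
  obtain K2 where K2: "K2 \<ge> 0" "\<And>x v y w. norm x \<le> R' \<Longrightarrow> norm v \<le> R' \<Longrightarrow> norm y \<le> R' \<Longrightarrow> norm w \<le> R' \<Longrightarrow>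
       norm (D_x L x v - D_x L y w) \<le> K2 * (norm (x - y) + norm (v - w))"
     "\<And>x v y w. norm x \<le> R' \<Longrightarrow> norm v \<le> R' \<Longrightarrow> norm y \<le> R' \<Longrightarrow> norm w \<le> R' \<Longrightarrow>
       norm (D_v L x v - D_v L y w) \<le> K2 * (norm (x - y) + norm (v - w))"
    by (fact grad_lipschitz)
  let ?v = "V x p"
  define C where "C = K2 * (1 + 2 * K1)"
  have C0: "C \<ge> 0" using K1(1) K2(1) by (simp add: C_def)
  have VR: "norm (V y q) \<le> R'" if "norm q \<le> R" for y q
    using order_trans[OF V_bound mult_left_mono[OF that less_imp_le[OF C1(1)]]] by (simp add: R'_def le_max_iff_disj)
  show ?thesis
  proof (rule has_derivative_quadratic[where d=1 and C="C + 2 * K1"])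
    show "bounded_linear (\<lambda>h. snd h \<bullet> ?v - fst h \<bullet> D_x L x ?v)"
      by (intro bounded_linear_intros)
    fix z assume z: "norm (z - (x, p)) < 1"
    obtain x' p' where z_def: "z = (x', p')" by force
    define e where "e = norm (z - (x, p))"
    let ?k = "x' - x" and ?l = "p' - p" and ?w = "V x' p'"
    have k: "norm ?k \<le> e" and l: "norm ?l \<le> e"
      using norm_fst_le[of ?k ?l] norm_snd_le[of ?l ?k] by (simp_all add: e_def z_def)
    have e: "0 \<le> e" "e < 1" using z by (simp_all add: e_def)
    have nx: "norm x \<le> R" "norm p \<le> R" "norm x' \<le> R" "norm p' \<le> R"
      using k l e norm_triangle_ineq2[of x' x] norm_triangle_ineq2[of p' p]
        norm_ge_zero[of x] norm_ge_zero[of p] unfolding R_def by linarith+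
    have wv: "norm (?w - ?v) \<le> 2 * K1 * e"
    proof -
      have "norm (?w - ?v) \<le> K1 * (norm ?k + norm ?l)" by (intro K1 nx)
      also have "\<dots> \<le> K1 * (e + e)" using k l K1(1) by (intro mult_left_mono) auto
      finally show ?thesis by simp
    qed
    have Q: "\<bar>L x' u - L x u - ?k \<bullet> D_x L x ?v\<bar> \<le> C * e^2" if u: "u = ?v \<or> u = ?w" for u
    proof -
      obtain t where t: "0 < t" "t < 1" and eq: "L x' u - L x u = ?k \<bullet> D_x L (x + t *\<^sub>R ?k) u"
        by (rule mvt_segment[OF GDERIV_D_x])
      have tk: "norm (t *\<^sub>R ?k) \<le> e" using t k e mult_mono[of t 1 "norm ?k" e] by simp
      have xi: "norm (x + t *\<^sub>R ?k) \<le> R"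
        using norm_triangle_ineq[of x "t *\<^sub>R ?k"] tk e norm_ge_zero[of p] unfolding R_def by linarith
      have uR: "norm u \<le> R'" using u VR nx by blast
      have uv: "norm (u - ?v) \<le> 2 * K1 * e" using u wv K1(1) e by auto
      have "norm (D_x L (x + t *\<^sub>R ?k) u - D_x L x ?v) \<le> K2 * (norm (x + t *\<^sub>R ?k - x) + norm (u - ?v))"
        using xi nx VR uR by (intro K2) (auto simp: R'_def)
      also have "\<dots> \<le> K2 * (e + 2 * K1 * e)" using tk uv K2(1) by (intro mult_left_mono add_mono) auto
      finally have d: "norm (D_x L (x + t *\<^sub>R ?k) u - D_x L x ?v) \<le> C * e" by (simp add: C_def algebra_simps)
      have "\<bar>L x' u - L x u - ?k \<bullet> D_x L x ?v\<bar> = \<bar>?k \<bullet> (D_x L (x + t *\<^sub>R ?k) u - D_x L x ?v)\<bar>"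
        using eq by (simp add: inner_diff_right)
      also have "\<dots> \<le> norm ?k * norm (D_x L (x + t *\<^sub>R ?k) u - D_x L x ?v)" by (rule Cauchy_Schwarz_ineq2)
      also have "\<dots> \<le> e * (C * e)" using k d e by (intro mult_mono) auto
      finally show ?thesis by (simp add: power2_eq_square algebra_simps)
    qed
    let ?E = "energy x' p' - energy x p - (?l \<bullet> ?v - ?k \<bullet> D_x L x ?v)"
    have lo: "- (C * e^2) \<le> ?E"
    proof -
      have "p' \<bullet> ?v - L x' ?v \<le> energy x' p'" by (rule energy_ge)
      moreover have "energy x p = p \<bullet> ?v - L x ?v" by (rule energy_def)
      moreover have "?l \<bullet> ?v = p' \<bullet> ?v - p \<bullet> ?v" by (rule inner_diff_left)
      ultimately show ?thesis using Q[OF disjI1[OF refl]] by linarith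
    qed
    \<comment> \<open>The product of the change of momentum and the change of maximiser is of second
      order; it accounts for the summand \<open>2 * K1\<close>.\<close>
    have up: "?E \<le> (C + 2 * K1) * e^2"
    proof -
      have "p \<bullet> ?w - L x ?w \<le> energy x p" by (rule energy_ge)
      moreover have "energy x' p' = p' \<bullet> ?w - L x' ?w" by (rule energy_def)
      moreover have "?l \<bullet> (?w - ?v) = p' \<bullet> ?w - p \<bullet> ?w - ?l \<bullet> ?v" by (simp add: inner_diff_left inner_diff_right)
      moreover have "?l \<bullet> (?w - ?v) \<le> e * (2 * K1 * e)"
        using norm_cauchy_schwarz[of ?l "?w - ?v"] mult_mono[OF l wv] e by simp
      moreover have "(C + 2 * K1) * e^2 = C * e^2 + e * (2 * K1 * e)"
        by (simp add: power2_eq_square algebra_simps)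
      ultimately show ?thesis using Q[OF disjI2[OF refl]] by linarith
    qed
    have "C * e^2 \<le> (C + 2 * K1) * e^2" using K1(1) by (intro mult_right_mono) auto
    with lo up have "\<bar>?E\<bar> \<le> (C + 2 * K1) * e^2" by linarith
    then show "norm (energy (fst z) (snd z) - energy (fst (x, p)) (snd (x, p)) -
         (snd (z - (x, p)) \<bullet> ?v - fst (z - (x, p)) \<bullet> D_x L x ?v)) \<le> (C + 2 * K1) * (norm (z - (x, p)))\<^sup>2"
      unfolding e_def by (simp add: z_def)
  qed (use C0 K1(1) in auto)
qed

text \<open>Hamilton's equations: \<open>D_x L\<close> at the maximiser is minus the derivative of
  the energy in \<open>x\<close>.\<close>

definition X :: "'a \<times> 'a \<Rightarrow> 'a \<times> 'a" where
  "X z = (V (fst z) (snd z), D_x L (fst z) (V (fst z) (snd z)))"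

lemma X_locally_lipschitz:
  "\<exists>K. \<forall>a\<in>cball 0 R. \<forall>b\<in>cball 0 R. norm (X a - X b) \<le> K * norm (a - b)"
proof -
  define R' where "R' = max R (C1 * R)"
  obtain K1 where K1: "K1 \<ge> 0" "\<And>x p y q. norm x \<le> R \<Longrightarrow> norm p \<le> R \<Longrightarrow> norm y \<le> R \<Longrightarrow> norm q \<le> R \<Longrightarrow>
      norm (V x p - V y q) \<le> K1 * (norm (x - y) + norm (p - q))"
    by (fact V_lipschitz)
  obtain K2 where K2: "K2 \<ge> 0" "\<And>x v y w. norm x \<le> R' \<Longrightarrow> norm v \<le> R' \<Longrightarrow> norm y \<le> R' \<Longrightarrow> norm w \<le> R' \<Longrightarrow>
       norm (D_x L x v - D_x L y w) \<le> K2 * (norm (x - y) + norm (v - w))"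
     "\<And>x v y w. norm x \<le> R' \<Longrightarrow> norm v \<le> R' \<Longrightarrow> norm y \<le> R' \<Longrightarrow> norm w \<le> R' \<Longrightarrow>
       norm (D_v L x v - D_v L y w) \<le> K2 * (norm (x - y) + norm (v - w))"
    by (fact grad_lipschitz)
  have VR: "norm (V y q) \<le> R'" if "norm q \<le> R" for y q
    using order_trans[OF V_bound mult_left_mono[OF that less_imp_le[OF C1(1)]]] by (simp add: R'_def le_max_iff_disj)
  have "norm (X a - X b) \<le> (2 * K1 + K2 * (1 + 2 * K1)) * norm (a - b)"
    if ab: "a \<in> cball 0 R" "b \<in> cball 0 R" for a b
  proof -
    obtain x p y q where a: "a = (x, p)" and b: "b = (y, q)" by force
    have n: "norm x \<le> R" "norm p \<le> R" "norm y \<le> R" "norm q \<le> R"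
      using ab norm_fst_le[of x p] norm_snd_le[of p x] norm_fst_le[of y q] norm_snd_le[of q y]
      by (auto simp: a b)
    have d: "norm (x - y) \<le> norm (a - b)" "norm (p - q) \<le> norm (a - b)"
      using norm_fst_le[of "x - y" "p - q"] norm_snd_le[of "p - q" "x - y"] by (auto simp: a b)
    have "norm (V x p - V y q) \<le> K1 * (norm (x - y) + norm (p - q))" by (intro K1 n)
    also have "\<dots> \<le> K1 * (norm (a - b) + norm (a - b))" using d K1(1) by (intro mult_left_mono) auto
    finally have v: "norm (V x p - V y q) \<le> 2 * K1 * norm (a - b)" by simp
    have "norm (D_x L x (V x p) - D_x L y (V y q)) \<le> K2 * (norm (x - y) + norm (V x p - V y q))"
      using n VR by (intro K2) (auto simp: R'_def)
    also have "\<dots> \<le> K2 * (norm (a - b) + 2 * K1 * norm (a - b))"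
      using d v K2(1) by (intro mult_left_mono) auto
    finally have "norm (D_x L x (V x p) - D_x L y (V y q)) \<le> K2 * (1 + 2 * K1) * norm (a - b)"
      by (simp add: algebra_simps)
    moreover have "norm (X a - X b) \<le> norm (V x p - V y q) + norm (D_x L x (V x p) - D_x L y (V y q))"
      unfolding X_def a b by (simp add: norm_Pair_le)
    ultimately show ?thesis using v unfolding distrib_right by linarith
  qed
  then show ?thesis by blast
qed

text \<open>Multiplying the vector field by a scalar function only reparametrises its orbits, so the
  energy is still conserved; this confines the momentum and hence the speed.\<close>

lemma X_scaled_bound:
  "\<exists>B. \<forall>(\<kappa> :: 'a \<times> 'a \<Rightarrow> real) y. (\<forall>z. 0 \<le> \<kappa> z \<and> \<kappa> z \<le> 1) \<and> norm (y 0) \<le> R \<and>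
        (\<forall>t. (y has_vector_derivative \<kappa> (y t) *\<^sub>R X (y t)) (at t)) \<longrightarrow> (\<forall>t. \<bar>t\<bar> \<le> T \<longrightarrow> norm (y t) \<le> B)"
proof -
  obtain C3 where C3: "C3 > 0" "\<And>x. \<bar>L x 0\<bar> \<le> C3" by (fact L0_bounded)
  \<comment> \<open>The conserved energy is at most \<open>C1 * R^2 + C3\<close> initially and at
    least \<open>|p|^2 / (4 * C1) - C3\<close> at any time; this bounds the momentum by
    \<open>P\<close>.\<close>
  define P where "P = sqrt (4 * C1 * (C1 * R^2 + 2 * C3))"
  have P0: "4 * C1 * (C1 * R^2 + 2 * C3) \<ge> 0" using C1(1) C3(1) by simp
  have "norm (y t) \<le> R + C1 * P * T + P"
    if k: "\<forall>z. 0 \<le> \<kappa> z \<and> \<kappa> z \<le> 1" and y0: "norm (y 0) \<le> R"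
      and y: "\<forall>t. (y has_vector_derivative \<kappa> (y t) *\<^sub>R X (y t)) (at t)" and t: "\<bar>t\<bar> \<le> T"
    for \<kappa> :: "'a \<times> 'a \<Rightarrow> real" and y t
  proof -
    let ?x = "\<lambda>t. fst (y t)" and ?p = "\<lambda>t. snd (y t)"
    have dy: "(y has_derivative (\<lambda>h. h *\<^sub>R (\<kappa> (y t) *\<^sub>R X (y t)))) (at t)" for t
      using y by (simp add: has_vector_derivative_def)
    have dE: "((\<lambda>t. energy (?x t) (?p t)) has_derivative (\<lambda>h. 0)) (at t within UNIV)" for t
    proof -
      have "((\<lambda>z. energy (fst z) (snd z)) has_derivative
         (\<lambda>h. snd h \<bullet> V (?x t) (?p t) - fst h \<bullet> D_x L (?x t) (V (?x t) (?p t)))) (at (y t))"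
        using has_derivative_energy[of "?x t" "?p t"] by simp
      from has_derivative_compose[OF dy this] show ?thesis
        by (rule has_derivative_eq_rhs) (auto simp: X_def inner_commute)
    qed
    have E: "energy (?x t) (?p t) = energy (?x 0) (?p 0)" for t
      using has_derivative_zero_unique[OF convex_UNIV dE] by auto
    have p: "norm (?p t) \<le> P" for t
    proof -
      let ?xi = "?x 0" and ?pi = "?p 0"
      have p0: "norm ?pi \<le> R" using y0 norm_snd_le[of ?pi ?xi] by simp
      have R0: "R \<ge> 0" using y0 norm_ge_zero[of "y 0"] by linarith
      have "energy ?xi ?pi \<le> norm ?pi * norm (V ?xi ?pi) - L ?xi 0"
        using norm_cauchy_schwarz[of ?pi "V ?xi ?pi"] L_min_0[of ?xi "V ?xi ?pi"] unfolding energy_def by linarith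
      also have "norm ?pi * norm (V ?xi ?pi) \<le> R * (C1 * R)"
      proof (rule mult_mono)
        show "norm (V ?xi ?pi) \<le> C1 * R" using V_bound[of ?xi ?pi] mult_left_mono[OF p0, of C1] C1(1) by linarith
      qed (use p0 R0 in auto)
      finally have u: "energy ?xi ?pi \<le> C1 * R^2 + C3"
        using C3(2)[of ?xi] by (simp add: power2_eq_square algebra_simps)
      \<comment> \<open>The maximiser of \<open>p \<bullet> w - C1 * |w|^2\<close>, which gives the
        lower bound for the energy.\<close>
      let ?w = "(1 / (2 * C1)) *\<^sub>R ?p t"
      have "?p t \<bullet> ?w - L (?x t) ?w \<le> energy (?x t) (?p t)" by (rule energy_ge)
      moreover have "L (?x t) ?w \<le> L (?x t) 0 + C1 * norm ?w^2" by (rule L_upper)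
      moreover have "?p t \<bullet> ?w = norm (?p t)^2 / (2 * C1)" by (simp add: dot_square_norm)
      moreover have "C1 * norm ?w^2 = norm (?p t)^2 / (4 * C1)"
        using C1(1) by (simp add: power_divide power2_eq_square field_simps)
      moreover have "norm (?p t)^2 / (2 * C1) - norm (?p t)^2 / (4 * C1) = norm (?p t)^2 / (4 * C1)"
        by (simp add: field_simps)
      ultimately have "norm (?p t)^2 / (4 * C1) \<le> C1 * R^2 + 2 * C3"
        using u E[of t] C3(2)[of "?x t"] by linarith
      then have "norm (?p t)^2 \<le> 4 * C1 * (C1 * R^2 + 2 * C3)"
        using C1(1) by (simp add: field_simps)
      then show ?thesis unfolding P_def by (rule real_le_rsqrt)
    qed
    have "norm (?x t - ?x 0) \<le> (C1 * P) * norm (t - 0)"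
    proof (rule differentiable_bound[where S=UNIV and f'="\<lambda>s h. h *\<^sub>R (\<kappa> (y s) *\<^sub>R V (?x s) (?p s))"])
      fix s
      show "(?x has_derivative (\<lambda>h. h *\<^sub>R (\<kappa> (y s) *\<^sub>R V (?x s) (?p s)))) (at s within UNIV)"
        using has_derivative_fst[OF dy[of s]] by (simp add: X_def)
      show "onorm (\<lambda>h. h *\<^sub>R (\<kappa> (y s) *\<^sub>R V (?x s) (?p s))) \<le> C1 * P"
      proof (rule onorm_bound)
        have P: "0 \<le> P" using p[of s] norm_ge_zero[of "?p s"] by linarith
        then show "0 \<le> C1 * P" using C1(1) by simp
        fix h :: real
        have "norm (V (?x s) (?p s)) \<le> C1 * P"
          using order_trans[OF V_bound mult_left_mono[OF p less_imp_le[OF C1(1)]]] .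
        moreover have "\<kappa> (y s) \<le> 1" using k by blast
        ultimately have "\<kappa> (y s) * norm (V (?x s) (?p s)) \<le> 1 * (C1 * P)"
          by (intro mult_mono) auto
        then have hk: "\<bar>h\<bar> * (\<kappa> (y s) * norm (V (?x s) (?p s))) \<le> \<bar>h\<bar> * (C1 * P)" by (intro mult_left_mono) auto
        show "norm (h *\<^sub>R (\<kappa> (y s) *\<^sub>R V (?x s) (?p s))) \<le> C1 * P * norm h"
        proof -
          have "\<bar>\<kappa> (y s)\<bar> = \<kappa> (y s)" by (rule abs_of_nonneg) (use k in blast)
          then show ?thesis using hk by (simp add: abs_mult mult.commute mult.left_commute)
        qed
      qed
    qed auto
    also have "\<dots> \<le> C1 * P * T"
    proof -
      have "0 \<le> P" using p[of 0] norm_ge_zero[of "?p 0"] by linarith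
      then show ?thesis using t C1(1) by (intro mult_left_mono) auto
    qed
    finally have "norm (?x t) \<le> R + C1 * P * T"
      using norm_triangle_ineq2[of "?x t" "?x 0"] norm_fst_le[of "?x 0" "?p 0"] y0 by simp
    then show ?thesis using norm_Pair_le[of "?x t" "?p t"] p[of t] by simp
  qed
  then show ?thesis by blast
qed

text \<open>In position and momentum the second-order equation becomes the flow of \<open>X\<close>,
  which is locally Lipschitz although \<open>L\<close> is only of class \<open>C^2\<close>.\<close>

lemma EL_curve_iff:
  "EL_curve L \<gamma> \<gamma>' \<longleftrightarrow> (\<exists>y. (\<forall>t. (y has_vector_derivative X (y t)) (at t)) \<and>
     (\<forall>t. \<gamma> t = fst (y t) \<and> \<gamma>' t = V (fst (y t)) (snd (y t))))"
proof
  assume E: "EL_curve L \<gamma> \<gamma>'"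
  let ?y = "\<lambda>t. (\<gamma> t, D_v L (\<gamma> t) (\<gamma>' t))"
  have "(?y has_vector_derivative X (?y t)) (at t)" for t
  proof -
    have "(?y has_vector_derivative (\<gamma>' t, D_x L (\<gamma> t) (\<gamma>' t))) (at t)"
      using E unfolding EL_curve_def by (intro has_vector_derivative_Pair) auto
    then show ?thesis by (simp add: X_def V_D_v)
  qed
  moreover have "\<gamma> t = fst (?y t) \<and> \<gamma>' t = V (fst (?y t)) (snd (?y t))" for t by (simp add: V_D_v)
  ultimately show "\<exists>y. (\<forall>t. (y has_vector_derivative X (y t)) (at t)) \<and>
     (\<forall>t. \<gamma> t = fst (y t) \<and> \<gamma>' t = V (fst (y t)) (snd (y t)))" by (intro exI[of _ ?y]) simp
next
  assume "\<exists>y. (\<forall>t. (y has_vector_derivative X (y t)) (at t)) \<and>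
     (\<forall>t. \<gamma> t = fst (y t) \<and> \<gamma>' t = V (fst (y t)) (snd (y t)))"
  then obtain y where y: "\<And>t. (y has_vector_derivative X (y t)) (at t)"
    and g: "\<gamma> = (\<lambda>t. fst (y t))" "\<gamma>' = (\<lambda>t. V (fst (y t)) (snd (y t)))" by fast
  have "((\<lambda>t. fst (y t)) has_vector_derivative fst (X (y t))) (at t)"
    "((\<lambda>t. snd (y t)) has_vector_derivative snd (X (y t))) (at t)" for t
    using has_derivative_fst[OF y[unfolded has_vector_derivative_def]]
      has_derivative_snd[OF y[unfolded has_vector_derivative_def]]
    unfolding has_vector_derivative_def by simp_all
  then show "EL_curve L \<gamma> \<gamma>'"
    unfolding EL_curve_def g by (simp add: X_def D_v_V)
qed

lemma continuous_on_D_v: "continuous_on UNIV (\<lambda>z. (fst z, D_v L (fst z) (snd z)))"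
proof (rule locally_lipschitz_imp_continuous)
  fix R
  obtain K where K: "K \<ge> 0" "\<And>x v y w. norm x \<le> R \<Longrightarrow> norm v \<le> R \<Longrightarrow> norm y \<le> R \<Longrightarrow> norm w \<le> R \<Longrightarrow>
       norm (D_x L x v - D_x L y w) \<le> K * (norm (x - y) + norm (v - w))"
     "\<And>x v y w. norm x \<le> R \<Longrightarrow> norm v \<le> R \<Longrightarrow> norm y \<le> R \<Longrightarrow> norm w \<le> R \<Longrightarrow>
       norm (D_v L x v - D_v L y w) \<le> K * (norm (x - y) + norm (v - w))"
    by (fact grad_lipschitz)
  have "norm ((fst a, D_v L (fst a) (snd a)) - (fst b, D_v L (fst b) (snd b))) \<le> (1 + 2 * K) * norm (a - b)"
    if "a \<in> cball 0 R" "b \<in> cball 0 R" for a b :: "'a \<times> 'a"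
  proof -
    obtain x p y q where a: "a = (x, p)" and b: "b = (y, q)" by force
    have n: "norm x \<le> R" "norm p \<le> R" "norm y \<le> R" "norm q \<le> R"
      using that norm_fst_le[of x p] norm_snd_le[of p x] norm_fst_le[of y q] norm_snd_le[of q y]
      by (auto simp: a b)
    have d: "norm (x - y) \<le> norm (a - b)" "norm (p - q) \<le> norm (a - b)"
      using norm_fst_le[of "x - y" "p - q"] norm_snd_le[of "p - q" "x - y"] by (auto simp: a b)
    have "norm (D_v L x p - D_v L y q) \<le> K * (norm (x - y) + norm (p - q))" by (intro K n)
    also have "\<dots> \<le> K * (norm (a - b) + norm (a - b))" using d K(1) by (intro mult_left_mono) auto
    finally have "norm (D_v L x p - D_v L y q) \<le> 2 * K * norm (a - b)" by simp
    then show ?thesis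
      using norm_Pair_le[of "x - y" "D_v L x p - D_v L y q"] d(1) unfolding distrib_right by (simp add: a b)
  qed
  then show "\<exists>K. \<forall>a\<in>cball 0 R. \<forall>b\<in>cball 0 R.
    norm ((fst a, D_v L (fst a) (snd a)) - (fst b, D_v L (fst b) (snd b))) \<le> K * norm (a - b)" by blast
qed

lemma continuous_on_V: "continuous_on UNIV (\<lambda>z. (fst z, V (fst z) (snd z)))"
proof -
  have "continuous_on UNIV X" by (rule locally_lipschitz_imp_continuous[OF X_locally_lipschitz])
  then have "continuous_on UNIV (\<lambda>z. (fst z, fst (X z)))" by (intro continuous_intros) auto
  then show ?thesis by (simp add: X_def)
qed

text \<open>Uniqueness for \<open>X\<close> turns the description in \<open>EL_flow\<close> into an
  equation: the flow of \<open>X\<close> conjugated by the Legendre map. Both properties are then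
  read off, as \<open>(x, 0)\<close> is an equilibrium of \<open>X\<close> when
  \<open>D_x L x 0\<close> vanishes.\<close>

lemma EL_flow_properties:
  shows "continuous_on UNIV (EL_flow L t)"
    and "D_x L x 0 = 0 \<Longrightarrow> EL_flow L t (x, 0) = (x, 0)"
proof -
  obtain \<Phi> where F: "\<And>z. \<Phi> z 0 = z" "\<And>z t. (\<Phi> z has_vector_derivative X (\<Phi> z t)) (at t)"
    "\<And>y t. (\<And>s. (y has_vector_derivative X (y s)) (at s)) \<Longrightarrow> y t = \<Phi> (y 0) t"
    "\<And>t. continuous_on UNIV (\<lambda>z. \<Phi> z t)"
    using locally_lipschitz_flow[OF X_locally_lipschitz X_scaled_bound] by metis
  let ?in = "\<lambda>z. (fst z, D_v L (fst z) (snd z))" and ?out = "\<lambda>z. (fst z, V (fst z) (snd z))"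
  have EL: "EL_flow L t z = ?out (\<Phi> (?in z) t)" for t z
    unfolding EL_flow_def
  proof (rule the_equality)
    let ?y = "\<Phi> (?in z)"
    have "EL_curve L (\<lambda>s. fst (?y s)) (\<lambda>s. V (fst (?y s)) (snd (?y s)))"
      unfolding EL_curve_iff by (intro exI[of _ ?y] conjI allI F(2)) auto
    moreover have "(fst (?y 0), V (fst (?y 0)) (snd (?y 0))) = z" by (simp add: F(1) V_D_v)
    ultimately show "\<exists>\<gamma> \<gamma>'. EL_curve L \<gamma> \<gamma>' \<and> (\<gamma> 0, \<gamma>' 0) = z \<and> (\<gamma> t, \<gamma>' t) = ?out (?y t)"
      by blast
  next
    fix w assume "\<exists>\<gamma> \<gamma>'. EL_curve L \<gamma> \<gamma>' \<and> (\<gamma> 0, \<gamma>' 0) = z \<and> (\<gamma> t, \<gamma>' t) = w"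
    then obtain \<gamma> \<gamma>' where g: "EL_curve L \<gamma> \<gamma>'" "(\<gamma> 0, \<gamma>' 0) = z" "(\<gamma> t, \<gamma>' t) = w" by blast
    then obtain y where y: "\<And>t. (y has_vector_derivative X (y t)) (at t)"
      and gy: "\<And>t. \<gamma> t = fst (y t)" "\<And>t. \<gamma>' t = V (fst (y t)) (snd (y t))" unfolding EL_curve_iff by blast
    have "?in z = y 0" using g(2) gy[of 0] by (auto simp: D_v_V)
    then show "w = ?out (\<Phi> (?in z) t)" using F(3)[OF y, of t] g(3) gy[of t] by simp
  qed
  have "continuous_on UNIV (\<lambda>z. ?out (\<Phi> (?in z) t))"
    by (rule continuous_on_compose2[OF continuous_on_V
          continuous_on_compose2[OF F(4) continuous_on_D_v]]) auto
  then show "continuous_on UNIV (EL_flow L t)" using EL by (simp add: fun_eq_iff cong: continuous_on_cong)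
  assume D: "D_x L x 0 = 0"
  have V0: "V x 0 = 0" using V_D_v[of x 0] by (simp add: D_v_0)
  have "((\<lambda>_::real. (x, 0 :: 'a)) has_vector_derivative X (x, 0)) (at s)" for s
    using D by (simp add: X_def V0 zero_prod_def[symmetric])
  from F(3)[of "\<lambda>_. (x, 0)", OF this] show "EL_flow L t (x, 0) = (x, 0)"
    unfolding EL by (simp add: D_v_0 V0)
qed

end

section \<open>Lagrangians with a potential, and Hamiltonians at rest\<close>

lemma dir_deriv_add:
  assumes "f differentiable (at x)" "g differentiable (at x)"
  shows "dir_deriv h (\<lambda>x. f x + g x) x = dir_deriv h f x + dir_deriv h g x"
proof -
  have "((\<lambda>x. f x + g x) has_derivative
      (\<lambda>h. frechet_derivative f (at x) h + frechet_derivative g (at x) h)) (at x)"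
    using assms unfolding frechet_derivative_works by (rule has_derivative_add)
  from frechet_derivative_at[OF this, symmetric] show ?thesis unfolding dir_deriv_def by simp
qed

lemma Ck_add:
  fixes f g :: "'a::euclidean_space \<Rightarrow> real"
  assumes "Ck k f" "Ck k g"
  shows "Ck k (\<lambda>x. f x + g x)"
  using assms
proof (induction k arbitrary: f g)
  case 0
  then show ?case by (simp add: continuous_on_add)
next
  case (Suc k)
  have "dir_deriv h (\<lambda>x. f x + g x) = (\<lambda>x. dir_deriv h f x + dir_deriv h g x)" for h
    using Suc.prems by (auto simp: dir_deriv_add)
  then show ?case using Suc by simp
qed

lemma Ck_fst:
  fixes f :: "'a::euclidean_space \<Rightarrow> real"
  assumes "Ck k f"
  shows "Ck k (\<lambda>z :: 'a \<times> 'b::euclidean_space. f (fst z))"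
  using assms
proof (induction k arbitrary: f)
  case 0
  have "continuous_on UNIV (\<lambda>z :: 'a \<times> 'b. f (fst z))"
    by (rule continuous_on_compose2[of UNIV f UNIV fst]) (use 0 in \<open>simp_all add: continuous_on_fst[OF continuous_on_id]\<close>)
  then show ?case by simp
next
  case (Suc k)
  have d: "((\<lambda>z :: 'a \<times> 'b. f (fst z)) has_derivative (\<lambda>h. frechet_derivative f (at (fst z)) (fst h))) (at z)" for z
    using Suc.prems
    by (intro has_derivative_compose[where f=fst and g=f]) (auto simp: frechet_derivative_works[symmetric] intro!: derivative_eq_intros)
  have "dir_deriv h (\<lambda>z :: 'a \<times> 'b. f (fst z)) = (\<lambda>z. dir_deriv (fst h) f (fst z))" for h
    unfolding dir_deriv_def using frechet_derivative_at[OF d] by auto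
  moreover have "(\<lambda>z :: 'a \<times> 'b. f (fst z)) differentiable (at z)" for z
    using d differentiableI by blast
  ultimately show ?case using Suc by simp
qed

lemma C2b_bounded_grad:
  assumes "C2b g"
  obtains B where "\<And>x. \<bar>g x\<bar> \<le> B" "\<And>x. norm (grad g x) \<le> B"
proof -
  obtain B0 where B0: "\<And>x. \<bar>g x\<bar> \<le> B0" using assms unfolding C2b_def bounded_iff by auto
  have "\<exists>b. \<forall>x. \<bar>dir_deriv i g x\<bar> \<le> b" if "i \<in> Basis" for i
    using assms that unfolding C2b_def bounded_iff by auto
  then obtain b where b: "\<And>i x. i \<in> Basis \<Longrightarrow> \<bar>dir_deriv i g x\<bar> \<le> b i" by metis
  have gd: "g differentiable (at x)" for x using assms Ck_2D(1) unfolding C2b_def by blast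
  have "norm (grad g x) \<le> (\<Sum>i\<in>Basis. b i)" for x
  proof -
    have "norm (grad g x) \<le> (\<Sum>i\<in>Basis. \<bar>grad g x \<bullet> i\<bar>)" by (rule norm_le_l1)
    also have "\<dots> \<le> (\<Sum>i\<in>Basis. b i)"
    proof (rule sum_mono)
      fix i :: 'a assume "i \<in> Basis"
      then show "\<bar>grad g x \<bullet> i\<bar> \<le> b i"
        using b[of i x] differentiable_imp_GDERIV(2)[OF gd[of x], of i] by (simp add: inner_commute)
    qed
    finally show ?thesis .
  qed
  then show ?thesis using that[of "max B0 (\<Sum>i\<in>Basis. b i)"] B0 by (simp add: le_max_iff_disj)
qed

lemma GDERIV_add_const: "GDERIV f x :> D \<Longrightarrow> GDERIV (\<lambda>y. f y + c) x :> D"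
  unfolding gderiv_def by (auto intro!: derivative_eq_intros)

text \<open>A potential leaves \<open>D_v\<close> unchanged, so the conditions on
  \<open>D_vv\<close> and \<open>D_vx\<close> carry over verbatim; only the bound at zero velocity
  grows, once for \<open>F\<close> and once for its gradient, hence \<open>2 * B\<close>.\<close>

lemma L_mf_reversible_tonelli:
  fixes L :: "'a::euclidean_space \<Rightarrow> 'a \<Rightarrow> real"
  assumes L: "strict_tonelli L" "reversible L" and F: "C2b (\<lambda>x. F x m)"
  shows "reversible_tonelli (L_mf L F m)" and "GDERIV (\<lambda>y. L_mf L F m y v) x :> D_x (L_mf L F m) x v"
proof -
  interpret reversible_tonelli L by standard (rule L)+
  have Fd: "(\<lambda>x. F x m) differentiable (at x)" for x using F Ck_2D(1) unfolding C2b_def by blast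
  have Dv: "D_v (L_mf L F m) x v = D_v L x v" for x v
    unfolding D_v_def[of "L_mf L F m"] L_mf_def by (rule GDERIV_unique[OF GDERIV_add_const[OF GDERIV_D_v]])
  have Dx: "GDERIV (\<lambda>y. L_mf L F m y v) x :> D_x L x v + grad (\<lambda>x. F x m) x" for x v
    unfolding L_mf_def by (rule GDERIV_add[OF GDERIV_D_x differentiable_imp_GDERIV(1)[OF Fd]])
  have Dxe: "D_x (L_mf L F m) x v = D_x L x v + grad (\<lambda>x. F x m) x" for x v
    unfolding D_x_def[of "L_mf L F m"] by (rule GDERIV_unique[OF Dx])
  then show "GDERIV (\<lambda>y. L_mf L F m y v) x :> D_x (L_mf L F m) x v" using Dx by simp
  have "Ck 2 (\<lambda>z :: 'a \<times> 'a. Lpair z + F (fst z) m)"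
    using F by (intro Ck_add Ck_Lpair Ck_fst) (simp add: C2b_def)
  then have C: "Ck 2 (\<lambda>(x, v). L_mf L F m x v)"
    by (simp add: L_mf_def case_prod_beta')
  obtain B where B: "\<And>x. \<bar>F x m\<bar> \<le> B" "\<And>x. norm (grad (\<lambda>x. F x m) x) \<le> B"
    by (rule C2b_bounded_grad[OF F]) blast
  obtain A1 A2 A3 where A: "A1 > 0" "A2 > 0" "A3 > 0"
    "\<forall>x v. (\<forall>h. (h \<bullet> h) / A1 \<le> D_vv L x v h \<bullet> h \<and> D_vv L x v h \<bullet> h \<le> A1 * (h \<bullet> h)) \<and>
        onorm (D_vx L x v) \<le> A2 * (1 + norm v) \<and>
        \<bar>L x 0\<bar> + norm (D_x L x 0) + norm (D_v L x 0) \<le> A3"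
    using L(1) unfolding strict_tonelli_def by blast
  have DvF: "D_v (L_mf L F m) = D_v L" by (intro ext) (rule Dv)
  have B0: "0 \<le> B" using B(1)[of undefined] by linarith
  have "strict_tonelli (L_mf L F m)"
    unfolding strict_tonelli_def
  proof (rule conjI[OF C], rule exI[of _ A1], rule conjI[OF A(1)], rule exI[of _ A2], rule conjI[OF A(2)],
      rule exI[of _ "A3 + 2 * B"], intro conjI allI)
    show "A3 + 2 * B > 0" using A(3) B0 by linarith
    fix x v h
    show "h \<bullet> h / A1 \<le> D_vv (L_mf L F m) x v h \<bullet> h" "D_vv (L_mf L F m) x v h \<bullet> h \<le> A1 * (h \<bullet> h)"
      unfolding D_vv_def DvF using A(4) unfolding D_vv_def by blast+
    show "onorm (D_vx (L_mf L F m) x v) \<le> A2 * (1 + norm v)"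
      unfolding D_vx_def DvF using A(4) unfolding D_vx_def by blast
    have "\<bar>L x 0\<bar> + norm (D_x L x 0) + norm (D_v L x 0) \<le> A3" using A(4) by blast
    then show "\<bar>L_mf L F m x 0\<bar> + norm (D_x (L_mf L F m) x 0) + norm (D_v (L_mf L F m) x 0) \<le> A3 + 2 * B"
      using B[of x] norm_triangle_ineq[of "D_x L x 0" "grad (\<lambda>x. F x m) x"] unfolding DvF Dxe L_mf_def by linarith
  qed
  then show "reversible_tonelli (L_mf L F m)"
    using L(2) by unfold_locales (simp_all add: reversible_def L_mf_def)
qed

section \<open>The Hamiltonian near zero momentum\<close>

context reversible_tonelli
begin

text \<open>Young's inequality for \<open>norm p * norm v\<close> against the quadratic lower bound
  on \<open>L\<close>. It makes the supremum in \<open>hamiltonian\<close> finite.\<close>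

lemma legendre_bound: "p \<bullet> v - L x v \<le> - L x 0 + C1 * norm p^2"
proof -
  have "0 \<le> (2 * C1 * norm p - norm v)^2" by simp
  then have "4 * C1 * (norm p * norm v) \<le> 4 * C1 * (C1 * norm p^2) + norm v^2"
    by (simp add: power2_eq_square algebra_simps)
  then have "(4 * C1) * (norm p * norm v - C1 * norm p^2) \<le> (4 * C1) * (norm v^2 / (4 * C1))"
    using C1(1) by (simp add: algebra_simps)
  then have "norm p * norm v - C1 * norm p^2 \<le> norm v^2 / (4 * C1)"
    using C1(1) by (subst (asm) mult_le_cancel_left_pos) auto
  then show ?thesis using L_lower[of x v] norm_cauchy_schwarz[of p v] by linarith
qed

lemma hamiltonian_ge: "p \<bullet> v - L x v \<le> hamiltonian L x p"
  unfolding hamiltonian_def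
  by (rule cSUP_upper) (auto intro!: bdd_aboveI2[where M="- L x 0 + C1 * norm p^2"] legendre_bound)

lemma hamiltonian_le: "(\<And>v. p \<bullet> v - L x v \<le> c) \<Longrightarrow> hamiltonian L x p \<le> c"
  unfolding hamiltonian_def by (rule cSUP_least) auto

lemma hamiltonian_ge_0: "- L x 0 \<le> hamiltonian L x p"
  using hamiltonian_ge[of p 0 x] by simp

lemma hamiltonian_0: "hamiltonian L x 0 = - L x 0"
  using hamiltonian_ge_0[of x 0] hamiltonian_le[of 0 x "- L x 0"] L_min_0[of x] by fastforce

text \<open>Reversibility puts the minimum of \<open>hamiltonian L x\<close> at 0, and
  \<open>legendre_bound\<close> adds a quadratic upper bound, so the gradient there vanishes. Hence
  the drift is zero wherever the solution has zero gradient.\<close>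

lemma D_v_hamiltonian_0: "D_v (hamiltonian L) x 0 = 0"
  unfolding D_v_def
proof (rule GDERIV_unique)
  have "(hamiltonian L x has_derivative (\<lambda>h. 0)) (at 0)"
  proof (rule has_derivative_quadratic[where d=1 and C=C1])
    fix p :: 'a
    have "hamiltonian L x p \<le> - L x 0 + C1 * norm p^2" by (intro hamiltonian_le legendre_bound)
    then show "norm (hamiltonian L x p - hamiltonian L x 0 - 0) \<le> C1 * (norm (p - 0))\<^sup>2"
      using hamiltonian_ge_0[of x p] by (simp add: hamiltonian_0)
  qed (use C1(1) in auto)
  then show "GDERIV (hamiltonian L x) 0 :> 0" by (simp add: gderiv_def)
qed

end

section \<open>The action along polygonal curves\<close>

text \<open>Here \<open>lag\<close> stands for a Lagrangian minus its minimal rest cost. By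
  \<open>chain\<close>, nearby points of \<open>K\<close> are joined inside \<open>K\<close> by
  three segments of length comparable to their distance, which replaces local convexity at the
  boundary.\<close>

locale nonneg_lagrangian =
  fixes K :: "'a::euclidean_space set" and lag :: "'a \<Rightarrow> 'a \<Rightarrow> real" and \<alpha> \<beta> :: real
  assumes compact_K: "compact K" and connected_K: "connected K"
    and cont_l: "continuous_on UNIV (\<lambda>(x, v). lag x v)"
    and nonneg: "x \<in> K \<Longrightarrow> 0 \<le> lag x 0"
    and lower: "lag x 0 + \<alpha> * norm v^2 \<le> lag x v" and upper: "lag x v \<le> lag x 0 + \<beta> * norm v^2"
    and \<alpha>\<beta>: "0 < \<alpha>" "0 \<le> \<beta>"
    and rest: "\<exists>x\<in>K. lag x 0 = 0"
    and chain: "x \<in> K \<Longrightarrow> \<exists>\<rho>>0. \<exists>C\<ge>0. \<forall>y\<in>K \<inter> ball x \<rho>. \<forall>z\<in>K \<inter> ball x \<rho>. \<exists>p q.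
      closed_segment y p \<subseteq> K \<and> closed_segment p q \<subseteq> K \<and> closed_segment q z \<subseteq> K \<and>
      norm (p - y) \<le> C * norm (z - y) \<and> norm (q - p) \<le> C * norm (z - y) \<and> norm (z - q) \<le> C * norm (z - y)"
begin

text \<open>Upper sums of the action along polygonal curves with constant speed on each edge: no integrals are
  needed, since splitting an edge never increases the cost.\<close>

inductive reach :: "'a \<Rightarrow> real \<Rightarrow> bool" where
  base: "x \<in> K \<Longrightarrow> lag x 0 = 0 \<Longrightarrow> reach x 0"
| step: "reach x a \<Longrightarrow> T > 0 \<Longrightarrow> closed_segment x y \<subseteq> K \<Longrightarrow>
    (\<forall>z\<in>closed_segment x y. lag z ((1 / T) *\<^sub>R (y - x)) \<le> b) \<Longrightarrow> reach y (a + T * b)"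

definition u :: "'a \<Rightarrow> real" where
  "u x = Inf {a. reach x a}"

lemma l_nonneg: "x \<in> K \<Longrightarrow> 0 \<le> lag x v"
  using nonneg[of x] lower[of x v] \<alpha>\<beta>(1) by (smt (verit) mult_nonneg_nonneg zero_le_power2)

lemma reachD: "reach x a \<Longrightarrow> x \<in> K \<and> 0 \<le> a"
proof (induction rule: reach.induct)
  case (step x a T y b)
  have "y \<in> K" using step by auto
  then have "0 \<le> b" using l_nonneg[of y] step(4) by (meson ends_in_segment(2) order_trans)
  then show ?case using step \<open>y \<in> K\<close> by simp
qed simp

lemma bdd_below_reach: "bdd_below {a. reach x a}"
  using reachD by (intro bdd_belowI[of _ 0]) blast

lemma u_le: "reach x a \<Longrightarrow> u x \<le> a"
  unfolding u_def using bdd_below_reach by (simp add: cInf_lower)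

lemma le_u:
  assumes "\<And>a. reach x a \<Longrightarrow> c \<le> a" "\<exists>a. reach x a"
  shows "c \<le> u x"
  unfolding u_def using assms by (intro cInf_greatest) auto

text \<open>At constant speed \<open>\<epsilon>\<close> an edge costs
  \<open>\<omega> / \<epsilon> + \<beta> * \<epsilon>\<close> per unit length. The free speed is the
  point: where the rest cost is small, slow motion makes this rate small too.\<close>

lemma reach_move:
  assumes r: "reach x a" and s: "closed_segment x y \<subseteq> K" and w: "\<And>z. z \<in> closed_segment x y \<Longrightarrow> lag z 0 \<le> \<omega>"
    and e: "\<epsilon> > 0"
  shows "reach y (a + norm (y - x) * (\<omega> / \<epsilon> + \<beta> * \<epsilon>))"
proof (cases "x = y")
  case False
  define T where "T = norm (y - x) / \<epsilon>"
  have T: "T > 0" using False e by (simp add: T_def)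
  have "lag z ((1 / T) *\<^sub>R (y - x)) \<le> \<omega> + \<beta> * \<epsilon>^2" if z: "z \<in> closed_segment x y" for z
  proof -
    have "norm ((1 / T) *\<^sub>R (y - x)) = \<epsilon>" using False e by (simp add: T_def)
    then show ?thesis using upper[of z "(1 / T) *\<^sub>R (y - x)"] w[OF z] by simp
  qed
  then have "reach y (a + T * (\<omega> + \<beta> * \<epsilon>^2))" using reach.step[OF r T s] by blast
  moreover have "T * (\<omega> + \<beta> * \<epsilon>^2) = norm (y - x) * (\<omega> / \<epsilon> + \<beta> * \<epsilon>)"
    using e by (simp add: T_def field_simps power2_eq_square)
  ultimately show ?thesis by simp
qed (use r in simp)

lemma reach_chain:
  assumes r: "reach y a" and s: "closed_segment y p \<subseteq> K" "closed_segment p q \<subseteq> K" "closed_segment q z \<subseteq> K"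
    and n: "norm (p - y) \<le> D" "norm (q - p) \<le> D" "norm (z - q) \<le> D"
    and w: "\<And>w. w \<in> K \<Longrightarrow> norm (w - y) \<le> 3 * D \<Longrightarrow> lag w 0 \<le> \<omega>" and e: "\<epsilon> > 0"
  shows "\<exists>a'. reach z a' \<and> a' \<le> a + 3 * D * (\<omega> / \<epsilon> + \<beta> * \<epsilon>)"
proof -
  have D: "D \<ge> 0" using n(1) norm_ge_zero[of "p - y"] by linarith
  have yK: "y \<in> K" using reachD[OF r] by blast
  have om: "0 \<le> \<omega>" using w[OF yK] nonneg[OF yK] D by simp
  have seg: "norm (w - y) \<le> norm (p' - y) + norm (q' - p')" if "w \<in> closed_segment p' q'" for w p' q'
    using segment_bound1[of w p' q'] that norm_triangle_ineq[of "w - p'" "p' - y"]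
    by (simp add: norm_minus_commute)
  have qy: "norm (q - y) \<le> 2 * D" using norm_triangle_ineq[of "q - p" "p - y"] n by simp
  have 1: "reach p (a + norm (p - y) * (\<omega> / \<epsilon> + \<beta> * \<epsilon>))"
    using seg[of _ y p] n s D by (intro reach_move[OF r s(1) w e]) (auto, fastforce)
  have 2: "reach q (a + norm (p - y) * (\<omega> / \<epsilon> + \<beta> * \<epsilon>) + norm (q - p) * (\<omega> / \<epsilon> + \<beta> * \<epsilon>))"
    using seg[of _ p q] n s D by (intro reach_move[OF 1 s(2) w e]) (auto, fastforce)
  have 3: "reach z (a + norm (p - y) * (\<omega> / \<epsilon> + \<beta> * \<epsilon>) + norm (q - p) * (\<omega> / \<epsilon> + \<beta> * \<epsilon>) + norm (z - q) * (\<omega> / \<epsilon> + \<beta> * \<epsilon>))"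
    using seg[of _ q z] n s D qy by (intro reach_move[OF 2 s(3) w e]) (auto, fastforce)
  have c: "0 \<le> \<omega> / \<epsilon> + \<beta> * \<epsilon>" using om e \<alpha>\<beta>(2) by simp
  have "(norm (p - y) + norm (q - p) + norm (z - q)) * (\<omega> / \<epsilon> + \<beta> * \<epsilon>) \<le> 3 * D * (\<omega> / \<epsilon> + \<beta> * \<epsilon>)"
    using n c by (intro mult_right_mono) auto
  then show ?thesis using 3 by (intro exI conjI) (assumption, simp add: algebra_simps)
qed

lemma continuous_on_l0: "continuous_on S (\<lambda>x. lag x 0)"
proof -
  have "continuous_on UNIV (\<lambda>x. (\<lambda>(x, v). lag x v) (x, 0))"
    by (rule continuous_on_compose2[OF cont_l]) (auto intro!: continuous_intros)
  then show ?thesis using continuous_on_subset by fastforce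
qed

lemma l0_bound: obtains \<omega> where "\<omega> \<ge> 0" "\<And>x. x \<in> K \<Longrightarrow> lag x 0 \<le> \<omega>"
proof -
  have "bounded ((\<lambda>x. lag x 0) ` K)"
    by (intro compact_imp_bounded compact_continuous_image continuous_on_l0 compact_K)
  then obtain B where "B > 0" "\<forall>y\<in>(\<lambda>x. lag x 0) ` K. norm y \<le> B" using bounded_pos by blast
  then show ?thesis using that[of B] by fastforce
qed

text \<open>\<open>\<rho>\<close> and \<open>C\<close> depend on \<open>x\<close> only; the speed
  and the cost level are left open, since continuity takes speed 1 and differentiability at rest
  points takes a small speed.\<close>

lemma u_local_estimate:
  assumes x: "x \<in> K"
  obtains \<rho> C where "\<rho> > 0" "C \<ge> 0"
    "\<And>y z a \<omega> \<epsilon>. y \<in> K \<inter> ball x \<rho> \<Longrightarrow> z \<in> K \<inter> ball x \<rho> \<Longrightarrow> reach y a \<Longrightarrow> \<epsilon> > 0 \<Longrightarrow>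
      (\<And>w. w \<in> K \<Longrightarrow> norm (w - y) \<le> C * norm (z - y) \<Longrightarrow> lag w 0 \<le> \<omega>) \<Longrightarrow>
      \<exists>a'. reach z a' \<and> a' \<le> a + C * norm (z - y) * (\<omega> / \<epsilon> + \<beta> * \<epsilon>)"
proof -
  obtain \<rho> C where rho: "\<rho> > 0" "C \<ge> 0" and ch: "\<forall>y\<in>K \<inter> ball x \<rho>. \<forall>z\<in>K \<inter> ball x \<rho>. \<exists>p q.
      closed_segment y p \<subseteq> K \<and> closed_segment p q \<subseteq> K \<and> closed_segment q z \<subseteq> K \<and>
      norm (p - y) \<le> C * norm (z - y) \<and> norm (q - p) \<le> C * norm (z - y) \<and> norm (z - q) \<le> C * norm (z - y)"
    using chain[OF x] by blast
  show ?thesis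
  proof (rule that[of \<rho> "3 * C"])
    fix y z a \<omega> \<epsilon> assume a: "y \<in> K \<inter> ball x \<rho>" "z \<in> K \<inter> ball x \<rho>" "reach y a" "(\<epsilon>::real) > 0"
      "\<And>w. w \<in> K \<Longrightarrow> norm (w - y) \<le> 3 * C * norm (z - y) \<Longrightarrow> lag w 0 \<le> \<omega>"
    obtain p q where pq: "closed_segment y p \<subseteq> K" "closed_segment p q \<subseteq> K" "closed_segment q z \<subseteq> K"
      "norm (p - y) \<le> C * norm (z - y)" "norm (q - p) \<le> C * norm (z - y)" "norm (z - q) \<le> C * norm (z - y)"
      using ch a(1,2) by blast
    have "\<exists>a'. reach z a' \<and> a' \<le> a + 3 * (C * norm (z - y)) * (\<omega> / \<epsilon> + \<beta> * \<epsilon>)"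
      by (rule reach_chain[OF a(3) pq]) (use a(4,5) in auto)
    then show "\<exists>a'. reach z a' \<and> a' \<le> a + 3 * C * norm (z - y) * (\<omega> / \<epsilon> + \<beta> * \<epsilon>)"
      by (simp only: mult.assoc)
  qed (use rho in auto)
qed

text \<open>Locally, reachability of one point entails that of all its neighbours, and
  \<open>K\<close> is connected.\<close>

lemma reachable: "x \<in> K \<Longrightarrow> \<exists>a. reach x a"
proof -
  assume x: "x \<in> K"
  obtain z where z: "z \<in> K" "lag z 0 = 0" using rest by blast
  obtain \<omega> where om: "\<omega> \<ge> 0" "\<And>x. x \<in> K \<Longrightarrow> lag x 0 \<le> \<omega>" by (rule l0_bound) blast
  show ?thesis
  proof (rule connected_induction_simple[OF connected_K z(1) x, where P="\<lambda>x. \<exists>a. reach x a"])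
    show "\<exists>a. reach z a" using reach.base[OF z] by blast
    fix y assume "y \<in> K"
    obtain \<rho> C where rho: "\<rho> > 0" "C \<ge> 0" and ch:
      "\<And>y' z a \<omega> \<epsilon>. y' \<in> K \<inter> ball y \<rho> \<Longrightarrow> z \<in> K \<inter> ball y \<rho> \<Longrightarrow> reach y' a \<Longrightarrow> \<epsilon> > 0 \<Longrightarrow>
      (\<And>w. w \<in> K \<Longrightarrow> norm (w - y') \<le> C * norm (z - y') \<Longrightarrow> lag w 0 \<le> \<omega>) \<Longrightarrow>
      \<exists>a'. reach z a' \<and> a' \<le> a + C * norm (z - y') * (\<omega> / \<epsilon> + \<beta> * \<epsilon>)"
      by (fact u_local_estimate[OF \<open>y \<in> K\<close>])
    show "\<exists>T. openin (top_of_set K) T \<and> y \<in> T \<and> (\<forall>x\<in>T. \<forall>y\<in>T. (\<exists>a. reach x a) \<longrightarrow> (\<exists>a. reach y a))"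
    proof (intro exI[of _ "K \<inter> ball y \<rho>"] conjI ballI impI)
      show "openin (top_of_set K) (K \<inter> ball y \<rho>)" by (simp add: openin_open_Int)
      show "y \<in> K \<inter> ball y \<rho>" using \<open>y \<in> K\<close> rho by simp
      fix a b assume ab: "a \<in> K \<inter> ball y \<rho>" "b \<in> K \<inter> ball y \<rho>" "\<exists>c. reach a c"
      then obtain c where "reach a c" by blast
      from ch[OF ab(1,2) this, of 1 \<omega>] om(2) show "\<exists>c. reach b c" by auto
    qed
  qed
qed

lemma u_nonneg: "x \<in> K \<Longrightarrow> 0 \<le> u x"
  using reachable reachD by (intro le_u) auto

lemma u_rest: "x \<in> K \<Longrightarrow> lag x 0 = 0 \<Longrightarrow> u x = 0"
  using u_le[OF reach.base] u_nonneg by (simp add: antisym)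

lemma continuous_on_u: "continuous_on K u"
  unfolding continuous_on_iff
proof (intro ballI allI impI)
  fix x and e :: real assume x: "x \<in> K" and e: "e > 0"
  obtain \<omega> where om: "\<omega> \<ge> 0" "\<And>x. x \<in> K \<Longrightarrow> lag x 0 \<le> \<omega>" by (rule l0_bound) blast
  obtain \<rho> C where rho: "\<rho> > 0" "C \<ge> 0" and ch:
      "\<And>y' z a \<omega> \<epsilon>. y' \<in> K \<inter> ball x \<rho> \<Longrightarrow> z \<in> K \<inter> ball x \<rho> \<Longrightarrow> reach y' a \<Longrightarrow> \<epsilon> > 0 \<Longrightarrow>
      (\<And>w. w \<in> K \<Longrightarrow> norm (w - y') \<le> C * norm (z - y') \<Longrightarrow> lag w 0 \<le> \<omega>) \<Longrightarrow>
      \<exists>a'. reach z a' \<and> a' \<le> a + C * norm (z - y') * (\<omega> / \<epsilon> + \<beta> * \<epsilon>)"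
    by (fact u_local_estimate[OF x])
  define D where "D = C * (\<omega> + \<beta>) + 1"
  have D: "D > 0" using rho om \<alpha>\<beta> by (simp add: D_def add_nonneg_pos)
  have est: "u z \<le> u y + D * norm (z - y)" if yz: "y \<in> K \<inter> ball x \<rho>" "z \<in> K \<inter> ball x \<rho>" for y z
  proof -
    have "u z - D * norm (z - y) \<le> a" if a: "reach y a" for a
    proof -
      obtain a' where a': "reach z a'" "a' \<le> a + C * norm (z - y) * (\<omega> + \<beta>)"
        using ch[OF yz a, of 1 \<omega>] om(2) by auto
      have "C * norm (z - y) * (\<omega> + \<beta>) \<le> D * norm (z - y)"
        by (simp add: D_def algebra_simps)
      then show ?thesis using u_le[OF a'(1)] a'(2) by linarith
    qed
    then have "u z - D * norm (z - y) \<le> u y" using reachable yz(1) by (intro le_u) auto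
    then show ?thesis by simp
  qed
  show "\<exists>d>0. \<forall>x'\<in>K. dist x' x < d \<longrightarrow> dist (u x') (u x) < e"
  proof (intro exI[of _ "min \<rho> (e / D)"] conjI ballI impI)
    fix y assume y: "y \<in> K" "dist y x < min \<rho> (e / D)"
    have "u y \<le> u x + D * norm (y - x)" "u x \<le> u y + D * norm (x - y)"
      using y x rho by (auto intro!: est simp: dist_commute)
    then have "dist (u y) (u x) \<le> D * norm (y - x)" by (simp add: dist_real_def norm_minus_commute)
    also have "\<dots> < D * (e / D)" using y(2) D by (intro mult_strict_left_mono) (auto simp: dist_norm)
    finally show "dist (u y) (u x) < e" using D by simp
  qed (use rho e D in auto)
qed

text \<open>Near a rest point the rest cost is small, so moving slowly brings the cost per unit
  length below any \<open>e\<close>. As \<open>u\<close> is nonnegative and vanishes at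
  \<open>x\<close>, this is differentiability with derivative 0, also at the boundary.\<close>

lemma u_has_derivative_rest:
  assumes x: "x \<in> K" "lag x 0 = 0"
  shows "(u has_derivative (\<lambda>h. 0)) (at x within K)"
  unfolding has_derivative_within_alt
proof (intro conjI allI impI)
  fix e :: real assume e: "e > 0"
  obtain \<rho> C where rho: "\<rho> > 0" "C \<ge> 0" and ch:
      "\<And>y' z a \<omega> \<epsilon>. y' \<in> K \<inter> ball x \<rho> \<Longrightarrow> z \<in> K \<inter> ball x \<rho> \<Longrightarrow> reach y' a \<Longrightarrow> \<epsilon> > 0 \<Longrightarrow>
      (\<And>w. w \<in> K \<Longrightarrow> norm (w - y') \<le> C * norm (z - y') \<Longrightarrow> lag w 0 \<le> \<omega>) \<Longrightarrow>
      \<exists>a'. reach z a' \<and> a' \<le> a + C * norm (z - y') * (\<omega> / \<epsilon> + \<beta> * \<epsilon>)"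
    by (fact u_local_estimate[OF x(1)])
  \<comment> \<open>The speed makes the kinetic part at most \<open>e / 2\<close>, then the cost
    level \<open>\<omega>\<close> makes the rest part at most \<open>e / 2\<close>; the added 1's
    guard against \<open>C = 0\<close> and \<open>\<beta> = 0\<close>.\<close>
  define \<epsilon> where "\<epsilon> = e / (2 * (C * \<beta> + 1))"
  define \<omega> where "\<omega> = \<epsilon> * e / (2 * (C + 1))"
  have pos: "C * \<beta> + 1 > 0" "C + 1 > 0" using rho(2) \<alpha>\<beta>(2) by (auto intro: add_nonneg_pos)
  have ep: "\<epsilon> > 0" using e pos by (simp add: \<epsilon>_def)
  have om: "\<omega> > 0" using e ep pos by (simp add: \<omega>_def)
  have small: "C * (\<omega> / \<epsilon> + \<beta> * \<epsilon>) \<le> e"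
  proof -
    have "C * (\<omega> / \<epsilon>) = (C / (C + 1)) * (e / 2)" using ep by (simp add: \<omega>_def)
    also have "\<dots> \<le> 1 * (e / 2)" using e pos rho(2) by (intro mult_right_mono) auto
    finally have 1: "C * (\<omega> / \<epsilon>) \<le> e / 2" by simp
    have "C * (\<beta> * \<epsilon>) = (C * \<beta> / (C * \<beta> + 1)) * (e / 2)" by (simp add: \<epsilon>_def ac_simps)
    also have "\<dots> \<le> 1 * (e / 2)" using e pos by (intro mult_right_mono) auto
    finally have "C * (\<beta> * \<epsilon>) \<le> e / 2" by simp
    with 1 have "C * (\<omega> / \<epsilon>) + C * (\<beta> * \<epsilon>) \<le> e" by linarith
    then show ?thesis by (simp only: distrib_left)
  qed
  have "continuous_on UNIV (\<lambda>x. lag x 0)" by (rule continuous_on_l0)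
  then obtain d where d: "d > 0" "\<And>w. dist w x < d \<Longrightarrow> dist (lag w 0) (lag x 0) < \<omega>"
    using om unfolding continuous_on_iff by (metis UNIV_I)
  show "\<exists>d>0. \<forall>y\<in>K. norm (y - x) < d \<longrightarrow> norm (u y - u x - 0) \<le> e * norm (y - x)"
  proof (intro exI[of _ "min \<rho> (d / (C + 1))"] conjI ballI impI)
    fix y assume y: "y \<in> K" "norm (y - x) < min \<rho> (d / (C + 1))"
    have "lag w 0 \<le> \<omega>" if w: "norm (w - x) \<le> C * norm (y - x)" for w
    proof -
      have "C * norm (y - x) \<le> C * (d / (C + 1))" using y(2) rho by (intro mult_left_mono) auto
      also have "\<dots> < d" using pos d(1) by (simp add: field_simps)
      finally have "dist w x < d" using w by (simp add: dist_norm)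
      from d(2)[OF this] show ?thesis using x(2) by (simp add: dist_real_def)
    qed
    then obtain a' where a': "reach y a'" "a' \<le> 0 + C * norm (y - x) * (\<omega> / \<epsilon> + \<beta> * \<epsilon>)"
      using ch[OF _ _ reach.base[OF x] ep, of y \<omega>] y x(1) rho(1) by (auto simp: dist_norm norm_minus_commute)
    have "u y \<le> (C * (\<omega> / \<epsilon> + \<beta> * \<epsilon>)) * norm (y - x)"
      using u_le[OF a'(1)] a'(2) by (simp add: algebra_simps)
    also have "\<dots> \<le> e * norm (y - x)" using small by (intro mult_right_mono) auto
    finally show "norm (u y - u x - 0) \<le> e * norm (y - x)"
      using u_nonneg[OF y(1)] u_rest[OF x] by simp
  qed (use rho d pos in auto)
qed simp

end

section \<open>Sub- and supersolution inequalities for the least action\<close>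

context nonneg_lagrangian
begin

text \<open>Arrive at \<open>x\<close> along the short edge from \<open>x - h v\<close>: its cost
  bounds \<open>u x - u y\<close> from above, and touching bounds it from below by an increment of
  \<open>\<phi>\<close>. The value \<open>b\<close> strictly between the two sides of the negated
  claim leaves room for continuity.\<close>

lemma u_subsolution:
  assumes O: "open \<Omega>" "\<Omega> \<subseteq> K" "x \<in> \<Omega>" and \<phi>: "Ck 1 \<phi>"
    and touch: "\<forall>\<^sub>F y in at x within \<Omega>. u y - \<phi> y \<le> u x - \<phi> x"
  shows "grad \<phi> x \<bullet> v \<le> lag x v"
proof (rule ccontr)
  assume "\<not> grad \<phi> x \<bullet> v \<le> lag x v"
  then have "lag x v < grad \<phi> x \<bullet> v" by simp
  then obtain b where b: "lag x v < b" "b < grad \<phi> x \<bullet> v" using dense by blast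
  have G: "GDERIV \<phi> z :> grad \<phi> z" for z
    using \<phi> differentiable_imp_GDERIV(1)[of \<phi> z] by simp
  have cg: "continuous_on UNIV (grad \<phi>)" by (rule Ck_1_imp_continuous_grad[OF \<phi>])
  have "continuous_on UNIV (\<lambda>z. (\<lambda>(x, v). lag x v) (z, v))"
    by (rule continuous_on_compose2[OF cont_l]) (auto intro!: continuous_intros)
  then have cl: "continuous_on UNIV (\<lambda>z. lag z v)" by simp
  obtain d1 where d1: "d1 > 0" "ball x d1 \<subseteq> \<Omega>" using O open_contains_ball by blast
  obtain d2 where d2: "d2 > 0" "\<And>y. y \<in> \<Omega> \<Longrightarrow> y \<noteq> x \<Longrightarrow> dist y x < d2 \<Longrightarrow> u y - \<phi> y \<le> u x - \<phi> x"
    using touch unfolding eventually_at by auto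
  have "open {z. lag z v < b}" using cl by (intro open_Collect_less) auto
  then obtain d3 where d3: "d3 > 0" "ball x d3 \<subseteq> {z. lag z v < b}" using b(1) open_contains_ball by blast
  have "open {z. b < grad \<phi> z \<bullet> v}" using cg by (intro open_Collect_less continuous_intros) auto
  then obtain d4 where d4: "d4 > 0" "ball x d4 \<subseteq> {z. b < grad \<phi> z \<bullet> v}" using b(2) open_contains_ball by blast
  define d where "d = min (min d1 d2) (min d3 d4)"
  have d: "d > 0" using d1 d2 d3 d4 by (simp add: d_def)
  define h where "h = d / (norm v + 1)"
  have nv: "norm v + 1 > 0" using norm_ge_zero[of v] by linarith
  have h: "h > 0" "h * norm v < d" using d nv by (simp_all add: h_def pos_divide_less_eq distrib_left)
  define y where "y = x - h *\<^sub>R v"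
  have xb: "x \<in> ball x d" and yb: "y \<in> ball x d" using h d by (auto simp: y_def dist_norm)
  have seg: "closed_segment y x \<subseteq> ball x d"
    using xb yb by (simp add: closed_segment_subset)
  have db: "ball x d \<subseteq> ball x d1" "ball x d \<subseteq> ball x d2" "ball x d \<subseteq> ball x d3" "ball x d \<subseteq> ball x d4"
    by (auto simp: d_def)
  have segK: "closed_segment y x \<subseteq> K" using seg d1(2) O(2) db(1) by blast
  have hv: "(1 / h) *\<^sub>R (x - y) = v" using h by (simp add: y_def)
  have edge: "u x \<le> u y + h * b"
  proof -
    have "u x - h * b \<le> a" if a: "reach y a" for a
    proof -
      have "\<forall>z\<in>closed_segment y x. lag z ((1 / h) *\<^sub>R (x - y)) \<le> b"
        unfolding hv using seg d3(2) db(3) less_imp_le by blast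
      from u_le[OF reach.step[OF a h(1) segK this]] show ?thesis by simp
    qed
    then have "u x - h * b \<le> u y" using segK reachable by (intro le_u) auto
    then show ?thesis by simp
  qed
  obtain t where t: "0 < t" "t < 1" "\<phi> x - \<phi> y = (x - y) \<bullet> grad \<phi> (y + t *\<^sub>R (x - y))"
    by (rule mvt_segment[OF G])
  have "y + t *\<^sub>R (x - y) \<in> closed_segment y x"
    unfolding in_segment using t(1,2) by (intro exI[of _ t]) (auto simp: algebra_simps)
  then have "y + t *\<^sub>R (x - y) \<in> ball x d4" using seg db(4) by blast
  then have "b < grad \<phi> (y + t *\<^sub>R (x - y)) \<bullet> v" using d4(2) by blast
  then have "h * b < h * (grad \<phi> (y + t *\<^sub>R (x - y)) \<bullet> v)" using h(1) by simp
  also have "\<dots> = \<phi> x - \<phi> y" using t(3) by (simp add: y_def inner_commute)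
  also have "\<dots> \<le> u x - u y"
  proof (cases "y = x")
    case False
    have "y \<in> \<Omega>" using yb d1(2) db(1) by blast
    moreover have "dist y x < d2" using subsetD[OF db(2) yb] by (simp add: dist_commute)
    ultimately
    show ?thesis using d2(2)[of y] False by simp
  qed simp
  finally show False using edge by simp
qed

text \<open>Bounded velocities are handled by uniform continuity, large ones by quadratic growth.
  The margin is proportional to \<open>norm v\<close> because it then adds up along an edge to
  \<open>\<delta>\<close> times the length, whatever the speed.\<close>

lemma strict_bound_near:
  assumes x: "x \<in> K" and \<phi>: "Ck 1 \<phi>" and \<eta>: "\<eta> > 0" "\<And>v. grad \<phi> x \<bullet> v - lag x v \<le> - \<eta>"
  obtains r \<delta> where "r > 0" "\<delta> > 0"
    "\<And>y v. y \<in> K \<Longrightarrow> dist y x < r \<Longrightarrow> 0 < lag y 0 \<and> grad \<phi> y \<bullet> v + \<delta> * norm v \<le> lag y v"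
proof -
  have cg: "continuous_on UNIV (grad \<phi>)" by (rule Ck_1_imp_continuous_grad[OF \<phi>])
  define M where "M = norm (grad \<phi> x) + 2"
  have M: "M > 0" by (simp add: M_def add_nonneg_pos)
  \<comment> \<open>Beyond \<open>R\<close> the term \<open>\<alpha> * norm v^2\<close> exceeds
    \<open>M * norm v\<close>; the 2 in \<open>M\<close> leaves 1 for the variation of the gradient
    and 1 for \<open>\<delta>\<close>.\<close>
  define R where "R = M / \<alpha>"
  have R: "R > 0" using M \<alpha>\<beta> by (simp add: R_def)
  define \<delta> where "\<delta> = min 1 (\<eta> / (2 * R))"
  have dl: "\<delta> > 0" "\<delta> \<le> 1" "\<delta> * R \<le> \<eta> / 2" using \<eta>(1) R by (auto simp: \<delta>_def min_def field_simps)
  have "continuous_on UNIV (\<lambda>z. grad \<phi> (fst z) \<bullet> snd z - (\<lambda>(x, v). lag x v) z)"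
    by (intro continuous_intros continuous_on_compose2[OF cg] cont_l) auto
  then have "continuous_on (cball x 1 \<times> cball 0 R) (\<lambda>z. grad \<phi> (fst z) \<bullet> snd z - (\<lambda>(x, v). lag x v) z)"
    using continuous_on_subset by blast
  then have "uniformly_continuous_on (cball x 1 \<times> cball 0 R) (\<lambda>z. grad \<phi> (fst z) \<bullet> snd z - (\<lambda>(x, v). lag x v) z)"
    by (intro compact_uniformly_continuous compact_Times) auto
  then obtain d1 where d1: "d1 > 0" and uc: "\<And>z z'. z \<in> cball x 1 \<times> cball 0 R \<Longrightarrow> z' \<in> cball x 1 \<times> cball 0 R \<Longrightarrow>
      dist z' z < d1 \<Longrightarrow> dist (grad \<phi> (fst z') \<bullet> snd z' - (\<lambda>(x, v). lag x v) z') (grad \<phi> (fst z) \<bullet> snd z - (\<lambda>(x, v). lag x v) z) < \<eta> / 2"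
    unfolding uniformly_continuous_on_def using half_gt_zero[OF \<eta>(1)] by metis
  have "0 < lag x 0" using \<eta>(2)[of 0] \<eta>(1) by simp
  moreover have "open {z. 0 < lag z 0}" using continuous_on_l0 by (intro open_Collect_less) auto
  ultimately obtain d2 where d2: "d2 > 0" "ball x d2 \<subseteq> {z. 0 < lag z 0}" using open_contains_ball by blast
  have "open {z. norm (grad \<phi> z) < M - 1}" using cg by (intro open_Collect_less continuous_intros) auto
  moreover have "norm (grad \<phi> x) < M - 1" by (simp add: M_def)
  ultimately obtain d3 where d3: "d3 > 0" "ball x d3 \<subseteq> {z. norm (grad \<phi> z) < M - 1}" using open_contains_ball by blast
  define r where "r = min (min 1 d1) (min d2 d3)"
  show ?thesis
  proof (rule that[of r \<delta>])
    show "r > 0" using d1 d2 d3 by (simp add: r_def)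
    fix y v assume y: "y \<in> K" "dist y x < r"
    have "0 < lag y 0" using d2(2) y(2) by (auto simp: r_def dist_commute subset_iff)
    moreover have "grad \<phi> y \<bullet> v + \<delta> * norm v \<le> lag y v"
    proof (cases "norm v \<le> R")
      case True
      have "dist (grad \<phi> y \<bullet> v - lag y v) (grad \<phi> x \<bullet> v - lag x v) < \<eta> / 2"
        using uc[of "(x, v)" "(y, v)"] y(2) True by (auto simp: r_def dist_commute dist_Pair_Pair)
      then have "grad \<phi> y \<bullet> v - lag y v < - (\<eta> / 2)" using \<eta>(2)[of v] unfolding dist_real_def by linarith
      moreover have "\<delta> * norm v \<le> \<delta> * R" using True dl(1) by simp
      ultimately show ?thesis using dl(3) by linarith
    next
      case False
      have "norm (grad \<phi> y) \<le> M - 1" using d3(2) y(2) by (auto simp: r_def dist_commute subset_iff less_imp_le)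
      then have "grad \<phi> y \<bullet> v \<le> (M - 1) * norm v"
        using norm_cauchy_schwarz[of "grad \<phi> y" v] mult_right_mono[of "norm (grad \<phi> y)" "M - 1" "norm v"] by simp
      moreover have "\<delta> * norm v \<le> 1 * norm v" using dl(2) by (intro mult_right_mono) auto
      moreover have "M * norm v \<le> \<alpha> * norm v^2"
      proof -
        have "M \<le> \<alpha> * norm v" using False \<alpha>\<beta> by (simp add: R_def field_simps)
        then show ?thesis by (simp add: power2_eq_square mult.assoc[symmetric] mult_right_mono)
      qed
      ultimately have "grad \<phi> y \<bullet> v + \<delta> * norm v \<le> \<alpha> * norm v^2" by (simp add: algebra_simps)
      then show ?thesis using lower[of y v] nonneg[OF y(1)] by linarith
    qed
    ultimately show "0 < lag y 0 \<and> grad \<phi> y \<bullet> v + \<delta> * norm v \<le> lag y v" by blast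
  qed (rule dl(1))
qed

text \<open>If the claim failed, no rest point would lie near \<open>x\<close>, so every competitor
  would have to enter a ball around \<open>x\<close> from outside. On the sphere, touching gives
  \<open>u q \<ge> u x - \<phi> x + \<phi> q\<close>, and inside, the margin of
  \<open>strict_bound_near\<close> charges \<open>\<delta>\<close> per unit length on top of the
  increment of \<open>\<phi>\<close>. Reaching \<open>x\<close> would then cost at least
  \<open>u x + \<delta> * r\<close>.\<close>

lemma u_supersolution:
  assumes x: "x \<in> K" and \<phi>: "Ck 1 \<phi>"
    and touch: "\<forall>\<^sub>F y in at x within K. u y - \<phi> y \<ge> u x - \<phi> x"
    and \<eta>: "\<eta> > 0"
  shows "\<exists>v. grad \<phi> x \<bullet> v - lag x v > - \<eta>"
proof (rule ccontr)
  assume "\<not> (\<exists>v. grad \<phi> x \<bullet> v - lag x v > - \<eta>)"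
  then have neg: "\<And>v. grad \<phi> x \<bullet> v - lag x v \<le> - \<eta>" by (simp add: not_less)
  have G: "GDERIV \<phi> z :> grad \<phi> z" for z
    using \<phi> differentiable_imp_GDERIV(1)[of \<phi> z] by simp
  obtain r1 \<delta> where r1: "r1 > 0" "\<delta> > 0"
    "\<And>y v. y \<in> K \<Longrightarrow> dist y x < r1 \<Longrightarrow> 0 < lag y 0 \<and> grad \<phi> y \<bullet> v + \<delta> * norm v \<le> lag y v"
    by (fact strict_bound_near[OF x \<phi> \<eta> neg])
  obtain r2 where r2: "r2 > 0" "\<And>y. y \<in> K \<Longrightarrow> y \<noteq> x \<Longrightarrow> dist y x < r2 \<Longrightarrow> u y - \<phi> y \<ge> u x - \<phi> x"
    using touch unfolding eventually_at by auto
  define r where "r = min r1 r2 / 2"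
  have r: "r > 0" using r1 r2 by (simp add: r_def)
  have in_r: "dist y x < r1" "dist y x < r2" if "y \<in> cball x r" for y
    using that r r1(1) r2(1) by (auto simp: r_def dist_commute min_def split: if_splits)
  have touch': "u x - \<phi> x \<le> u y - \<phi> y" if "y \<in> K" "y \<in> cball x r" for y
    using r2(2)[OF that(1)] in_r(2)[OF that(2)] by (cases "y = x") auto
  have edge: "\<phi> z - \<phi> q + \<delta> * norm (z - q) \<le> S * b"
    if q: "q \<in> cball x r" "z \<in> cball x r" "closed_segment q z \<subseteq> K" "S > 0"
      and b: "\<forall>w\<in>closed_segment q z. lag w ((1 / S) *\<^sub>R (z - q)) \<le> b" for q z S b
  proof -
    obtain t where t: "0 < t" "t < 1" "\<phi> z - \<phi> q = (z - q) \<bullet> grad \<phi> (q + t *\<^sub>R (z - q))"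
      by (rule mvt_segment[OF G])
    let ?w = "q + t *\<^sub>R (z - q)" and ?v = "(1 / S) *\<^sub>R (z - q)"
    have w: "?w \<in> closed_segment q z"
      unfolding in_segment using t(1,2) by (intro exI[of _ t]) (auto simp: algebra_simps)
    moreover have "closed_segment q z \<subseteq> cball x r" using q(1,2) by (simp add: closed_segment_subset)
    ultimately have "grad \<phi> ?w \<bullet> ?v + \<delta> * norm ?v \<le> lag ?w ?v" using r1(3)[of ?w ?v] in_r q(3) by blast
    also have "\<dots> \<le> b" using b w by blast
    finally have "S * (grad \<phi> ?w \<bullet> ?v + \<delta> * norm ?v) \<le> S * b" using q(4) by simp
    moreover have "S * (grad \<phi> ?w \<bullet> ?v + \<delta> * norm ?v) = \<phi> z - \<phi> q + \<delta> * norm (z - q)"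
      using q(4) t(3) by (simp add: distrib_left inner_commute)
    ultimately show ?thesis by simp
  qed
  \<comment> \<open>A lower bound for all costs, kept along every competitor. The last term is the
    charge for the distance to be covered from the sphere to \<open>y\<close>.\<close>
  have inv: "y \<in> ball x r \<longrightarrow> u x - \<phi> x + \<phi> y + \<delta> * (r - norm (y - x)) \<le> a" if "reach y a" for y a
    using that
  proof (induction rule: reach.induct)
    case (base y)
    have "\<not> dist y x < r1" using r1(3)[of y 0] base by fastforce
    then show ?case using in_r(1)[of y] by auto
  next
    case (step y a T z b)
    show ?case
    proof
      assume z: "z \<in> ball x r"
      show "u x - \<phi> x + \<phi> z + \<delta> * (r - norm (z - x)) \<le> a + T * b"
      proof (cases "y \<in> ball x r")
        case True
        have "\<phi> z - \<phi> y + \<delta> * norm (z - y) \<le> T * b"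
          using True z step by (intro edge) auto
        moreover have "u x - \<phi> x + \<phi> y + \<delta> * (r - norm (y - x)) \<le> a" using step.IH True by blast
        moreover have "\<delta> * (r - norm (z - x)) \<le> \<delta> * (r - norm (y - x) + norm (z - y))"
          using r1(2) norm_triangle_ineq[of "y - z" "z - x"] by (intro mult_left_mono) (auto simp: norm_minus_commute)
        ultimately show ?thesis by (simp add: distrib_left)
      next
        case False
        \<comment> \<open>The edge enters the ball and is split at a point \<open>q\<close> of the
          sphere. The part up to \<open>q\<close> is estimated through \<open>u q\<close>, since the
          induction hypothesis says nothing outside the ball.\<close>
        let ?f = "\<lambda>t. y + t *\<^sub>R (z - y)"
        have "\<exists>t\<ge>0. t \<le> 1 \<and> norm (?f t - x) = r"
          by (rule IVT2') (use z False in \<open>auto intro!: continuous_intros simp: dist_norm norm_minus_commute\<close>)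
        then obtain t where t: "0 \<le> t" "t \<le> 1" "norm (?f t - x) = r" by blast
        define q where "q = ?f t"
        have t1: "t < 1" using t z by (cases "t = 1") (auto simp: dist_norm norm_minus_commute)
        have zq: "z - q = (1 - t) *\<^sub>R (z - y)" by (simp add: q_def algebra_simps)
        have qseg: "q \<in> closed_segment y z"
          unfolding in_segment q_def using t(1,2) by (intro exI[of _ t]) (auto simp: algebra_simps)
        have s1: "closed_segment y q \<subseteq> closed_segment y z" and s2: "closed_segment q z \<subseteq> closed_segment y z"
          using qseg by (auto simp: closed_segment_subset)
        \<comment> \<open>If \<open>y\<close> itself is the chosen point of the sphere, the first
          part is void, and \<open>step\<close> does not admit an edge of duration 0.\<close>
        have "reach q (a + (t * T) * b)"
        proof (cases "t = 0")
          case True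
          then show ?thesis using step.hyps(1) by (simp add: q_def)
        next
          case False
          have "\<forall>w\<in>closed_segment y q. lag w ((1 / (t * T)) *\<^sub>R (q - y)) \<le> b"
            using s1 step.hyps(4) False by (auto simp: q_def)
          then show ?thesis using False t(1) step.hyps s1 by (intro reach.step) auto
        qed
        then have uq: "u q \<le> a + (t * T) * b" by (rule u_le)
        have qb: "q \<in> cball x r" using t(3) by (simp add: q_def dist_norm norm_minus_commute)
        have "\<phi> z - \<phi> q + \<delta> * norm (z - q) \<le> ((1 - t) * T) * b"
        proof (rule edge[OF qb])
          show "\<forall>w\<in>closed_segment q z. lag w ((1 / ((1 - t) * T)) *\<^sub>R (z - q)) \<le> b"
            unfolding zq using s2 step.hyps(4) t1 by auto
        qed (use z s2 step.hyps t1 in auto)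
        moreover have "u x - \<phi> x \<le> u q - \<phi> q" using qseg step.hyps(3) qb by (intro touch') auto
        moreover have "\<delta> * (r - norm (z - x)) \<le> \<delta> * norm (z - q)"
          using r1(2) t(3) norm_triangle_ineq[of "q - z" "z - x"]
          by (intro mult_left_mono) (auto simp: norm_minus_commute q_def)
        moreover have "(t * T) * b + ((1 - t) * T) * b = T * b" by (simp add: algebra_simps)
        ultimately show ?thesis using uq by linarith
      qed
    qed
  qed
  have "u x + \<delta> * r \<le> u x"
    using inv[of x] r reachable[OF x] by (intro le_u) auto
  then show False using r r1(2) by (simp add: mult_le_0_iff)
qed

end

section \<open>Domains with \<open>C\<^sup>2\<close> boundary\<close>

text \<open>Up, across, down: lifting by \<open>s\<close>, a Lipschitz constant times the distance,
  clears the graph between \<open>y\<close> and \<open>z\<close>, and all three edges stay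
  comparable to \<open>norm (z - y)\<close>.\<close>

lemma boundary_graph_chain:
  fixes \<Omega> :: "'a::euclidean_space set"
  assumes g: "boundary_graph \<Omega> x r e \<gamma>"
  shows "\<exists>\<rho>>0. \<exists>C\<ge>0. \<forall>y\<in>closure \<Omega> \<inter> ball x \<rho>. \<forall>z\<in>closure \<Omega> \<inter> ball x \<rho>. \<exists>p q.
      closed_segment y p \<subseteq> closure \<Omega> \<and> closed_segment p q \<subseteq> closure \<Omega> \<and> closed_segment q z \<subseteq> closure \<Omega> \<and>
      norm (p - y) \<le> C * norm (z - y) \<and> norm (q - p) \<le> C * norm (z - y) \<and> norm (z - q) \<le> C * norm (z - y)"
proof -
  have r: "r > 0" and e: "norm e = 1" and ck: "Ck 2 \<gamma>"
    and graph: "\<Omega> \<inter> ball x r = {y \<in> ball x r. y \<bullet> e > \<gamma> (y - (y \<bullet> e) *\<^sub>R e)}"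
    using g unfolding boundary_graph_def by auto
  have ee: "e \<bullet> e = 1" using e by (simp add: dot_square_norm)
  define P where "P y = y - (y \<bullet> e) *\<^sub>R e" for y
  have Pdiff: "P y - P z = P (y - z)" for y z by (simp add: P_def algebra_simps)
  have Pn: "norm (P y) \<le> 2 * norm y" for y
  proof -
    have "norm (P y) \<le> norm y + \<bar>y \<bullet> e\<bar> * norm e" unfolding P_def using norm_triangle_ineq4[of y "(y \<bullet> e) *\<^sub>R e"] by simp
    also have "\<bar>y \<bullet> e\<bar> \<le> norm y" using Cauchy_Schwarz_ineq2[of y e] e by simp
    finally show ?thesis using e by simp
  qed
  have Pe: "P (y + s *\<^sub>R e) = P y" for y s by (simp add: P_def inner_add_left ee algebra_simps)
  define R where "R = 2 * (norm x + r)"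
  obtain M where M: "M \<ge> 0" "\<And>a b. a \<in> cball 0 R \<Longrightarrow> b \<in> cball 0 R \<Longrightarrow> \<bar>\<gamma> a - \<gamma> b\<bar> \<le> M * norm (a - b)"
    by (rule Ck_1_lipschitz_cball[OF Ck_2D(4)[OF ck], of R]) blast
  \<comment> \<open>The factor 2 comes from the crude bound \<open>Pn\<close> on the projection
    \<open>P\<close>.\<close>
  define N where "N = 2 * M"
  have N: "N \<ge> 0" using M(1) by (simp add: N_def)
  have lip: "\<bar>\<gamma> (P y) - \<gamma> (P z)\<bar> \<le> N * norm (y - z)" if "y \<in> ball x r" "z \<in> ball x r" for y z
  proof -
    have "P w \<in> cball 0 R" if "w \<in> ball x r" for w
      using Pn[of w] norm_triangle_ineq2[of w x] that by (simp add: R_def dist_norm norm_minus_commute)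
    then have "\<bar>\<gamma> (P y) - \<gamma> (P z)\<bar> \<le> M * norm (P y - P z)" using that by (intro M) auto
    also have "\<dots> \<le> M * (2 * norm (y - z))" unfolding Pdiff using Pn M(1) by (intro mult_left_mono) auto
    finally show ?thesis by (simp add: N_def)
  qed
  have cP: "continuous_on UNIV P" unfolding P_def by (intro continuous_intros)
  have "continuous_on UNIV \<gamma>"
    using Ck_2D(1)[OF ck] by (auto intro!: continuous_at_imp_continuous_on differentiable_imp_continuous_within)
  then have cg: "continuous_on UNIV (\<lambda>y. \<gamma> (P y))"
    by (rule continuous_on_compose2[OF _ cP]) simp
  \<comment> \<open>Within the ball, \<open>below\<close> and \<open>above\<close> identify
    \<open>closure \<Omega>\<close> with the closed epigraph; from there a slight lift along
    \<open>e\<close> enters \<open>\<Omega>\<close>.\<close>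
  have below: "\<gamma> (P y) \<le> y \<bullet> e" if y: "y \<in> closure \<Omega>" "y \<in> ball x r" for y
  proof (rule ccontr)
    assume n: "\<not> \<gamma> (P y) \<le> y \<bullet> e"
    let ?U = "ball x r \<inter> {w. w \<bullet> e < \<gamma> (P w)}"
    have "open ?U" using cg by (intro open_Int open_ball open_Collect_less continuous_intros) auto
    moreover have "?U \<inter> \<Omega> = {}"
    proof -
      have "\<not> w \<bullet> e < \<gamma> (P w)" if "w \<in> \<Omega>" "w \<in> ball x r" for w
      proof -
        have "w \<in> {y \<in> ball x r. y \<bullet> e > \<gamma> (P y)}"
          using graph that unfolding P_def[symmetric] by blast
        then show ?thesis by simp
      qed
      then show ?thesis by blast
    qed
    ultimately have "?U \<inter> closure \<Omega> = {}" using open_Int_closure_eq_empty by blast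
    then show False using y n by auto
  qed
  have above: "y \<in> closure \<Omega>" if y: "y \<in> ball x r" "\<gamma> (P y) \<le> y \<bullet> e" for y
  proof (subst closure_approachable, intro allI impI)
    fix d :: real assume d: "d > 0"
    define s where "s = min d (r - dist x y) / 2"
    have s: "s > 0" "s < d" "s < r - dist x y" using d y(1) by (auto simp: s_def min_def field_simps)
    have dy: "dist (y + s *\<^sub>R e) y = s" using s e by (simp add: dist_norm)
    have "y + s *\<^sub>R e \<in> ball x r"
      using dist_triangle[of x "y + s *\<^sub>R e" y] dy s by (simp add: dist_commute)
    moreover have "(y + s *\<^sub>R e) \<bullet> e > \<gamma> (P (y + s *\<^sub>R e))"
      using y(2) s unfolding Pe by (simp add: inner_add_left ee)
    ultimately have "y + s *\<^sub>R e \<in> \<Omega>" using graph unfolding P_def by blast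
    moreover have "dist (y + s *\<^sub>R e) y < d" using dy s(2) by linarith
    ultimately show "\<exists>w\<in>\<Omega>. dist w y < d" by blast
  qed
  \<comment> \<open>Chosen so that points within \<open>\<rho>\<close> of \<open>x\<close>, lifted
    by at most \<open>2 * N * \<rho>\<close>, stay in the ball where the graph describes
    \<open>\<Omega>\<close>.\<close>
  define \<rho> where "\<rho> = r / (2 * N + 2)"
  have rho: "\<rho> > 0" using r N by (simp add: \<rho>_def)
  have rhor: "\<rho> + 2 * N * \<rho> < r"
  proof -
    have "(2 * N + 2) * \<rho> = r" using N by (simp add: \<rho>_def)
    then show ?thesis using rho by (simp add: algebra_simps)
  qed
  show ?thesis
  proof (rule exI[of _ \<rho>], rule conjI[OF rho], rule exI[of _ "N + 1"], intro conjI ballI)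
    show "0 \<le> N + 1" using N by simp
    fix y z assume y: "y \<in> closure \<Omega> \<inter> ball x \<rho>" and z: "z \<in> closure \<Omega> \<inter> ball x \<rho>"
    define s where "s = N * norm (z - y)"
    have nyz: "norm (z - y) \<le> 2 * \<rho>"
      using y z dist_triangle[of z y x] by (simp add: dist_norm norm_minus_commute)
    have s: "0 \<le> s" "s \<le> 2 * N * \<rho>" using N mult_left_mono[OF nyz N] by (simp_all add: s_def)
    have inr: "w + t *\<^sub>R e \<in> ball x r" if "w \<in> ball x \<rho>" "0 \<le> t" "t \<le> s" for w t
    proof -
      have "dist x (w + t *\<^sub>R e) \<le> dist x w + t"
        using dist_triangle[of x "w + t *\<^sub>R e" w] e that by (simp add: dist_norm)
      then show ?thesis using that s rhor by simp
    qed
    have yr: "y \<in> ball x r" "z \<in> ball x r" using inr[of y 0] inr[of z 0] y z s by auto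
    have gy: "\<gamma> (P y) \<le> y \<bullet> e" "\<gamma> (P z) \<le> z \<bullet> e" using below y z yr by auto
    have up: "closed_segment w (w + s *\<^sub>R e) \<subseteq> closure \<Omega>" if w: "w \<in> closure \<Omega> \<inter> ball x \<rho>" for w
    proof
      fix a assume "a \<in> closed_segment w (w + s *\<^sub>R e)"
      then obtain t where t: "0 \<le> t" "t \<le> 1" "a = (1 - t) *\<^sub>R w + t *\<^sub>R (w + s *\<^sub>R e)" unfolding in_segment by blast
      then have a: "a = w + (t * s) *\<^sub>R e" by (simp add: algebra_simps)
      have ts: "0 \<le> t * s" "t * s \<le> s" using t s by (auto simp: mult_left_le_one_le)
      have wr: "w \<in> ball x r" using inr[of w 0] w s by auto
      show "a \<in> closure \<Omega>"
      proof (rule above)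
        show "a \<in> ball x r" unfolding a using inr w ts by auto
        show "\<gamma> (P a) \<le> a \<bullet> e" unfolding a Pe using below[of w] w wr ts by (simp add: inner_add_left ee)
      qed
    qed
    have across: "closed_segment (y + s *\<^sub>R e) (z + s *\<^sub>R e) \<subseteq> closure \<Omega>"
    proof
      fix a assume "a \<in> closed_segment (y + s *\<^sub>R e) (z + s *\<^sub>R e)"
      then obtain t where t: "0 \<le> t" "t \<le> 1" "a = (1 - t) *\<^sub>R (y + s *\<^sub>R e) + t *\<^sub>R (z + s *\<^sub>R e)"
        unfolding in_segment by blast
      define w where "w = (1 - t) *\<^sub>R y + t *\<^sub>R z"
      have a: "a = w + s *\<^sub>R e" using t(3) by (simp add: w_def algebra_simps)
      have "w \<in> closed_segment y z" unfolding in_segment w_def using t by blast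
      then have wb: "w \<in> ball x \<rho>" using y z closed_segment_subset[of y "ball x \<rho>" z] by auto
      have wr: "w \<in> ball x r" using inr[of w 0] wb s by auto
      have "norm (w - y) = t * norm (z - y)"
      proof -
        have "w - y = t *\<^sub>R (z - y)" by (simp add: w_def algebra_simps)
        then show ?thesis using t by simp
      qed
      then have wy: "norm (w - y) \<le> norm (z - y)" using t by (simp add: mult_left_le_one_le)
      have "norm (w - z) = (1 - t) * norm (z - y)"
      proof -
        have "w - z = (1 - t) *\<^sub>R (y - z)" by (simp add: w_def algebra_simps)
        then show ?thesis using t by (simp add: norm_minus_commute)
      qed
      then have wz: "norm (w - z) \<le> norm (z - y)" using t by (simp add: mult_left_le_one_le)
      have 1: "\<gamma> (P w) \<le> y \<bullet> e + s"
        using lip[OF wr yr(1)] gy(1) mult_left_mono[OF wy N] unfolding s_def by linarith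
      have 2: "\<gamma> (P w) \<le> z \<bullet> e + s"
        using lip[OF wr yr(2)] gy(2) mult_left_mono[OF wz N] unfolding s_def by linarith
      \<comment> \<open>Both lifted endpoints are at least as high as the graph over
        \<open>w\<close>, hence so is their convex combination.\<close>
      have "\<gamma> (P w) = (1 - t) * \<gamma> (P w) + t * \<gamma> (P w)" by (simp add: algebra_simps)
      also have "\<dots> \<le> (1 - t) * (y \<bullet> e + s) + t * (z \<bullet> e + s)"
        using 1 2 t by (intro add_mono mult_left_mono) auto
      also have "\<dots> = a \<bullet> e" unfolding a w_def by (simp add: inner_add_left ee algebra_simps)
      finally have ge: "\<gamma> (P w) \<le> a \<bullet> e" .
      show "a \<in> closure \<Omega>"
      proof (rule above)
        show "a \<in> ball x r" unfolding a using inr wb s by auto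
        show "\<gamma> (P a) \<le> a \<bullet> e" using ge unfolding a Pe .
      qed
    qed
    have sl: "s \<le> (N + 1) * norm (z - y)" by (simp add: s_def algebra_simps)
    have nl: "norm (z - y) \<le> (N + 1) * norm (z - y)" using N by (simp add: algebra_simps)
    show "\<exists>p q. closed_segment y p \<subseteq> closure \<Omega> \<and> closed_segment p q \<subseteq> closure \<Omega> \<and> closed_segment q z \<subseteq> closure \<Omega> \<and>
      norm (p - y) \<le> (N + 1) * norm (z - y) \<and> norm (q - p) \<le> (N + 1) * norm (z - y) \<and> norm (z - q) \<le> (N + 1) * norm (z - y)"
    proof (rule exI[of _ "y + s *\<^sub>R e"], rule exI[of _ "z + s *\<^sub>R e"], intro conjI)
      show "closed_segment y (y + s *\<^sub>R e) \<subseteq> closure \<Omega>" by (rule up[OF y])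
      show "closed_segment (z + s *\<^sub>R e) z \<subseteq> closure \<Omega>" using up[OF z] by (simp add: closed_segment_commute)
      show "norm (y + s *\<^sub>R e - y) \<le> (N + 1) * norm (z - y)" "norm (z - (z + s *\<^sub>R e)) \<le> (N + 1) * norm (z - y)"
        using sl s e by auto
      show "norm (z + s *\<^sub>R e - (y + s *\<^sub>R e)) \<le> (N + 1) * norm (z - y)" using nl by simp
    qed (rule across)
  qed
qed

lemma C2_bounded_domain_chain:
  fixes \<Omega> :: "'a::euclidean_space set"
  assumes D: "C2_bounded_domain \<Omega>" and x: "x \<in> closure \<Omega>"
  shows "\<exists>\<rho>>0. \<exists>C\<ge>0. \<forall>y\<in>closure \<Omega> \<inter> ball x \<rho>. \<forall>z\<in>closure \<Omega> \<inter> ball x \<rho>. \<exists>p q.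
      closed_segment y p \<subseteq> closure \<Omega> \<and> closed_segment p q \<subseteq> closure \<Omega> \<and> closed_segment q z \<subseteq> closure \<Omega> \<and>
      norm (p - y) \<le> C * norm (z - y) \<and> norm (q - p) \<le> C * norm (z - y) \<and> norm (z - q) \<le> C * norm (z - y)"
proof (cases "x \<in> \<Omega>")
  case True
  have "open \<Omega>" using D unfolding C2_bounded_domain_def by blast
  then obtain \<rho> where rho: "\<rho> > 0" "ball x \<rho> \<subseteq> \<Omega>" using True open_contains_ball by blast
  show ?thesis
  proof (rule exI[of _ \<rho>], rule conjI[OF rho(1)], rule exI[of _ 1], intro conjI ballI)
    fix y z assume yz: "y \<in> closure \<Omega> \<inter> ball x \<rho>" "z \<in> closure \<Omega> \<inter> ball x \<rho>"
    then have "closed_segment y z \<subseteq> ball x \<rho>" by (simp add: closed_segment_subset)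
    then have "closed_segment y z \<subseteq> closure \<Omega>" using rho(2) closure_subset by blast
    then show "\<exists>p q. closed_segment y p \<subseteq> closure \<Omega> \<and> closed_segment p q \<subseteq> closure \<Omega> \<and> closed_segment q z \<subseteq> closure \<Omega> \<and>
      norm (p - y) \<le> 1 * norm (z - y) \<and> norm (q - p) \<le> 1 * norm (z - y) \<and> norm (z - q) \<le> 1 * norm (z - y)"
      using yz by (intro exI[where x=y, OF exI[where x=z]]) auto
  qed simp
next
  case False
  then have "x \<in> frontier \<Omega>" using x D unfolding C2_bounded_domain_def frontier_def by (simp add: interior_open)
  then obtain r e \<gamma> where "boundary_graph \<Omega> x r e \<gamma>" using D unfolding C2_bounded_domain_def by blast
  then show ?thesis by (rule boundary_graph_chain)
qed

section \<open>Rest points, Mather measures and the critical value\<close>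

lemma wasserstein1_nonneg:
  fixes K :: "'a::{second_countable_topology, metric_space} set"
  assumes "m1 \<in> prob_measures K" "m2 \<in> prob_measures K"
  shows "0 \<le> wasserstein1 m1 m2"
  unfolding wasserstein1_def using couplings_nonempty[OF assms] by (intro cINF_greatest) auto

text \<open>A quotient by distance 0 would be 0 and give no information, so distinct measures must
  have positive distance. \<open>max M 0\<close> avoids asking whether the set of quotients is
  nonempty.\<close>

lemma assm_F2_lipschitz:
  assumes "assm_F2 \<Omega> F" and K: "compact (closure \<Omega>)"
  obtains C where "C \<ge> 0" "\<And>m1 m2 x. m1 \<in> prob_measures (closure \<Omega>) \<Longrightarrow> m2 \<in> prob_measures (closure \<Omega>) \<Longrightarrow>
    \<bar>F x m1 - F x m2\<bar> \<le> C * wasserstein1 m1 m2"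
proof -
  obtain M where M: "\<And>r. r \<in> {\<bar>F x m1 - F x m2\<bar> / wasserstein1 m1 m2 | x m1 m2.
     m1 \<in> prob_measures (closure \<Omega>) \<and> m2 \<in> prob_measures (closure \<Omega>) \<and> m1 \<noteq> m2} \<Longrightarrow> r \<le> M"
    using assms(1) unfolding assm_F2_def bdd_above_def by blast
  show ?thesis
  proof (rule that[of "max M 0"])
    fix m1 m2 x assume m: "m1 \<in> prob_measures (closure \<Omega>)" "m2 \<in> prob_measures (closure \<Omega>)"
    have W: "0 \<le> wasserstein1 m1 m2" by (rule wasserstein1_nonneg[OF m])
    show "\<bar>F x m1 - F x m2\<bar> \<le> max M 0 * wasserstein1 m1 m2"
    proof (cases "m1 = m2")
      case False
      then have W: "0 < wasserstein1 m1 m2" using W wasserstein1_eq_0_imp_eq[OF K m] by force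
      have "\<bar>F x m1 - F x m2\<bar> / wasserstein1 m1 m2 \<le> M" by (rule M) (use m False in blast)
      then have "\<bar>F x m1 - F x m2\<bar> \<le> M * wasserstein1 m1 m2" using W by (simp add: pos_divide_le_eq)
      also have "\<dots> \<le> max M 0 * wasserstein1 m1 m2" using W by (intro mult_right_mono) auto
      finally show ?thesis .
    qed (use W in simp)
  qed simp
qed

text \<open>Points off the support lie in a basic open null set, and by second countability there
  are only countably many of these.\<close>

lemma AE_in_spt:
  fixes m :: "'a::second_countable_topology measure"
  assumes m: "m \<in> prob_measures K"
  shows "AE x in m. x \<in> spt m"
proof -
  obtain B :: "'a set set" where B: "countable B" "topological_basis B"
    using ex_countable_basis by blast
  let ?N = "{b \<in> B. emeasure m (b \<inter> space m) = 0}"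
  have "AE x in m. \<forall>b\<in>?N. x \<notin> b"
  proof (subst AE_ball_countable)
    show "countable ?N" using B(1) by simp
    show "\<forall>b\<in>?N. AE x in m. x \<notin> b"
    proof
      fix b assume b: "b \<in> ?N"
      then have "open b" using B(2) topological_basis_open by blast
      then have "b \<inter> K \<in> sets (restrict_space borel K)" by (auto simp: sets_restrict_space)
      then have "b \<inter> space m \<in> null_sets m"
        using b by (simp add: null_sets_def space_prob_measures[OF m] prob_measures_sets[OF m])
      then have "AE x in m. x \<notin> b \<inter> space m" by (rule AE_not_in)
      with AE_space show "AE x in m. x \<notin> b" by eventually_elim auto
    qed
  qed
  with AE_space show ?thesis
  proof eventually_elim
    case (elim x)
    have "emeasure m (U \<inter> space m) > 0" if U: "open U" "x \<in> U" for U
    proof (rule ccontr)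
      assume "\<not> emeasure m (U \<inter> space m) > 0"
      then have z: "emeasure m (U \<inter> space m) = 0" by simp
      obtain b where b: "b \<in> B" "x \<in> b" "b \<subseteq> U" using topological_basisE[OF B(2) U] by blast
      have "U \<inter> space m \<in> sets m"
        using U(1) by (auto simp: space_prob_measures[OF m] prob_measures_sets[OF m] sets_restrict_space)
      then have "emeasure m (b \<inter> space m) \<le> emeasure m (U \<inter> space m)" using b by (intro emeasure_mono) auto
      then show False using z b elim by auto
    qed
    then show ?case using elim unfolding spt_def by blast
  qed
qed

text \<open>Turns a closed condition that holds almost everywhere into one that holds on all of the
  support.\<close>

lemma AE_open_imp_spt:
  assumes m: "m \<in> prob_measures K" and U: "open U" and AE: "AE x in m. x \<notin> U" and x: "x \<in> spt m"
  shows "x \<notin> U"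
proof
  assume "x \<in> U"
  then have "emeasure m (U \<inter> space m) > 0" using x U unfolding spt_def by blast
  moreover have "U \<inter> space m \<in> sets m"
    using U by (auto simp: space_prob_measures[OF m] prob_measures_sets[OF m] sets_restrict_space)
  then have "emeasure m (U \<inter> space m) = 0"
    using AE by (intro iffD2[OF AE_iff_measurable[symmetric, of _ m "\<lambda>x. x \<notin> U"]]) auto
  ultimately show False by simp
qed

section \<open>Uniqueness of the ergodic constant\<close>

lemma Ck_1_quadratic: "Ck 1 (\<lambda>y::'a::euclidean_space. k * ((y - x) \<bullet> (y - x)))"
proof -
  have d: "((\<lambda>y. k * ((y - x) \<bullet> (y - x))) has_derivative (\<lambda>h. 2 * k * (h \<bullet> (y - x)))) (at y)" for y
    by (auto intro!: derivative_eq_intros simp: inner_commute)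
  have "dir_deriv h (\<lambda>y. k * ((y - x) \<bullet> (y - x))) = (\<lambda>y. 2 * k * (h \<bullet> (y - x)))" for h
    unfolding dir_deriv_def using frechet_derivative_at[OF d, symmetric] by auto
  moreover have "(\<lambda>y. k * ((y - x) \<bullet> (y - x))) differentiable (at y)" for y
    using d differentiableI by blast
  ultimately show ?thesis by (simp add: continuous_intros)
qed

text \<open>Any constant is determined by testing with constants at a minimum point of the solution, and
  with steep paraboloids touching it from above on a dense set.\<close>

lemma viscosity_constant_unique:
  fixes \<Omega> :: "'a::euclidean_space set"
  assumes O: "open \<Omega>" "bounded \<Omega>" "\<Omega> \<noteq> {}"
    and sol: "constrained_viscosity_solution \<Omega> G c w"
    and ge: "\<And>x p. g x \<le> G x p" and g0: "\<And>x. G x 0 = g x"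
    and cont: "continuous_on UNIV g"
    and x0: "x0 \<in> closure \<Omega>" "\<And>x. x \<in> closure \<Omega> \<Longrightarrow> g x \<le> g x0"
  shows "c = g x0"
proof (rule antisym)
  have K: "compact (closure \<Omega>)" using O(2) by (simp add: compact_closure)
  have wc: "continuous_on (closure \<Omega>) w" using sol unfolding constrained_viscosity_solution_def by blast
  have sub: "G x (grad \<phi> x) \<le> c" if "Ck 1 \<phi>" "x \<in> \<Omega>" "\<forall>\<^sub>F y in at x within \<Omega>. w y - \<phi> y \<le> w x - \<phi> x" for \<phi> x
    using sol that unfolding constrained_viscosity_solution_def by blast
  have super: "c \<le> G x (grad \<phi> x)" if "Ck 1 \<phi>" "x \<in> closure \<Omega>" "\<forall>\<^sub>F y in at x within closure \<Omega>. w y - \<phi> y \<ge> w x - \<phi> x" for \<phi> x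
    using sol that unfolding constrained_viscosity_solution_def by blast
  obtain x1 where x1: "x1 \<in> closure \<Omega>" "\<forall>y\<in>closure \<Omega>. w x1 \<le> w y"
    using continuous_attains_inf[OF K _ wc] O(3) by auto
  have "Ck 1 (\<lambda>y::'a. 0 * ((y - x1) \<bullet> (y - x1)))" by (rule Ck_1_quadratic)
  then have ck: "Ck 1 (\<lambda>y::'a. 0)" by simp
  have "GDERIV (\<lambda>y::'a. 0) x1 :> 0" by (rule GDERIV_const)
  then have "grad (\<lambda>y::'a. 0) x1 = 0" by (rule GDERIV_unique)
  moreover have "\<forall>\<^sub>F y in at x1 within closure \<Omega>. w y - 0 \<ge> w x1 - 0"
    using x1(2) by (auto simp: eventually_at intro: exI[of _ 1])
  ultimately have "c \<le> G x1 0" using super[OF ck x1(1)] by simp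
  then show "c \<le> g x0" using x0(2)[OF x1(1)] g0 by simp
  have "g x \<le> c" if x: "x \<in> \<Omega>" for x
  proof (rule ccontr)
    assume "\<not> g x \<le> c"
    then have "x \<in> {y. c < g y}" by simp
    moreover have "open {y. c < g y}" using cont by (intro open_Collect_less) auto
    ultimately obtain r1 where r1: "r1 > 0" "ball x r1 \<subseteq> {y. c < g y} \<inter> \<Omega>"
      using x O(1) open_contains_ball[of "{y. c < g y} \<inter> \<Omega>"] by (meson IntI open_Int)
    define r where "r = r1 / 2"
    have r: "r > 0" "cball x r \<subseteq> ball x r1" using r1(1) by (auto simp: r_def)
    have cb: "cball x r \<subseteq> closure \<Omega>" "cball x r \<subseteq> \<Omega>" using r r1(2) closure_subset by blast+
    have wcb: "continuous_on (cball x r) w" using wc cb(1) continuous_on_subset by blast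
    then have "bounded (w ` cball x r)" by (intro compact_imp_bounded compact_continuous_image) auto
    then obtain B where B: "B > 0" "\<forall>z\<in>w ` cball x r. norm z \<le> B" using bounded_pos by blast
    \<comment> \<open>With this steepness the paraboloid exceeds the oscillation of
      \<open>w\<close>, at most \<open>2 * B\<close>, on the sphere of radius \<open>r\<close>, so
      the maximum lies inside.\<close>
    define k where "k = (2 * B + 1) / r^2"
    let ?\<phi> = "\<lambda>y. k * ((y - x) \<bullet> (y - x))"
    have "continuous_on (cball x r) (\<lambda>y. w y - ?\<phi> y)" by (intro continuous_intros wcb)
    then obtain y1 where y1: "y1 \<in> cball x r" "\<forall>y\<in>cball x r. w y - ?\<phi> y \<le> w y1 - ?\<phi> y1"
      using continuous_attains_sup[of "cball x r" "\<lambda>y. w y - ?\<phi> y"] r(1) by auto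
    have "y1 \<in> ball x r"
    proof (rule ccontr)
      assume "y1 \<notin> ball x r"
      then have "norm (y1 - x) = r" using y1(1) by (simp add: dist_norm norm_minus_commute)
      then have "?\<phi> y1 = 2 * B + 1" using r(1) by (simp add: dot_square_norm k_def)
      moreover have "w x - ?\<phi> x \<le> w y1 - ?\<phi> y1" using bspec[OF y1(2), of x] r(1) by simp
      moreover have "norm (w x) \<le> B" "norm (w y1) \<le> B" using B(2) y1(1) r(1) by auto
      then have "- B \<le> w x" "w y1 \<le> B" by (auto simp: abs_le_iff)
      ultimately show False by simp
    qed
    then obtain d where d: "d > 0" "ball y1 d \<subseteq> ball x r" using open_contains_ball open_ball by blast
    have "\<forall>\<^sub>F y in at y1 within \<Omega>. w y - ?\<phi> y \<le> w y1 - ?\<phi> y1"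
      unfolding eventually_at
    proof (intro exI[of _ d] conjI ballI impI d(1))
      fix y assume "y \<in> \<Omega>" "y \<noteq> y1 \<and> dist y y1 < d"
      then have "y \<in> ball x r" using d(2) by (auto simp: dist_commute)
      then show "w y - ?\<phi> y \<le> w y1 - ?\<phi> y1" using y1(2) by auto
    qed
    then have "G y1 (grad ?\<phi> y1) \<le> c" using cb(2) y1(1) by (intro sub Ck_1_quadratic) auto
    then have "g y1 \<le> c" using ge[of y1 "grad ?\<phi> y1"] by linarith
    moreover have "c < g y1" using y1(1) r(2) r1(2) by blast
    ultimately show False by linarith
  qed
  then show "g x0 \<le> c"
    using continuous_le_on_closure[OF continuous_on_subset[OF cont] x0(1)] by blast
qed

section \<open>Rest points and Mather measures\<close>

lemma reversible_tonelli_l0_continuous: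
  assumes "reversible_tonelli L"
  shows "continuous_on UNIV (\<lambda>x. L x 0)"
proof -
  interpret reversible_tonelli L by fact
  have "continuous_on UNIV (\<lambda>x. Lpair (x, 0))"
    by (rule continuous_on_compose2[OF continuous_Lpair]) (auto intro!: continuous_intros)
  then show ?thesis by simp
qed

text \<open>The rest points minimise \<open>L x 0\<close> over the whole space, not just over
  \<open>closure \<Omega>\<close>, so \<open>D_x L x 0\<close> vanishes even on the boundary and
  \<open>(x, 0)\<close> is an equilibrium. The measure is the image of \<open>m\<close> under
  \<open>x \<mapsto> (x, 0)\<close>.\<close>

lemma mather_measure_of_rest_points:
  fixes \<Omega> :: "'a::euclidean_space set"
  assumes L: "reversible_tonelli L" and m: "m \<in> prob_measures (closure \<Omega>)"
    and x0: "\<And>y. L x0 0 \<le> L y 0" and AE: "AE x in m. L x 0 = L x0 0"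
  shows "\<exists>\<eta>. mather_measure \<Omega> L \<eta> \<and> m = distr \<eta> (restrict_space borel (closure \<Omega>)) fst"
proof -
  interpret reversible_tonelli L by (rule L)
  let ?K = "closure \<Omega>" and ?N = "restrict_space borel (closure \<Omega> \<times> UNIV :: ('a \<times> 'a) set)"
  let ?j = "\<lambda>x. (x, 0 :: 'a)"
  have jb: "?j \<in> borel_measurable m"
    using measurable_id_prob_measures[OF m] by (intro borel_measurable_Pair) auto
  have jm: "?j \<in> measurable m ?N"
    using jb by (intro measurable_restrict_space2) (auto simp: space_prob_measures[OF m])
  define \<eta> where "\<eta> = distr m ?N ?j"
  have eta: "\<eta> \<in> prob_measures (?K \<times> UNIV)"
    unfolding \<eta>_def by (rule distr_in_prob_measures[OF prob_measures_prob[OF m] jm])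
  have inf: "(INF y. L y 0) = L x0 0"
    by (rule antisym[OF cINF_lower cINF_greatest]) (use x0 in \<open>auto intro!: bdd_belowI2[of _ "L x0 0"]\<close>)
  have ext: "extend_measure_borel \<eta> = distr m borel ?j"
    unfolding extend_measure_borel_def \<eta>_def
    by (subst distr_distr) (use jm in \<open>auto simp: o_def intro: measurable_restrict_space1\<close>)
  have rest: "D_x L x 0 = 0" if "L x 0 = L x0 0" for x
  proof -
    have "(\<lambda>h. h \<bullet> D_x L x 0) = (\<lambda>h. 0)"
      using x0 that by (intro has_derivative_local_min[OF GDERIV_D_x[unfolded gderiv_def]] always_eventually allI) simp
    then have "D_x L x 0 \<bullet> D_x L x 0 = 0" by metis
    then show ?thesis by simp
  qed
  have flow: "distr (extend_measure_borel \<eta>) borel (EL_flow L t) = extend_measure_borel \<eta>" for t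
  proof -
    have F: "EL_flow L t \<in> borel_measurable borel"
      by (rule borel_measurable_continuous_onI[OF EL_flow_properties(1)])
    have "distr (extend_measure_borel \<eta>) borel (EL_flow L t) = distr m borel (\<lambda>x. EL_flow L t (x, 0))"
      unfolding ext using distr_distr[OF F jb] by (simp add: o_def)
    also have "\<dots> = distr m borel ?j"
    proof (rule distr_cong_AE)
      show "AE x in m. EL_flow L t (x, 0) = (x, 0)"
        using AE by eventually_elim (intro EL_flow_properties(2) rest)
      show "(\<lambda>x. EL_flow L t (x, 0)) \<in> borel_measurable m" by (rule measurable_compose[OF jb F])
    qed (use jb in auto)
    finally show ?thesis unfolding ext .
  qed
  have AE\<eta>: "AE z in \<eta>. snd z = 0 \<and> L (fst z) 0 = L x0 0"
  proof -
    have c: "closed {z :: 'a \<times> 'a. snd z = 0 \<and> L (fst z) 0 = L x0 0}"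
      by (intro closed_Collect_conj closed_Collect_eq continuous_intros
          continuous_on_compose2[OF reversible_tonelli_l0_continuous[OF L]]) auto
    have "{z \<in> space ?N. snd z = 0 \<and> L (fst z) 0 = L x0 0} \<in> sets ?N"
    proof -
      have "{z \<in> space ?N. snd z = 0 \<and> L (fst z) 0 = L x0 0} = {z. snd z = 0 \<and> L (fst z) 0 = L x0 0} \<inter> (?K \<times> UNIV)"
        by auto
      then show ?thesis using borel_closed[OF c] by (auto simp: sets_restrict_space)
    qed
    then show ?thesis unfolding \<eta>_def using AE by (subst AE_distr_iff[OF jm]) auto
  qed
  have "spt \<eta> \<subseteq> {(x, 0) | x. x \<in> ?K \<and> L x 0 = (INF y. L y 0)}"
  proof
    fix z assume z: "z \<in> spt \<eta>"
    have zK: "fst z \<in> ?K" using z space_prob_measures[OF eta] unfolding spt_def by auto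
    have "open (- {z :: 'a \<times> 'a. snd z = 0 \<and> L (fst z) 0 = L x0 0})"
      by (intro open_Compl closed_Collect_conj closed_Collect_eq continuous_intros
          continuous_on_compose2[OF reversible_tonelli_l0_continuous[OF L]]) auto
    from AE_open_imp_spt[OF eta this _ z] AE\<eta> have "snd z = 0 \<and> L (fst z) 0 = L x0 0" by auto
    then show "z \<in> {(x, 0) | x. x \<in> ?K \<and> L x 0 = (INF y. L y 0)}" using zK inf by (cases z) auto
  qed
  then have "mather_measure \<Omega> L \<eta>" unfolding mather_measure_def using eta flow by blast
  moreover have "m = distr \<eta> (restrict_space borel ?K) fst"
  proof -
    have f: "fst \<in> measurable ?N (restrict_space borel ?K)"
    proof (rule measurable_restrict_space2)
      have "(fst :: 'a \<times> 'a \<Rightarrow> 'a) \<in> borel_measurable borel" by (intro borel_measurable_continuous_onI continuous_intros)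
      then show "fst \<in> measurable ?N borel" by (rule measurable_restrict_space1)
    qed auto
    show ?thesis unfolding \<eta>_def
      using distr_distr[OF f jm] distr_id2[OF prob_measures_sets[OF m, symmetric]] by (simp add: o_def)
  qed
  ultimately show ?thesis by blast
qed

section \<open>The mean field game system\<close>

lemma C2b_imp_continuous:
  assumes "C2b g"
  shows "continuous_on S g"
proof -
  have "g differentiable (at x)" for x using assms Ck_2D(1) unfolding C2b_def by blast
  then show ?thesis
    by (intro continuous_at_imp_continuous_on ballI differentiable_imp_continuous_within)
qed

text \<open>Uniqueness yields equality of the couplings on \<open>closure \<Omega>\<close> only;
  this is all that the critical value sees.\<close>

lemma critical_value_cong:
  assumes "\<And>x p. x \<in> closure \<Omega> \<Longrightarrow> G x p = G' x p"
  shows "critical_value \<Omega> G = critical_value \<Omega> G'"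
proof -
  have e: "G x p = G' x p" if "x \<in> \<Omega>" for x p
    using assms[of x p] closure_subset[of \<Omega>] that by blast
  have "constrained_viscosity_solution \<Omega> G = constrained_viscosity_solution \<Omega> G'"
    by (intro ext) (simp add: constrained_viscosity_solution_def assms e cong: ball_cong)
  then show ?thesis unfolding critical_value_def by simp
qed

lemma C2_bounded_domainD:
  assumes "C2_bounded_domain \<Omega>"
  shows "open \<Omega>" "bounded \<Omega>" "\<Omega> \<noteq> {}" "compact (closure \<Omega>)" "connected (closure \<Omega>)"
  using assms unfolding C2_bounded_domain_def by (auto simp: compact_closure connected_imp_connected_closure)

locale mfg =
  fixes \<Omega> :: "'a::euclidean_space set" and L :: "'a \<Rightarrow> 'a \<Rightarrow> real" and F :: "'a \<Rightarrow> 'a measure \<Rightarrow> real"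
  assumes dom: "C2_bounded_domain \<Omega>" and ton: "strict_tonelli L" and rev: "reversible L"
    and F1: "assm_F1 \<Omega> F" and F2: "assm_F2 \<Omega> F" and A2: "assm_A2 \<Omega> L F"
begin

lemmas dom_facts = C2_bounded_domainD[OF dom]

lemma F_C2b: "m \<in> prob_measures (closure \<Omega>) \<Longrightarrow> C2b (\<lambda>x. F x m)"
  using F1 unfolding assm_F1_def by blast

lemma rt_L: "reversible_tonelli L"
  by standard (rule ton rev)+

lemma rt_Lm: "m \<in> prob_measures (closure \<Omega>) \<Longrightarrow> reversible_tonelli (L_mf L F m)"
  by (rule L_mf_reversible_tonelli(1)[OF ton rev F_C2b])

lemma continuous_cost: "m \<in> prob_measures (closure \<Omega>) \<Longrightarrow> continuous_on S (\<lambda>x. L_mf L F m x 0)"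
  using continuous_on_subset[OF reversible_tonelli_l0_continuous[OF rt_Lm]] by blast

lemma rest_point:
  assumes "m \<in> prob_measures (closure \<Omega>)"
  obtains x0 where "x0 \<in> closure \<Omega>" "\<And>y. L_mf L F m x0 0 \<le> L_mf L F m y 0"
proof -
  have "{x. is_arg_min (\<lambda>y. L y 0 + F y m) (\<lambda>_. True) x} \<inter> closure \<Omega> \<noteq> {}"
    using A2 assms unfolding assm_A2_def by blast
  then show ?thesis using that unfolding is_arg_min_def L_mf_def by (force simp: not_less)
qed

text \<open>At the minimum point \<open>x0\<close> the variational inequality says that the mean of
  the cost is at most its minimum, so the cost is minimal almost everywhere.\<close>

lemma exists_rest_measure:
  obtains m where "m \<in> prob_measures (closure \<Omega>)"
    "\<And>x0. (\<And>y. L_mf L F m x0 0 \<le> L_mf L F m y 0) \<Longrightarrow> x0 \<in> closure \<Omega> \<Longrightarrow> AE x in m. L_mf L F m x 0 = L_mf L F m x0 0"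
proof -
  obtain C where C: "C \<ge> 0" "\<And>m1 m2 x. m1 \<in> prob_measures (closure \<Omega>) \<Longrightarrow> m2 \<in> prob_measures (closure \<Omega>) \<Longrightarrow>
    \<bar>F x m1 - F x m2\<bar> \<le> C * wasserstein1 m1 m2"
    by (fact assm_F2_lipschitz[OF F2 dom_facts(4)])
  obtain m where m: "m \<in> prob_measures (closure \<Omega>)"
    and le: "\<And>y. y \<in> closure \<Omega> \<Longrightarrow> (\<integral>x. L_mf L F m x 0 \<partial>m) \<le> L_mf L F m y 0"
  proof (rule exists_equilibrium_measure[where f="\<lambda>x m. L_mf L F m x 0" and C=C, OF dom_facts(4)])
    show "closure \<Omega> \<noteq> {}" using dom_facts(3) by simp
    show "\<bar>L_mf L F m1 x 0 - L_mf L F m2 x 0\<bar> \<le> C * wasserstein1 m1 m2"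
      if "m1 \<in> prob_measures (closure \<Omega>)" "m2 \<in> prob_measures (closure \<Omega>)" for m1 m2 x
      using C(2)[OF that, of x] by (simp add: L_mf_def)
  qed (use C(1) continuous_cost in auto)
  show ?thesis
  proof (rule that[OF m])
    fix x0 assume x0: "\<And>y. L_mf L F m x0 0 \<le> L_mf L F m y 0" "x0 \<in> closure \<Omega>"
    interpret prob_space m by (rule prob_measures_prob[OF m])
    have i: "integrable m (\<lambda>x. L_mf L F m x 0)"
      by (rule integrable_prob_measures[OF dom_facts(4) continuous_cost[OF m] m])
    have i': "integrable m (\<lambda>x. L_mf L F m x 0 - L_mf L F m x0 0)" using i by simp
    have e: "(\<integral>x. L_mf L F m x 0 - L_mf L F m x0 0 \<partial>m) = (\<integral>x. L_mf L F m x 0 \<partial>m) - L_mf L F m x0 0"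
      using i by (simp add: prob_space)
    have "0 \<le> (\<integral>x. L_mf L F m x 0 - L_mf L F m x0 0 \<partial>m)"
      using x0(1) by (intro integral_nonneg_AE) auto
    then have "(\<integral>x. L_mf L F m x 0 - L_mf L F m x0 0 \<partial>m) = 0" using e le[OF x0(2)] by linarith
    then have "AE x in m. L_mf L F m x 0 - L_mf L F m x0 0 = 0"
      using integral_nonneg_eq_0_iff_AE[OF i'] x0(1) by simp
    then show "AE x in m. L_mf L F m x 0 = L_mf L F m x0 0" by eventually_elim simp
  qed
qed

text \<open>By reversibility \<open>H_mf L F m x\<close> is minimal at momentum 0, with value minus
  the rest cost; the constant is the maximum of these minima over
  \<open>closure \<Omega>\<close>.\<close>

lemma critical_value_eq:
  assumes m: "m \<in> prob_measures (closure \<Omega>)" and x0: "x0 \<in> closure \<Omega>" "\<And>y. L_mf L F m x0 0 \<le> L_mf L F m y 0"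
    and sol: "constrained_viscosity_solution \<Omega> (H_mf L F m) c w"
  shows "c = - L_mf L F m x0 0"
proof (rule viscosity_constant_unique[where g="\<lambda>x. - L_mf L F m x 0", OF dom_facts(1-3) sol])
  interpret reversible_tonelli L by (rule rt_L)
  show "- L_mf L F m x 0 \<le> H_mf L F m x p" for x p
    using hamiltonian_ge_0[of x p] by (simp add: L_mf_def H_mf_def)
  show "H_mf L F m x 0 = - L_mf L F m x 0" for x
    by (simp add: L_mf_def H_mf_def hamiltonian_0)
  show "continuous_on UNIV (\<lambda>x. - L_mf L F m x 0)" by (intro continuous_intros continuous_cost m)
qed (use x0 in auto)

lemma exists_viscosity_solution:
  assumes m: "m \<in> prob_measures (closure \<Omega>)" and x0: "x0 \<in> closure \<Omega>" "\<And>y. L_mf L F m x0 0 \<le> L_mf L F m y 0"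
  obtains w where "constrained_viscosity_solution \<Omega> (H_mf L F m) (- L_mf L F m x0 0) w"
    "\<And>x. x \<in> closure \<Omega> \<Longrightarrow> L_mf L F m x 0 = L_mf L F m x0 0 \<Longrightarrow> (w has_derivative (\<lambda>h. 0)) (at x within closure \<Omega>)"
proof -
  let ?l = "L_mf L F m"
  interpret Lm: reversible_tonelli ?l by (rule rt_Lm[OF m])
  interpret L: reversible_tonelli L by (rule rt_L)
  \<comment> \<open>Subtracting the minimal rest cost moves the constant of the equation to 0 and
    makes \<open>lag\<close> nonnegative, with \<open>lag x 0 = 0\<close> exactly at the rest
    points.\<close>
  define lag where "lag x v = ?l x v - ?l x0 0" for x v
  have cl: "continuous_on UNIV (\<lambda>(x, v). lag x v)"
  proof -
    have "continuous_on UNIV (\<lambda>z. Lm.Lpair z - ?l x0 0)" by (intro continuous_intros Lm.continuous_Lpair)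
    then show ?thesis by (simp add: lag_def case_prod_beta')
  qed
  interpret N: nonneg_lagrangian "closure \<Omega>" lag "1 / (4 * Lm.C1)" "Lm.C1"
  proof
    show "compact (closure \<Omega>)" "connected (closure \<Omega>)" by (rule dom_facts)+
    show "continuous_on UNIV (\<lambda>(x, v). lag x v)" by (rule cl)
    show "0 \<le> lag x 0" for x using x0(2)[of x] by (simp add: lag_def)
    show "lag x 0 + 1 / (4 * Lm.C1) * norm v^2 \<le> lag x v" for x v
      using Lm.L_lower[of x v] by (simp add: lag_def)
    show "lag x v \<le> lag x 0 + Lm.C1 * norm v^2" for x v
      using Lm.L_upper[of x v] by (simp add: lag_def)
    show "0 < 1 / (4 * Lm.C1)" "0 \<le> Lm.C1" using Lm.C1(1) by auto
    show "\<exists>x\<in>closure \<Omega>. lag x 0 = 0" using x0(1) by (auto simp: lag_def)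
  qed (rule C2_bounded_domain_chain[OF dom])
  show ?thesis
  proof (rule that[of N.u])
    show "constrained_viscosity_solution \<Omega> (H_mf L F m) (- ?l x0 0) N.u"
      unfolding constrained_viscosity_solution_def
    proof (intro conjI allI impI ballI)
      show "continuous_on (closure \<Omega>) N.u" by (rule N.continuous_on_u)
      fix \<phi> :: "'a \<Rightarrow> real" and x assume \<phi>: "Ck 1 \<phi>"
      {
        assume "x \<in> \<Omega>" "\<forall>\<^sub>F y in at x within \<Omega>. N.u y - \<phi> y \<le> N.u x - \<phi> x"
        then have "grad \<phi> x \<bullet> v \<le> lag x v" for v
          by (intro N.u_subsolution[OF dom_facts(1) closure_subset _ \<phi>])
        then have "hamiltonian L x (grad \<phi> x) \<le> F x m - ?l x0 0"
          by (intro L.hamiltonian_le) (simp add: lag_def L_mf_def algebra_simps)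
        then show "H_mf L F m x (grad \<phi> x) \<le> - ?l x0 0" by (simp add: H_mf_def)
      }
      {
        assume x: "x \<in> closure \<Omega>" "\<forall>\<^sub>F y in at x within closure \<Omega>. N.u x - \<phi> x \<le> N.u y - \<phi> y"
        show "- ?l x0 0 \<le> H_mf L F m x (grad \<phi> x)"
        proof (rule ccontr)
          assume n: "\<not> - ?l x0 0 \<le> H_mf L F m x (grad \<phi> x)"
          \<comment> \<open>The gap of the failing inequality serves as \<open>\<eta>\<close>, since
            the supersolution property is available up to an arbitrary positive error.\<close>
          define e where "e = - ?l x0 0 - H_mf L F m x (grad \<phi> x)"
          have "e > 0" using n by (simp add: e_def)
          then obtain v where "grad \<phi> x \<bullet> v - lag x v > - e" using N.u_supersolution[OF x(1) \<phi> x(2)] by blast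
          moreover have "grad \<phi> x \<bullet> v - L x v \<le> hamiltonian L x (grad \<phi> x)" by (rule L.hamiltonian_ge)
          ultimately show False by (simp add: e_def lag_def L_mf_def H_mf_def)
        qed
      }
    qed
    show "(N.u has_derivative (\<lambda>h. 0)) (at x within closure \<Omega>)"
      if "x \<in> closure \<Omega>" "?l x 0 = ?l x0 0" for x
      using that by (intro N.u_has_derivative_rest) (simp_all add: lag_def)
  qed
qed

lemma critical_value_rest:
  assumes m: "m \<in> prob_measures (closure \<Omega>)" and x0: "x0 \<in> closure \<Omega>" "\<And>y. L_mf L F m x0 0 \<le> L_mf L F m y 0"
  shows "critical_value \<Omega> (H_mf L F m) = - L_mf L F m x0 0"
  unfolding critical_value_def
proof (rule the_equality)
  show "\<exists>u. constrained_viscosity_solution \<Omega> (H_mf L F m) (- L_mf L F m x0 0) u"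
    by (rule exists_viscosity_solution[OF m x0]) blast
qed (use critical_value_eq[OF m x0] in blast)

lemma grad_eq_0_outside_support:
  fixes f :: "'a \<Rightarrow> real"
  assumes "x \<notin> closure {x. f x \<noteq> 0}"
  shows "grad f x = 0"
proof (rule GDERIV_unique)
  have z: "0 = f y" if "y \<in> - closure {x. f x \<noteq> 0}" for y
    using that closure_subset[of "{x. f x \<noteq> 0}"] by auto
  have "(f has_derivative (\<lambda>h. 0)) (at x)"
    by (rule has_derivative_transform_within_open[OF has_derivative_const[of 0], of "- closure {x. f x \<noteq> 0}", OF _ _ z])
       (use assms in auto)
  then show "GDERIV f x :> 0" by (simp add: gderiv_def)
qed

lemma exists_solution: "\<exists>w m. mfg_solution \<Omega> L F (critical_value \<Omega> (H_mf L F m)) w m"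
proof -
  interpret L: reversible_tonelli L by (rule rt_L)
  obtain m where m: "m \<in> prob_measures (closure \<Omega>)" and AE0:
    "\<And>x0. (\<And>y. L_mf L F m x0 0 \<le> L_mf L F m y 0) \<Longrightarrow> x0 \<in> closure \<Omega> \<Longrightarrow> AE x in m. L_mf L F m x 0 = L_mf L F m x0 0"
    by (fact exists_rest_measure)
  obtain x0 where x0: "x0 \<in> closure \<Omega>" "\<And>y. L_mf L F m x0 0 \<le> L_mf L F m y 0"
    by (fact rest_point[OF m])
  note AE = AE0[OF x0(2,1)]
  obtain w where w: "constrained_viscosity_solution \<Omega> (H_mf L F m) (- L_mf L F m x0 0) w"
    "\<And>x. x \<in> closure \<Omega> \<Longrightarrow> L_mf L F m x 0 = L_mf L F m x0 0 \<Longrightarrow> (w has_derivative (\<lambda>h. 0)) (at x within closure \<Omega>)"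
    by (fact exists_viscosity_solution[OF m x0])
  have spt: "L_mf L F m x 0 = L_mf L F m x0 0" if x: "x \<in> spt m" for x
  proof -
    have "open {x. L_mf L F m x 0 \<noteq> L_mf L F m x0 0}"
      by (intro open_Collect_neq continuous_cost m continuous_intros)
    from AE_open_imp_spt[OF m this _ x] AE show ?thesis by simp
  qed
  have D: "AE x in m. w differentiable (at x within closure \<Omega>)"
    using AE AE_space
  proof eventually_elim
    case (elim x)
    then show ?case using w(2)[of x] space_prob_measures[OF m] differentiableI by blast
  qed
  \<comment> \<open>The integrand vanishes identically: off \<open>\<Omega>\<close> the test
    function has zero gradient, on the support within \<open>\<Omega>\<close> the solution has
    gradient 0 and hence no drift, and elsewhere in \<open>\<Omega>\<close> the field is 0 by
    definition.\<close>
  have field: "grad f x \<bullet> mfg_field \<Omega> L F w m x = 0" if f: "closure {x. f x \<noteq> 0} \<subseteq> \<Omega>" for f :: "'a \<Rightarrow> real" and x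
  proof (cases "x \<in> \<Omega>")
    case False
    then have "grad f x = 0" using f by (intro grad_eq_0_outside_support) blast
    then show ?thesis by simp
  next
    case True
    then have nf: "x \<notin> frontier \<Omega>" using dom_facts(1) by (simp add: frontier_def interior_open)
    show ?thesis
    proof (cases "x \<in> spt m")
      case s: True
      have xi: "x \<in> interior (closure \<Omega>)"
        using True dom_facts(1) closure_subset by (meson interior_maximal subsetD)
      have "(w has_derivative (\<lambda>h. 0)) (at x within closure \<Omega>)"
        using w(2) spt[OF s] True closure_subset by blast
      then have d: "(w has_derivative (\<lambda>h. 0)) (at x)" by (simp add: at_within_interior[OF xi])
      then have "GDERIV w x :> 0" by (simp add: gderiv_def)
      then have "grad w x = 0" by (rule GDERIV_unique)
      then show ?thesis using True s d differentiableI[OF d]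
        by (simp add: mfg_field_def L.D_v_hamiltonian_0)
    qed (use nf in \<open>simp add: mfg_field_def\<close>)
  qed
  have "mfg_solution \<Omega> L F (- L_mf L F m x0 0) w m"
    unfolding mfg_solution_def
  proof (intro conjI m w(1) D allI impI)
    show "continuous_on (closure \<Omega>) w" using w(1) unfolding constrained_viscosity_solution_def by blast
    show "\<exists>\<eta>. mather_measure \<Omega> (L_mf L F m) \<eta> \<and> m = distr \<eta> (restrict_space borel (closure \<Omega>)) fst"
      by (rule mather_measure_of_rest_points[OF rt_Lm[OF m] m x0(2) AE])
    show "has_bochner_integral m (\<lambda>x. grad f x \<bullet> mfg_field \<Omega> L F w m x) 0"
      if "smooth f \<and> closure {x. f x \<noteq> 0} \<subseteq> \<Omega>" for f
      using that by (simp add: field has_bochner_integral_zero)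
  qed
  then show ?thesis unfolding critical_value_rest[OF m x0, symmetric] by blast
qed

section \<open>Monotonicity and uniqueness\<close>

lemma mather_projection_rest:
  assumes m: "m \<in> prob_measures (closure \<Omega>)" and x0: "x0 \<in> closure \<Omega>" "\<And>y. L_mf L F m x0 0 \<le> L_mf L F m y 0"
    and \<eta>: "mather_measure \<Omega> (L_mf L F m) \<eta>" "m = distr \<eta> (restrict_space borel (closure \<Omega>)) fst"
  shows "AE x in m. L_mf L F m x 0 = L_mf L F m x0 0"
proof -
  have eta: "\<eta> \<in> prob_measures (closure \<Omega> \<times> UNIV)" using \<eta>(1) unfolding mather_measure_def by blast
  have inf: "(INF y. L_mf L F m y 0) = L_mf L F m x0 0"
    by (rule antisym[OF cINF_lower cINF_greatest]) (use x0 in \<open>auto intro!: bdd_belowI2[of _ "L_mf L F m x0 0"]\<close>)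
  \<comment> \<open>The support of \<open>\<eta>\<close> has full measure, so the pointwise
    condition in \<open>mather_measure\<close> becomes an almost sure one and passes to the
    projection.\<close>
  have AE: "AE z in \<eta>. L_mf L F m (fst z) 0 = L_mf L F m x0 0"
    using AE_in_spt[OF eta]
  proof eventually_elim
    case (elim z)
    then have "z \<in> {(x, 0) | x. x \<in> closure \<Omega> \<and> L_mf L F m x 0 = (INF y. L_mf L F m y 0)}"
      using \<eta>(1) unfolding mather_measure_def by blast
    then show ?case using inf by auto
  qed
  have f: "fst \<in> measurable \<eta> (restrict_space borel (closure \<Omega>))"
  proof (rule measurable_restrict_space2)
    show "fst \<in> space \<eta> \<rightarrow> closure \<Omega>" using space_prob_measures[OF eta] by auto
    show "fst \<in> borel_measurable \<eta>"
      using measurable_compose[OF measurable_id_prob_measures[OF eta], of fst borel]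
      by (simp add: borel_measurable_continuous_onI continuous_on_fst[OF continuous_on_id])
  qed
  have "closed {x. L_mf L F m x 0 = L_mf L F m x0 0}"
    by (intro closed_Collect_eq continuous_cost m continuous_intros)
  then have "{x \<in> closure \<Omega>. L_mf L F m x 0 = L_mf L F m x0 0} \<in> sets (restrict_space borel (closure \<Omega>))"
    by (auto simp: sets_restrict_space intro!: image_eqI[where x="{x. L_mf L F m x 0 = L_mf L F m x0 0}"])
  then show ?thesis
    by (subst \<eta>(2)) (subst AE_distr_iff[OF f], use AE in auto)
qed

lemma uniqueness:
  assumes F3: "assm_F3 \<Omega> F"
    and s1: "mfg_solution \<Omega> L F c1 u1 m1" and s2: "mfg_solution \<Omega> L F c2 u2 m2"
  shows "\<forall>x\<in>closure \<Omega>. F x m1 = F x m2"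
proof -
  let ?K = "closure \<Omega>"
  have m1: "m1 \<in> prob_measures ?K" and m2: "m2 \<in> prob_measures ?K"
    using s1 s2 unfolding mfg_solution_def by blast+
  have Fc: "continuous_on S (\<lambda>x. F x m)" if "m \<in> prob_measures ?K" for m S
    by (rule C2b_imp_continuous[OF F_C2b[OF that]])
  have iF: "integrable m (\<lambda>x. F x m')" if "m \<in> prob_measures ?K" "m' \<in> prob_measures ?K" for m m'
    by (rule integrable_prob_measures[OF dom_facts(4) Fc[OF that(2)] that(1)])
  have Lc: "continuous_on ?K (\<lambda>x. L x 0)"
    using continuous_on_subset[OF reversible_tonelli_l0_continuous[OF rt_L]] by blast
  have iL: "integrable m (\<lambda>x. L x 0)" if "m \<in> prob_measures ?K" for m
    by (rule integrable_prob_measures[OF dom_facts(4) Lc that])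
  \<comment> \<open>Each solution minimises the linear functional obtained by freezing
    \<open>F\<close> at its own measure. Adding the two inequalities cancels the terms with
    \<open>L x 0\<close>.\<close>
  have opt: "(\<integral>x. L x 0 \<partial>m) + (\<integral>x. F x m \<partial>m) \<le> (\<integral>x. L x 0 \<partial>m') + (\<integral>x. F x m \<partial>m')"
    if s: "mfg_solution \<Omega> L F c w m" and m': "m' \<in> prob_measures ?K" for c w m m'
  proof -
    have m: "m \<in> prob_measures ?K" using s unfolding mfg_solution_def by blast
    obtain x0 where x0: "x0 \<in> closure \<Omega>" "\<And>y. L_mf L F m x0 0 \<le> L_mf L F m y 0"
      by (fact rest_point[OF m])
    obtain \<eta> where \<eta>: "mather_measure \<Omega> (L_mf L F m) \<eta>" "m = distr \<eta> (restrict_space borel ?K) fst"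
      using s unfolding mfg_solution_def by blast
    interpret m: prob_space m by (rule prob_measures_prob[OF m])
    interpret m': prob_space m' by (rule prob_measures_prob[OF m'])
    have "(\<integral>x. L x 0 + F x m \<partial>m) = (\<integral>x. L_mf L F m x0 0 \<partial>m)"
    proof (rule integral_cong_AE)
      show "AE x in m. L x 0 + F x m = L_mf L F m x0 0"
        using mather_projection_rest[OF m x0 \<eta>] by (simp add: L_mf_def)
    qed (use iL[OF m] iF[OF m m] in auto)
    also have "\<dots> = (\<integral>x. L_mf L F m x0 0 \<partial>m')" by (simp add: m.prob_space m'.prob_space)
    also have "\<dots> \<le> (\<integral>x. L x 0 + F x m \<partial>m')"
      using x0(2) iL[OF m'] iF[OF m' m] by (intro integral_mono) (auto simp: L_mf_def)
    finally show ?thesis using iL[OF m] iF[OF m m] iL[OF m'] iF[OF m' m] by simp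
  qed
  have "(\<integral>x. F x m1 - F x m2 \<partial>m1) - (\<integral>x. F x m1 - F x m2 \<partial>m2) \<le> 0"
    using opt[OF s1 m2] opt[OF s2 m1] iF m1 m2 by simp
  moreover obtain C where "C > 0" and C: "(\<integral>x. F x m1 - F x m2 \<partial>m1) - (\<integral>x. F x m1 - F x m2 \<partial>m2)
       \<ge> C * (LINT x:?K|lborel. (F x m1 - F x m2)\<^sup>2)"
    using F3 m1 m2 unfolding assm_F3_def by blast
  ultimately have "C * (LINT x:?K|lborel. (F x m1 - F x m2)\<^sup>2) \<le> 0" by linarith
  then have le: "(LINT x:?K|lborel. (F x m1 - F x m2)\<^sup>2) \<le> 0"
    using \<open>C > 0\<close> by (simp add: mult_le_0_iff)
  let ?g = "\<lambda>x. indicator ?K x *\<^sub>R (F x m1 - F x m2)\<^sup>2 :: real"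
  have "continuous_on ?K (\<lambda>x. (F x m1 - F x m2)\<^sup>2)" by (intro continuous_intros Fc m1 m2)
  then have ig: "integrable lborel ?g" by (rule borel_integrable_compact[OF dom_facts(4)])
  have "0 \<le> (\<integral>x. ?g x \<partial>lborel)" by (intro integral_nonneg_AE) auto
  then have "(\<integral>x. ?g x \<partial>lborel) = 0" using le unfolding set_lebesgue_integral_def by linarith
  then have AE: "AE x in lborel. ?g x = 0"
    using integral_nonneg_eq_0_iff_AE[OF ig] by simp
  \<comment> \<open>A nonempty open set is not negligible, so equality almost everywhere becomes
    equality everywhere in \<open>\<Omega>\<close>, and by continuity in its closure.\<close>
  let ?U = "{x. F x m1 \<noteq> F x m2} \<inter> \<Omega>"
  have oU: "open ?U" by (intro open_Int dom_facts(1) open_Collect_neq Fc m1 m2)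
  have "AE x in lborel. x \<notin> ?U"
    using AE by eventually_elim (use closure_subset in \<open>auto simp: indicator_def split: if_splits\<close>)
  then have "?U \<in> null_sets lborel" using oU by (subst AE_iff_null_sets) auto
  then have "negligible ?U" unfolding negligible_iff_null_sets by (rule null_sets_completionI)
  then have "?U = {}" using open_not_negligible[OF oU] by blast
  then have "F x m1 - F x m2 = 0" if "x \<in> \<Omega>" for x using that by auto
  then have "F x m1 - F x m2 = 0" if "x \<in> ?K" for x
    using continuous_constant_on_closure[of \<Omega> "\<lambda>x. F x m1 - F x m2" 0 x] that
    by (simp add: continuous_intros Fc m1 m2)
  then show ?thesis by simp
qed

end

theorem theorem4p4:
  fixes \<Omega> :: "'a::euclidean_space set"
    and L :: "'a \<Rightarrow> 'a \<Rightarrow> real"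
    and F :: "'a \<Rightarrow> 'a measure \<Rightarrow> real"
  assumes "C2_bounded_domain \<Omega>"
    and "strict_tonelli L" and "reversible L"
    and "assm_F1 \<Omega> F" and "assm_F2 \<Omega> F" and "assm_A2 \<Omega> L F"
  shows "(\<exists>u m. mfg_solution \<Omega> L F (critical_value \<Omega> (H_mf L F m)) u m) \<and>
    (assm_F3 \<Omega> F \<longrightarrow>
      (\<forall>u1 m1 u2 m2.
        mfg_solution \<Omega> L F (critical_value \<Omega> (H_mf L F m1)) u1 m1 \<and>
        mfg_solution \<Omega> L F (critical_value \<Omega> (H_mf L F m2)) u2 m2 \<longrightarrow>
        (\<forall>x\<in>closure \<Omega>. F x m1 = F x m2) \<and>
        critical_value \<Omega> (H_mf L F m1) = critical_value \<Omega> (H_mf L F m2)))"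
proof -
  interpret mfg \<Omega> L F by standard (rule assms)+
  show ?thesis
  proof (intro conjI impI allI exists_solution)
    fix u1 m1 u2 m2
    assume "assm_F3 \<Omega> F"
      and "mfg_solution \<Omega> L F (critical_value \<Omega> (H_mf L F m1)) u1 m1 \<and>
        mfg_solution \<Omega> L F (critical_value \<Omega> (H_mf L F m2)) u2 m2"
    then show eq: "\<forall>x\<in>closure \<Omega>. F x m1 = F x m2" using uniqueness by blast
    then show "critical_value \<Omega> (H_mf L F m1) = critical_value \<Omega> (H_mf L F m2)"
      by (intro critical_value_cong) (simp add: H_mf_def)
  qed
qed

end
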